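(* Let $g$ be a Carter background metric with zero scalar curvature ($k=0$), let $\Omega=[r_-,r_+]\times[x_-,x_+]$ be a bounded connected regular timelike slab (i.e. $\rho^2,\Delta_r,\Delta_x,A>0$ on it), with reflecting boundary conditions for which the constant function belongs to the operator domain (all as defined in the context). Consider the axisymmetric conformal equation $\Box_gu=0$, $\partial_\phi u=0$, on $\mathbb R_t\times\Omega$. Then: (i) The weighted spatial operator $L_0=A^{-1}\mathcal H_0$ is nonnegative and self-adjoint on $L^2_A(\Omega)$. Its kernel is one-dimensional and is generated by the constant function $1$. (ii) The generalized zero-mode space for the time evolution is exactly $\mathrm{span}\{1,t\}$. Equivalently, every polynomial-in-$t$ axisymmetric solution is affine in $t$ (of the form $c_0+c_1t$ with constants $c_0,c_1$). (iii) Every axisymmetric solution in the energy class $u\in C(\mathbb R;H^1(\Omega))$, $u_t\in C(\mathbb R;L^2(\Omega))$ admits a unique decomposition $$u(t,r,x)=c_0+c_1t+v(t,r,x),$$ where $c_0,c_1$ are constants (real for real-valued $u$), the $A$-weighted averages of $v(t,\cdot)$ and $v_t(t,\cdot)$ vanish for all $t$, and $$\sup_{t\in\mathbb R}\bigl(\|v(t)\|_{H^1(\Omega)}+\|v_t(t)\|_{L^2(\Omega)}\bigr)\le C\bigl(\|v(0)\|_{H^1(\Omega)}+\|v_t(0)\|_{L^2(\Omega)}\bigr)$$ with $C$ independent of $u$. In particular the axisymmetric conformal dynamics are linearly stable modulo the finite-dimensional generalized zero-mode space. (iv) There are no nontrivial separated axisymmetric modes $u=e^{-i\sigma t}\psi(r,x)$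 with $\operatorname{Im}\sigma>0$.
   Context: **Carter background ($k=0$).** Fix real parameters $a,M,\Lambda,C_1,\dots,C_5$ and set $\alpha_2=1-\frac{\Lambda a^2}{3}+\frac{C_1}{2}$. In coordinates $(t,\phi,r,x)$, $-1\le x\le1$, put $\rho^2=r^2+a^2x^2$, $$\Delta_r(r)=\alpha_2r^2+(C_2-2M)r+(a^2+C_3),\qquad \Delta_x(x)=-\alpha_2x^2-C_4x+(1+C_5),$$ $$g=-\frac{\Delta_r}{\rho^2}\bigl(dt-a(1-x^2)d\phi\bigr)^2+\frac{\Delta_x}{\rho^2}\bigl((r^2+a^2)d\phi-a\,dt\bigr)^2+\frac{\rho^2}{\Delta_r}dr^2+\frac{\rho^2}{\Delta_x}dx^2 .$$ Define $A=-\rho^2g^{tt}=\frac{(r^2+a^2)^2}{\Delta_r}-\frac{a^2(1-x^2)^2}{\Delta_x}$. For $\phi$-independent $u$, $\Box_gu=0$ reads $$Au_{tt}+\mathcal H_0u=0,\qquad \mathcal H_0=-\partial_r(\Delta_r\partial_r)-\partial_x(\Delta_x\partial_x).$$ **Realization.** $L^2_A(\Omega)$ is $L^2(\Omega)$ with inner product $\langle f,h\rangle_A=\int_\Omega Af\overline h\,dr\,dx$. Reflecting boundary conditions admitting constants mean a form domain $V_{\rm ax}\subset H^1(\Omega)$, a closed subspace dense in $L^2(\Omega)$, invariant under complex conjugation, with $1\in V_{\rm ax}$, for the form $q_0[u,v]=\int_\Omega(\Delta_ru_r\overline{v_r}+\Delta_xu_x\overline{v_x})\,dr\,dx$; $L_0$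 is the operator on $L^2_A(\Omega)$ associated with this form, $q_0[u,v]=\langle L_0u,v\rangle_A$ for $u\in\mathrm{Dom}(L_0)$, $v\in V_{\rm ax}$. Axisymmetric solutions are (weak) solutions of $u_{tt}+L_0u=0$ with $u(t)\in V_{\rm ax}$; separated modes satisfy $L_0\psi=\sigma^2\psi$. The $A$-weighted average of $f$ is $\int_\Omega Af/\int_\Omega A$. A polynomial-in-$t$ solution (generalized zero mode) is a sufficiently regular solution of the form $\sum_{j=0}^Nt^j\psi_j(r,x)$ (with $\psi_j\in\mathrm{Dom}(L_0)$). *)

theory Defs
  imports "HOL-Analysis.Analysis"
begin

record carter =
  car_a :: real
  car_M :: real
  car_Lambda :: real
  car_C1 :: real
  car_C2 :: real
  car_C3 :: real
  car_C4 :: real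
  car_C5 :: real

definition alpha2 :: "carter \<Rightarrow> real" where
  "alpha2 P = 1 - car_Lambda P * (car_a P)\<^sup>2 / 3 + car_C1 P / 2"

definition rho2 :: "carter \<Rightarrow> real \<times> real \<Rightarrow> real" where
  "rho2 P = (\<lambda>(r, x). r\<^sup>2 + (car_a P)\<^sup>2 * x\<^sup>2)"

definition Delta_r :: "carter \<Rightarrow> real \<Rightarrow> real" where
  "Delta_r P r = alpha2 P * r\<^sup>2 + (car_C2 P - 2 * car_M P) * r + ((car_a P)\<^sup>2 + car_C3 P)"

definition Delta_x :: "carter \<Rightarrow> real \<Rightarrow> real" where
  "Delta_x P x = - alpha2 P * x\<^sup>2 - car_C4 P * x + (1 + car_C5 P)"

text \<open>Coordinate indices: 1, 2, 3, 4 stand for $t, \phi, r, x$. The metric components do not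
  depend on $t$ and $\phi$, so they are functions of $(r,x)$.\<close>

definition theta_t :: "carter \<Rightarrow> real \<times> real \<Rightarrow> real^4" where
  "theta_t P = (\<lambda>(r, x). axis 1 1 - (car_a P * (1 - x\<^sup>2)) *\<^sub>R axis 2 1)"

definition theta_phi :: "carter \<Rightarrow> real \<times> real \<Rightarrow> real^4" where
  "theta_phi P = (\<lambda>(r, x). (r\<^sup>2 + (car_a P)\<^sup>2) *\<^sub>R axis 2 1 - car_a P *\<^sub>R axis 1 1)"

definition carter_metric :: "carter \<Rightarrow> real \<times> real \<Rightarrow> real^4^4" where
  "carter_metric P p = (\<chi> i j.
     - (Delta_r P (fst p) / rho2 P p) * (theta_t P p $ i * theta_t P p $ j)
     + (Delta_x P (snd p) / rho2 P p) * (theta_phi P p $ i * theta_phi P p $ j)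
     + (rho2 P p / Delta_r P (fst p)) * (axis 3 1 $ i * axis 3 1 $ j)
     + (rho2 P p / Delta_x P (snd p)) * (axis 4 1 $ i * axis 4 1 $ j))"

definition A_weight :: "carter \<Rightarrow> real \<times> real \<Rightarrow> real" where
  "A_weight P p = - rho2 P p * matrix_inv (carter_metric P p) $ 1 $ 1"

definition regular_timelike_slab :: "carter \<Rightarrow> (real \<times> real) set \<Rightarrow> bool" where
  "regular_timelike_slab P \<Omega> \<longleftrightarrow>
     (\<exists>r0 r1 x0 x1. r0 < r1 \<and> - 1 \<le> x0 \<and> x0 < x1 \<and> x1 \<le> 1 \<and> \<Omega> = {r0..r1} \<times> {x0..x1}) \<and>
     (\<forall>p\<in>\<Omega>. rho2 P p > 0 \<and> Delta_r P (fst p) > 0 \<and> Delta_x P (snd p) > 0 \<and> A_weight P p > 0)"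

definition partial4 :: "4 \<Rightarrow> (real^4 \<Rightarrow> complex) \<Rightarrow> real^4 \<Rightarrow> complex" where
  "partial4 i f q = vector_derivative (\<lambda>s. f (q + s *\<^sub>R axis i 1)) (at 0)"

text \<open>The Laplace--Beltrami operator
  $|g|^{-1/2} \partial_\mu(|g|^{1/2} g^{\mu\nu} \partial_\nu f)$ of the Carter metric.\<close>

definition wave_op :: "carter \<Rightarrow> (real^4 \<Rightarrow> complex) \<Rightarrow> real^4 \<Rightarrow> complex" where
  "wave_op P f q =
     (let g = (\<lambda>q. carter_metric P (q $ 3, q $ 4)); vol = (\<lambda>q. sqrt \<bar>det (g q)\<bar>)
      in (\<Sum>\<mu>\<in>UNIV. partial4 \<mu>
            (\<lambda>q. \<Sum>\<nu>\<in>UNIV. of_real (vol q * matrix_inv (g q) $ \<mu> $ \<nu>) * partial4 \<nu> f q) q) / of_real (vol q))"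

definition carter_coinv :: "carter \<Rightarrow> real \<times> real \<Rightarrow> real^4^4" where
  "carter_coinv P p = (let r = fst p; x = snd p; a = car_a P;
      e0 = (r\<^sup>2 + a\<^sup>2) *\<^sub>R axis 1 1 + a *\<^sub>R axis 2 1 :: real^4;
      e1 = (a * (1 - x\<^sup>2)) *\<^sub>R axis 1 1 + axis 2 1 :: real^4 in (\<chi> i j.
     - (1 / (Delta_r P r * rho2 P p)) * (e0 $ i * e0 $ j)
     + (1 / (Delta_x P x * rho2 P p)) * (e1 $ i * e1 $ j)
     + (Delta_r P r / rho2 P p) * (axis 3 1 $ i * axis 3 1 $ j)
     + (Delta_x P x / rho2 P p) * (axis 4 1 $ i * axis 4 1 $ j)))"

lemma det_4:
  "det (A::real^4^4) =
    A$1$1 * (A$2$2 * A$3$3 * A$4$4 + A$2$3 * A$3$4 * A$4$2 + A$2$4 * A$3$2 * A$4$3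
           - A$2$2 * A$3$4 * A$4$3 - A$2$3 * A$3$2 * A$4$4 - A$2$4 * A$3$3 * A$4$2)
  - A$1$2 * (A$2$1 * A$3$3 * A$4$4 + A$2$3 * A$3$4 * A$4$1 + A$2$4 * A$3$1 * A$4$3
           - A$2$1 * A$3$4 * A$4$3 - A$2$3 * A$3$1 * A$4$4 - A$2$4 * A$3$3 * A$4$1)
  + A$1$3 * (A$2$1 * A$3$2 * A$4$4 + A$2$2 * A$3$4 * A$4$1 + A$2$4 * A$3$1 * A$4$2
           - A$2$1 * A$3$4 * A$4$2 - A$2$2 * A$3$1 * A$4$4 - A$2$4 * A$3$2 * A$4$1)
  - A$1$4 * (A$2$1 * A$3$2 * A$4$3 + A$2$2 * A$3$3 * A$4$1 + A$2$3 * A$3$1 * A$4$2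
           - A$2$1 * A$3$3 * A$4$2 - A$2$2 * A$3$1 * A$4$3 - A$2$3 * A$3$2 * A$4$1)"
proof -
  have f1: "finite {2::4, 3, 4}" "1 \<notin> {2::4, 3, 4}" by auto
  have f2: "finite {3::4, 4}" "2 \<notin> {3::4, 4}" by auto
  have f3: "finite {4::4}" "3 \<notin> {4::4}" by auto
  show ?thesis
    unfolding det_def UNIV_4
    unfolding sum_over_permutations_insert[OF f1]
    unfolding sum_over_permutations_insert[OF f2]
    unfolding sum_over_permutations_insert[OF f3]
    unfolding permutes_sing
    by (simp add: sign_swap_id permutation_swap_id sign_compose sign_id swap_id_eq permutation_compose algebra_simps)
qed

lemma matrix_inv_eqI:
  fixes B C :: "real^'n^'n"
  assumes "B ** C = mat 1" shows "matrix_inv B = C"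
proof -
  have "C ** B = mat 1" using assms matrix_left_right_inverse by blast
  then have "invertible B" using assms invertible_def by blast
  then have "matrix_inv B ** B = mat 1" unfolding invertible_def matrix_inv_def by (rule someI2_ex) blast
  then have "matrix_inv B ** (B ** C) = C" by (simp add: matrix_mul_assoc)
  then show ?thesis using assms by simp
qed

lemma rho2_eq: "rho2 P p = ((fst p)\<^sup>2 + (car_a P)\<^sup>2) - (car_a P)\<^sup>2 * (1 - (snd p)\<^sup>2)"
  by (simp add: rho2_def split_beta algebra_simps)

lemma carter_inverse:
  assumes "rho2 P p \<noteq> 0" "Delta_r P (fst p) \<noteq> 0" "Delta_x P (snd p) \<noteq> 0"
  shows "matrix_inv (carter_metric P p) = carter_coinv P p"
proof (rule matrix_inv_eqI)
  define R S a D E \<rho> where "R = (fst p)\<^sup>2 + (car_a P)\<^sup>2" and "S = 1 - (snd p)\<^sup>2"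
    and "a = car_a P" and "D = Delta_r P (fst p)" and "E = Delta_x P (snd p)" and "\<rho> = rho2 P p"
  have R: "R = \<rho> + a\<^sup>2 * S" unfolding \<rho>_def rho2_eq R_def S_def a_def by simp
  have nz: "\<rho> \<noteq> 0" "D \<noteq> 0" "E \<noteq> 0" using assms by (simp_all add: \<rho>_def D_def E_def)
  have m: "carter_metric P p = (\<chi> i j.
      - (D / \<rho>) * ((axis 1 1 - (a * S) *\<^sub>R axis 2 1) $ i * (axis 1 1 - (a * S) *\<^sub>R axis 2 1) $ j)
      + (E / \<rho>) * ((R *\<^sub>R axis 2 1 - a *\<^sub>R axis 1 1) $ i * (R *\<^sub>R axis 2 1 - a *\<^sub>R axis 1 1) $ j)
      + (\<rho> / D) * (axis 3 1 $ i * axis 3 1 $ j)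
      + (\<rho> / E) * (axis 4 1 $ i * axis 4 1 $ j))"
    unfolding carter_metric_def theta_t_def theta_phi_def split_beta R_def S_def a_def D_def E_def \<rho>_def ..
  have c: "carter_coinv P p = (\<chi> i j.
     - (1 / (D * \<rho>)) * ((R *\<^sub>R axis 1 1 + a *\<^sub>R axis 2 1) $ i * (R *\<^sub>R axis 1 1 + a *\<^sub>R axis 2 1) $ j)
     + (1 / (E * \<rho>)) * (((a * S) *\<^sub>R axis 1 1 + axis 2 1) $ i * ((a * S) *\<^sub>R axis 1 1 + axis 2 1) $ j)
     + (D / \<rho>) * (axis 3 1 $ i * axis 3 1 $ j)
     + (E / \<rho>) * (axis 4 1 $ i * axis 4 1 $ j))"
    unfolding carter_coinv_def Let_def R_def S_def a_def D_def E_def \<rho>_def ..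
  show "carter_metric P p ** carter_coinv P p = mat 1"
    unfolding m c using nz
    by (simp add: vec_eq_iff forall_4 matrix_matrix_mult_def sum_4 mat_def axis_def R field_simps power2_eq_square)
qed

lemma A_weight_closed_form:
  assumes "rho2 P (r, x) \<noteq> 0" "Delta_r P r \<noteq> 0" "Delta_x P x \<noteq> 0"
  shows "A_weight P (r, x) =
    (r\<^sup>2 + (car_a P)\<^sup>2)\<^sup>2 / Delta_r P r - (car_a P)\<^sup>2 * (1 - x\<^sup>2)\<^sup>2 / Delta_x P x"
  using assms carter_inverse[of P "(r, x)"]
  by (simp add: A_weight_def carter_coinv_def Let_def axis_def field_simps power2_eq_square)

lemma det_carter_metric:
  assumes "rho2 P p \<noteq> 0" "Delta_r P (fst p) \<noteq> 0" "Delta_x P (snd p) \<noteq> 0"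
  shows "det (carter_metric P p) = - (rho2 P p)\<^sup>2"
proof -
  define R S a D E \<rho> where "R = (fst p)\<^sup>2 + (car_a P)\<^sup>2" and "S = 1 - (snd p)\<^sup>2"
    and "a = car_a P" and "D = Delta_r P (fst p)" and "E = Delta_x P (snd p)" and "\<rho> = rho2 P p"
  have R: "R = \<rho> + a\<^sup>2 * S" unfolding \<rho>_def rho2_eq R_def S_def a_def by simp
  have nz: "\<rho> \<noteq> 0" "D \<noteq> 0" "E \<noteq> 0" using assms by (simp_all add: \<rho>_def D_def E_def)
  have m: "carter_metric P p = (\<chi> i j.
      - (D / \<rho>) * ((axis 1 1 - (a * S) *\<^sub>R axis 2 1) $ i * (axis 1 1 - (a * S) *\<^sub>R axis 2 1) $ j)
      + (E / \<rho>) * ((R *\<^sub>R axis 2 1 - a *\<^sub>R axis 1 1) $ i * (R *\<^sub>R axis 2 1 - a *\<^sub>R axis 1 1) $ j)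
      + (\<rho> / D) * (axis 3 1 $ i * axis 3 1 $ j)
      + (\<rho> / E) * (axis 4 1 $ i * axis 4 1 $ j))"
    unfolding carter_metric_def theta_t_def theta_phi_def split_beta R_def S_def a_def D_def E_def \<rho>_def ..
  show ?thesis unfolding m \<rho>_def[symmetric] using nz
    by (simp add: det_4 axis_def R field_simps power2_eq_square)
qed

text \<open>For $\phi$-independent \<open>f\<close> this reads
  $\Box_g f = - \rho^{-2} (A f_{tt} + \mathcal H_0 f)$, which is the origin of the weight
  \<open>A_weight\<close> and of the form \<open>q0\<close> below.\<close>

lemma axisymmetric_wave_op:
  assumes pos: "rho2 P (q $ 3, q $ 4) > 0" "Delta_r P (q $ 3) > 0" "Delta_x P (q $ 4) > 0"
    and axi: "\<And>q s. f (q + s *\<^sub>R axis 2 1) = f q"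
    and diff: "(\<lambda>s. partial4 1 f (q + s *\<^sub>R axis 1 1)) differentiable (at 0)"
  shows "wave_op P f q =
    - (of_real (A_weight P (q $ 3, q $ 4)) * partial4 1 (partial4 1 f) q
       - partial4 3 (\<lambda>q. of_real (Delta_r P (q $ 3)) * partial4 3 f q) q
       - partial4 4 (\<lambda>q. of_real (Delta_x P (q $ 4)) * partial4 4 f q) q)
      / of_real (rho2 P (q $ 3, q $ 4))"
proof -
  define G where "G \<mu> q = (\<Sum>\<nu>\<in>UNIV. of_real (sqrt \<bar>det (carter_metric P (q $ 3, q $ 4))\<bar> *
      matrix_inv (carter_metric P (q $ 3, q $ 4)) $ \<mu> $ \<nu>) * partial4 \<nu> f q)" for \<mu> and q :: "real^4"
  have f2: "partial4 2 f q = 0" for q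
    unfolding partial4_def axi by (simp add: vector_derivative_const_at)
  have axi2: "partial4 \<nu> f (q + s *\<^sub>R axis 2 1) = partial4 \<nu> f q" for \<nu> s q
  proof -
    have "f (q + s *\<^sub>R axis 2 1 + t *\<^sub>R axis \<nu> 1) = f (q + t *\<^sub>R axis \<nu> 1)" for t
      using axi[of "q + t *\<^sub>R axis \<nu> 1" s] by (simp add: algebra_simps)
    then show ?thesis unfolding partial4_def by simp
  qed
  let ?ok = "\<lambda>q::real^4. rho2 P (q $ 3, q $ 4) > 0 \<and> Delta_r P (q $ 3) > 0 \<and> Delta_x P (q $ 4) > 0"
  have G: "G 1 q = of_real (- A_weight P (q $ 3, q $ 4)) * partial4 1 f q"
      "G 3 q = of_real (Delta_r P (q $ 3)) * partial4 3 f q"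
      "G 4 q = of_real (Delta_x P (q $ 4)) * partial4 4 f q" if "?ok q" for q
  proof -
    have s: "sqrt \<bar>det (carter_metric P (q $ 3, q $ 4))\<bar> = rho2 P (q $ 3, q $ 4)"
      using that det_carter_metric[of P "(q $ 3, q $ 4)"] by simp
    have i: "matrix_inv (carter_metric P (q $ 3, q $ 4)) = carter_coinv P (q $ 3, q $ 4)"
      using that by (intro carter_inverse) auto
    show "G 1 q = of_real (- A_weight P (q $ 3, q $ 4)) * partial4 1 f q"
      unfolding G_def s sum_4 f2 A_weight_def i using that
      by (simp add: carter_coinv_def Let_def axis_def)
    show "G 3 q = of_real (Delta_r P (q $ 3)) * partial4 3 f q"
      "G 4 q = of_real (Delta_x P (q $ 4)) * partial4 4 f q"
      unfolding G_def s sum_4 f2 i using that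
      by (simp_all add: carter_coinv_def Let_def axis_def)
  qed
  have ev: "eventually (\<lambda>s. ?ok (q + s *\<^sub>R axis i 1)) (nhds 0)" for i
  proof -
    have t1: "((\<lambda>s. rho2 P ((q + s *\<^sub>R axis i 1) $ 3, (q + s *\<^sub>R axis i 1) $ 4)) \<longlongrightarrow> rho2 P (q $ 3, q $ 4)) (nhds 0)"
      unfolding rho2_def prod.case by (rule tendsto_eq_intros refl filterlim_ident | simp)+
    have t2: "((\<lambda>s. Delta_r P ((q + s *\<^sub>R axis i 1) $ 3)) \<longlongrightarrow> Delta_r P (q $ 3)) (nhds 0)"
      unfolding Delta_r_def by (rule tendsto_eq_intros refl filterlim_ident | simp)+
    have t3: "((\<lambda>s. Delta_x P ((q + s *\<^sub>R axis i 1) $ 4)) \<longlongrightarrow> Delta_x P (q $ 4)) (nhds 0)"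
      unfolding Delta_x_def by (rule tendsto_eq_intros refl filterlim_ident | simp)+
    show ?thesis
      using order_tendstoD(1)[OF t1 pos(1)] order_tendstoD(1)[OF t2 pos(2)] order_tendstoD(1)[OF t3 pos(3)]
      by eventually_elim auto
  qed
  have p1: "partial4 1 (G 1) q = of_real (- A_weight P (q $ 3, q $ 4)) * partial4 1 (partial4 1 f) q"
  proof -
    have "(\<lambda>s. G 1 (q + s *\<^sub>R axis 1 1)) =
        (\<lambda>s. of_real (- A_weight P (q $ 3, q $ 4)) * partial4 1 f (q + s *\<^sub>R axis 1 1))"
      using G(1) pos by (simp add: axis_def)
    then show ?thesis
      using diff unfolding partial4_def[of 1 "G 1"] partial4_def[of 1 "partial4 1 f"]
      by (simp only: vector_derivative_mult_at[OF differentiable_const] vector_derivative_const_at) simp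
  qed
  have "G 2 (q + s *\<^sub>R axis 2 1) = G 2 q" for s
    unfolding G_def axi2 by (simp add: axis_def)
  then have p2: "partial4 2 (G 2) q = 0"
    unfolding partial4_def by (simp add: vector_derivative_const_at)
  have p3: "partial4 3 (G 3) q = partial4 3 (\<lambda>q. of_real (Delta_r P (q $ 3)) * partial4 3 f q) q"
    unfolding partial4_def[of 3 "G 3"] partial4_def[of 3 "\<lambda>q. of_real (Delta_r P (q $ 3)) * partial4 3 f q"]
    by (rule vector_derivative_cong_eq) (use ev[of 3] in \<open>auto elim!: eventually_mono simp: G(2)\<close>)
  have p4: "partial4 4 (G 4) q = partial4 4 (\<lambda>q. of_real (Delta_x P (q $ 4)) * partial4 4 f q) q"
    unfolding partial4_def[of 4 "G 4"] partial4_def[of 4 "\<lambda>q. of_real (Delta_x P (q $ 4)) * partial4 4 f q"]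
    by (rule vector_derivative_cong_eq) (use ev[of 4] in \<open>auto elim!: eventually_mono simp: G(3)\<close>)
  have vol: "sqrt \<bar>det (carter_metric P (q $ 3, q $ 4))\<bar> = rho2 P (q $ 3, q $ 4)"
    using pos det_carter_metric[of P "(q $ 3, q $ 4)"] by simp
  have "wave_op P f q = (\<Sum>\<mu>\<in>UNIV. partial4 \<mu> (G \<mu>) q) / of_real (rho2 P (q $ 3, q $ 4))"
    unfolding wave_op_def Let_def G_def[abs_def] vol ..
  then have "wave_op P f q = (partial4 1 (G 1) q + partial4 2 (G 2) q + partial4 3 (G 3) q + partial4 4 (G 4) q)
      / of_real (rho2 P (q $ 3, q $ 4))"
    by (simp only: sum_4)
  then show ?thesis unfolding p1 p2 p3 p4 by simp
qed

text \<open>Elements of $L^2(\Omega)$ and $H^1(\Omega)$ are represented by functions on the whole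
  plane. Their values off \<open>\<Omega>\<close> are irrelevant, and equality means almost-everywhere equality
  on \<open>\<Omega>\<close>.\<close>

type_synonym scalar_field = "real \<times> real \<Rightarrow> complex"

definition ae_eq :: "(real \<times> real) set \<Rightarrow> scalar_field \<Rightarrow> scalar_field \<Rightarrow> bool" where
  "ae_eq \<Omega> f g \<longleftrightarrow> (AE p in lebesgue_on \<Omega>. f p = g p)"

definition L2 :: "(real \<times> real) set \<Rightarrow> scalar_field set" where
  "L2 \<Omega> = {f \<in> borel_measurable (lebesgue_on \<Omega>). integrable (lebesgue_on \<Omega>) (\<lambda>p. (cmod (f p))\<^sup>2)}"

definition L2_norm :: "(real \<times> real) set \<Rightarrow> scalar_field \<Rightarrow> real" where
  "L2_norm \<Omega> f = sqrt (LINT p|lebesgue_on \<Omega>. (cmod (f p))\<^sup>2)"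

text \<open>Weak derivatives in the direction \<open>b\<close> are tested against $C^1_c$ functions on the interior
  of \<open>\<Omega>\<close>, as in Gilbarg--Trudinger; this is equivalent to testing against $C^\infty_c$.\<close>

definition test_function ::
    "(real \<times> real) set \<Rightarrow> (real \<times> real \<Rightarrow> real) \<Rightarrow> (real \<times> real \<Rightarrow> real \<times> real \<Rightarrow> real) \<Rightarrow> bool" where
  "test_function \<Omega> \<phi> \<phi>' \<longleftrightarrow>
     (\<forall>p. (\<phi> has_derivative \<phi>' p) (at p)) \<and> (\<forall>h. continuous_on UNIV (\<lambda>p. \<phi>' p h)) \<and>
     (\<exists>K. compact K \<and> K \<subseteq> interior \<Omega> \<and> (\<forall>p. p \<notin> K \<longrightarrow> \<phi> p = 0))"

definition weak_derivative ::
    "(real \<times> real) set \<Rightarrow> real \<times> real \<Rightarrow> scalar_field \<Rightarrow> scalar_field \<Rightarrow> bool" where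
  "weak_derivative \<Omega> b u g \<longleftrightarrow>
     (\<forall>\<phi> \<phi>'. test_function \<Omega> \<phi> \<phi>' \<longrightarrow>
        (LINT p|lebesgue_on \<Omega>. u p * of_real (\<phi>' p b)) = - (LINT p|lebesgue_on \<Omega>. g p * of_real (\<phi> p)))"

definition H1 :: "(real \<times> real) set \<Rightarrow> scalar_field set" where
  "H1 \<Omega> = {u \<in> L2 \<Omega>. (\<exists>g\<in>L2 \<Omega>. weak_derivative \<Omega> (1, 0) u g) \<and> (\<exists>g\<in>L2 \<Omega>. weak_derivative \<Omega> (0, 1) u g)}"

text \<open>Weak derivatives are unique only almost everywhere, hence the choice of representatives.\<close>

definition wd_r :: "(real \<times> real) set \<Rightarrow> scalar_field \<Rightarrow> scalar_field" where
  "wd_r \<Omega> u = (SOME g. g \<in> L2 \<Omega> \<and> weak_derivative \<Omega> (1, 0) u g)"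

definition wd_x :: "(real \<times> real) set \<Rightarrow> scalar_field \<Rightarrow> scalar_field" where
  "wd_x \<Omega> u = (SOME g. g \<in> L2 \<Omega> \<and> weak_derivative \<Omega> (0, 1) u g)"

definition H1_norm :: "(real \<times> real) set \<Rightarrow> scalar_field \<Rightarrow> real" where
  "H1_norm \<Omega> u = sqrt ((L2_norm \<Omega> u)\<^sup>2 + (L2_norm \<Omega> (wd_r \<Omega> u))\<^sup>2 + (L2_norm \<Omega> (wd_x \<Omega> u))\<^sup>2)"

definition complex_subspace :: "scalar_field set \<Rightarrow> bool" where
  "complex_subspace V \<longleftrightarrow>
     (\<lambda>_. 0) \<in> V \<and> (\<forall>u\<in>V. \<forall>v\<in>V. \<forall>c d. (\<lambda>p. c * u p + d * v p) \<in> V)"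

definition L2_dense :: "(real \<times> real) set \<Rightarrow> scalar_field set \<Rightarrow> bool" where
  "L2_dense \<Omega> D \<longleftrightarrow> (\<forall>f\<in>L2 \<Omega>. \<forall>e>0. \<exists>v\<in>D. L2_norm \<Omega> (\<lambda>p. f p - v p) < e)"

text \<open>Sequential closedness includes invariance under almost-everywhere equality.\<close>

definition H1_closed :: "(real \<times> real) set \<Rightarrow> scalar_field set \<Rightarrow> bool" where
  "H1_closed \<Omega> V \<longleftrightarrow>
     (\<forall>s u. (\<forall>n. s n \<in> V) \<and> u \<in> H1 \<Omega> \<and> (\<lambda>n::nat. H1_norm \<Omega> (\<lambda>p. s n p - u p)) \<longlonglongrightarrow> 0 \<longrightarrow> u \<in> V)"

definition reflecting_form_domain :: "(real \<times> real) set \<Rightarrow> scalar_field set \<Rightarrow> bool" where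
  "reflecting_form_domain \<Omega> V \<longleftrightarrow>
     V \<subseteq> H1 \<Omega> \<and> complex_subspace V \<and> H1_closed \<Omega> V \<and> L2_dense \<Omega> V \<and>
     (\<forall>u\<in>V. (\<lambda>p. cnj (u p)) \<in> V) \<and> (\<lambda>_. 1) \<in> V"

definition inner_A :: "carter \<Rightarrow> (real \<times> real) set \<Rightarrow> scalar_field \<Rightarrow> scalar_field \<Rightarrow> complex" where
  "inner_A P \<Omega> f h = (LINT p|lebesgue_on \<Omega>. of_real (A_weight P p) * f p * cnj (h p))"

definition average_A :: "carter \<Rightarrow> (real \<times> real) set \<Rightarrow> scalar_field \<Rightarrow> complex" where
  "average_A P \<Omega> f =
     (LINT p|lebesgue_on \<Omega>. of_real (A_weight P p) * f p) / of_real (LINT p|lebesgue_on \<Omega>. A_weight P p)"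

definition q0 :: "carter \<Rightarrow> (real \<times> real) set \<Rightarrow> scalar_field \<Rightarrow> scalar_field \<Rightarrow> complex" where
  "q0 P \<Omega> u v = (LINT p|lebesgue_on \<Omega>.
     of_real (Delta_r P (fst p)) * wd_r \<Omega> u p * cnj (wd_r \<Omega> v p) +
     of_real (Delta_x P (snd p)) * wd_x \<Omega> u p * cnj (wd_x \<Omega> v p))"

text \<open>Unbounded operators on $L^2_A(\Omega)$ are represented by their graphs.\<close>

type_synonym operator_graph = "(scalar_field \<times> scalar_field) set"

definition L0 :: "carter \<Rightarrow> (real \<times> real) set \<Rightarrow> scalar_field set \<Rightarrow> operator_graph" where
  "L0 P \<Omega> V = {(u, w). u \<in> V \<and> w \<in> L2 \<Omega> \<and> (\<forall>v\<in>V. q0 P \<Omega> u v = inner_A P \<Omega> w v)}"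

definition linear_operator_on_L2 :: "(real \<times> real) set \<Rightarrow> operator_graph \<Rightarrow> bool" where
  "linear_operator_on_L2 \<Omega> T \<longleftrightarrow>
     T \<subseteq> L2 \<Omega> \<times> L2 \<Omega> \<and> ((\<lambda>_. 0), (\<lambda>_. 0)) \<in> T \<and>
     (\<forall>(u, w)\<in>T. \<forall>(u', w')\<in>T. \<forall>c d. ((\<lambda>p. c * u p + d * u' p), (\<lambda>p. c * w p + d * w' p)) \<in> T) \<and>
     (\<forall>(u, w)\<in>T. \<forall>(u', w')\<in>T. ae_eq \<Omega> u u' \<longrightarrow> ae_eq \<Omega> w w')"

definition adjoint_A :: "carter \<Rightarrow> (real \<times> real) set \<Rightarrow> operator_graph \<Rightarrow> operator_graph" where
  "adjoint_A P \<Omega> T =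
     {(f, g). f \<in> L2 \<Omega> \<and> g \<in> L2 \<Omega> \<and> (\<forall>(u, w)\<in>T. inner_A P \<Omega> w f = inner_A P \<Omega> u g)}"

definition selfadjoint_A :: "carter \<Rightarrow> (real \<times> real) set \<Rightarrow> operator_graph \<Rightarrow> bool" where
  "selfadjoint_A P \<Omega> T \<longleftrightarrow>
     linear_operator_on_L2 \<Omega> T \<and> L2_dense \<Omega> (Domain T) \<and> adjoint_A P \<Omega> T = T"

definition nonnegative_A :: "carter \<Rightarrow> (real \<times> real) set \<Rightarrow> operator_graph \<Rightarrow> bool" where
  "nonnegative_A P \<Omega> T \<longleftrightarrow> (\<forall>(u, w)\<in>T. inner_A P \<Omega> w u \<in> \<real> \<and> Re (inner_A P \<Omega> w u) \<ge> 0)"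

definition operator_kernel :: "operator_graph \<Rightarrow> scalar_field set" where
  "operator_kernel T = {u. (u, (\<lambda>_. 0)) \<in> T}"

text \<open>\<open>u\<close> belongs to $C(\mathbb R; H^1)$ and has the time derivative \<open>ut\<close> in
  $C(\mathbb R; L^2)$. As \<open>ut\<close> is $L^2$-continuous, a distributional time derivative is the same as a
  norm limit of difference quotients.\<close>

definition energy_class ::
    "(real \<times> real) set \<Rightarrow> (real \<Rightarrow> scalar_field) \<Rightarrow> (real \<Rightarrow> scalar_field) \<Rightarrow> bool" where
  "energy_class \<Omega> u ut \<longleftrightarrow>
     (\<forall>t. u t \<in> H1 \<Omega> \<and> ut t \<in> L2 \<Omega>) \<and>
     (\<forall>t. ((\<lambda>s. H1_norm \<Omega> (\<lambda>p. u s p - u t p)) \<longlongrightarrow> 0) (at t)) \<and>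
     (\<forall>t. ((\<lambda>s. L2_norm \<Omega> (\<lambda>p. ut s p - ut t p)) \<longlongrightarrow> 0) (at t)) \<and>
     (\<forall>t. ((\<lambda>s. L2_norm \<Omega> (\<lambda>p. (u s p - u t p) / of_real (s - t) - ut t p)) \<longlongrightarrow> 0) (at t))"

text \<open>Weak form of $u_{tt} + L_0 u = 0$. For fields in the energy class the right-hand side
  is continuous in \<open>t\<close>, so the identity in the sense of distributions in \<open>t\<close> is the pointwise one.\<close>

definition axisymmetric_solution ::
    "carter \<Rightarrow> (real \<times> real) set \<Rightarrow> scalar_field set \<Rightarrow> (real \<Rightarrow> scalar_field) \<Rightarrow> (real \<Rightarrow> scalar_field) \<Rightarrow> bool" where
  "axisymmetric_solution P \<Omega> V u ut \<longleftrightarrow>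
     energy_class \<Omega> u ut \<and> (\<forall>t. u t \<in> V) \<and>
     (\<forall>v\<in>V. \<forall>t. ((\<lambda>s. inner_A P \<Omega> (ut s) v) has_vector_derivative (- q0 P \<Omega> (u t) v)) (at t))"

definition generalized_zero_mode ::
    "carter \<Rightarrow> (real \<times> real) set \<Rightarrow> scalar_field set \<Rightarrow> (real \<Rightarrow> scalar_field) \<Rightarrow> bool" where
  "generalized_zero_mode P \<Omega> V u \<longleftrightarrow>
     (\<exists>ut. axisymmetric_solution P \<Omega> V u ut) \<and>
     (\<exists>N \<psi>. (\<forall>j\<le>N. \<psi> j \<in> Domain (L0 P \<Omega> V)) \<and>
        (\<forall>t. ae_eq \<Omega> (u t) (\<lambda>p. \<Sum>j\<le>N. of_real t ^ j * \<psi> j p)))"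

definition separated_mode ::
    "carter \<Rightarrow> (real \<times> real) set \<Rightarrow> scalar_field set \<Rightarrow> complex \<Rightarrow> scalar_field \<Rightarrow> bool" where
  "separated_mode P \<Omega> V \<sigma> \<psi> \<longleftrightarrow>
     (\<exists>ut. axisymmetric_solution P \<Omega> V (\<lambda>t p. exp (- \<i> * \<sigma> * of_real t) * \<psi> p) ut)"

definition mean_free_splitting ::
    "carter \<Rightarrow> (real \<times> real) set \<Rightarrow> (real \<Rightarrow> scalar_field) \<Rightarrow>
     complex \<Rightarrow> complex \<Rightarrow> (real \<Rightarrow> scalar_field) \<Rightarrow> (real \<Rightarrow> scalar_field) \<Rightarrow> bool" where
  "mean_free_splitting P \<Omega> u c0 c1 v vt \<longleftrightarrow>
     energy_class \<Omega> v vt \<and>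
     (\<forall>t. ae_eq \<Omega> (u t) (\<lambda>p. c0 + c1 * of_real t + v t p)) \<and>
     (\<forall>t. average_A P \<Omega> (v t) = 0 \<and> average_A P \<Omega> (vt t) = 0)"

end

(* Self-adjointness reduces to solvability of (L0 + lam) u = F, which is Riesz representation in the
   complete form domain. The Poincare inequality on the rectangle follows from an explicit formula:
   testing the weak derivative with functions of vanishing integral along a coordinate line expresses
   the deviation of u from its line average as an integral of the derivative. For the dynamics, the
   Wronskian of a solution with its time shifts is constant; this gives conservation of the energy
   |u_t|^2 + q0(u,u) for weak solutions without any regularization in time. The mean of a solution is
   affine in t, and on mean-free solutions the energy controls the H1 norm. A polynomial solution is
   therefore affine, since its mean-free part is bounded, and exponential growth is impossible. *)

theory Submission
  imports Defs
begin

section \<open>Semi-inner product spaces\<close>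

text \<open>Everything is stated for functions, not for classes modulo null sets, and operators are
  graphs on such functions. Inner products are therefore only semidefinite, and weak derivatives,
  being picked by \<open>SOME\<close>, are linear only almost everywhere. The locale takes a carrier
  set and a form as parameters because it is instantiated for L2, for weighted L2, for the H1 form,
  for \<open>q0\<close> and for the shifted form of the resolvent. Definiteness is recovered at the
  end as almost-everywhere equality.

  A second tension is between measure spaces: the definitions integrate over
  \<open>lebesgue_on\<close>, whereas slicing along lines needs joint Borel measurability. Functions
  are replaced by Borel versions vanishing off the rectangle before Fubini is used. On a rectangle,
  products of one-variable test functions suffice to exploit a weak derivative, so no mollification
  or smooth density theorem enters.

  The Poincare inequality produces some constant near u; passing from it to the A-mean is
  Pythagoras, since mean-free functions are A-orthogonal to constants.\<close>

locale semi_inner =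
  fixes H :: "('a \<Rightarrow> complex) set"
    and B :: "('a \<Rightarrow> complex) \<Rightarrow> ('a \<Rightarrow> complex) \<Rightarrow> complex"
  assumes zero_mem: "(\<lambda>_. 0) \<in> H"
    and comb_mem: "\<lbrakk>u \<in> H; v \<in> H\<rbrakk> \<Longrightarrow> (\<lambda>p. c * u p + d * v p) \<in> H"
    and comb_left: "\<lbrakk>u \<in> H; v \<in> H; w \<in> H\<rbrakk> \<Longrightarrow> B (\<lambda>p. c * u p + d * v p) w = c * B u w + d * B v w"
    and hermitian: "\<lbrakk>u \<in> H; v \<in> H\<rbrakk> \<Longrightarrow> B v u = cnj (B u v)"
    and nonneg: "u \<in> H \<Longrightarrow> 0 \<le> Re (B u u)"
begin

definition nrm :: "('a \<Rightarrow> complex) \<Rightarrow> real" where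
  "nrm u = sqrt (Re (B u u))"

lemma scale_mem: "u \<in> H \<Longrightarrow> (\<lambda>p. c * u p) \<in> H"
  using comb_mem[of u u c 0] by simp

lemma add_mem: "\<lbrakk>u \<in> H; v \<in> H\<rbrakk> \<Longrightarrow> (\<lambda>p. u p + v p) \<in> H"
  using comb_mem[of u v 1 1] by simp

lemma diff_mem: "\<lbrakk>u \<in> H; v \<in> H\<rbrakk> \<Longrightarrow> (\<lambda>p. u p - v p) \<in> H"
  using comb_mem[of u v 1 "-1"] by simp

lemma scale_left: "\<lbrakk>u \<in> H; w \<in> H\<rbrakk> \<Longrightarrow> B (\<lambda>p. c * u p) w = c * B u w"
  using comb_left[of u u w c 0] by simp

lemma add_left: "\<lbrakk>u \<in> H; v \<in> H; w \<in> H\<rbrakk> \<Longrightarrow> B (\<lambda>p. u p + v p) w = B u w + B v w"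
  using comb_left[of u v w 1 1] by simp

lemma diff_left: "\<lbrakk>u \<in> H; v \<in> H; w \<in> H\<rbrakk> \<Longrightarrow> B (\<lambda>p. u p - v p) w = B u w - B v w"
  using comb_left[of u v w 1 "-1"] by simp

lemma comb_right:
  assumes "u \<in> H" "v \<in> H" "w \<in> H"
  shows "B w (\<lambda>p. c * u p + d * v p) = cnj c * B w u + cnj d * B w v"
proof -
  have "B w (\<lambda>p. c * u p + d * v p) = cnj (c * B u w + d * B v w)"
    using hermitian[OF comb_mem[OF assms(1,2)] assms(3)] comb_left[OF assms] by simp
  then show ?thesis
    using hermitian[OF assms(1,3)] hermitian[OF assms(2,3)] by simp
qed

lemma scale_right: "\<lbrakk>u \<in> H; w \<in> H\<rbrakk> \<Longrightarrow> B w (\<lambda>p. c * u p) = cnj c * B w u"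
  using comb_right[of u u w c 0] by simp

lemma add_right: "\<lbrakk>u \<in> H; v \<in> H; w \<in> H\<rbrakk> \<Longrightarrow> B w (\<lambda>p. u p + v p) = B w u + B w v"
  using comb_right[of u v w 1 1] by simp

lemma diff_right: "\<lbrakk>u \<in> H; v \<in> H; w \<in> H\<rbrakk> \<Longrightarrow> B w (\<lambda>p. u p - v p) = B w u - B w v"
  using comb_right[of u v w 1 "-1"] by simp

lemma diag_real: "u \<in> H \<Longrightarrow> B u u \<in> \<real>"
  using hermitian[of u u] by (simp add: Reals_cnj_iff)

lemma nrm_nonneg: "u \<in> H \<Longrightarrow> 0 \<le> nrm u"
  by (simp add: nrm_def nonneg)

lemma nrm_sq: "u \<in> H \<Longrightarrow> (nrm u)\<^sup>2 = Re (B u u)"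
  by (simp add: nrm_def nonneg)

lemma diag_eq: "u \<in> H \<Longrightarrow> B u u = of_real ((nrm u)\<^sup>2)"
  using diag_real[of u] by (simp add: nrm_sq)

text \<open>One expansion serves several arguments: c is a multiple of \<open>B u v\<close> for
  Cauchy-Schwarz, 1 for the triangle inequality, -1 for the parallelogram law, and free for the
  first variation in the Riesz theorem.\<close>

lemma Re_diag_comb:
  assumes "u \<in> H" "v \<in> H"
  shows "Re (B (\<lambda>p. u p + c * v p) (\<lambda>p. u p + c * v p))
    = Re (B u u) + 2 * Re (cnj c * B u v) + (cmod c)\<^sup>2 * Re (B v v)"
proof -
  let ?w = "\<lambda>p. u p + c * v p"
  have w: "?w \<in> H" and l: "B ?w x = B u x + c * B v x" and r: "B x ?w = B x u + cnj c * B x v"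
    if "x \<in> H" for x
    using comb_mem[OF assms, of 1 c] comb_left[OF assms that, of 1 c]
      comb_right[OF assms that, of 1 c] by simp_all
  have vu: "B v u = cnj (B u v)" by (rule hermitian) fact+
  have cc: "Re (c * (cnj c * B v v)) = (cmod c)\<^sup>2 * Re (B v v)"
    unfolding cmod_power2 by (simp add: algebra_simps power2_eq_square)
  have "B ?w ?w = B u u + cnj c * B u v + (c * cnj (B u v) + c * (cnj c * B v v))"
    using w assms by (simp add: l r vu algebra_simps)
  then show ?thesis using cc by simp
qed

text \<open>The discriminant argument, with the phase of \<open>B u v\<close> absorbed into the
  coefficient -t z so that only a real parameter remains. Semidefiniteness leaves N = 0 as a case of
  its own.\<close>

lemma Cauchy_Schwarz:
  assumes u: "u \<in> H" and v: "v \<in> H"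
  shows "cmod (B u v) \<le> nrm u * nrm v"
proof -
  define a N z where "a = Re (B u u)" and "N = Re (B v v)" and "z = B u v"
  have a: "0 \<le> a" and N: "0 \<le> N" using nonneg u v by (auto simp: a_def N_def)
  have q: "0 \<le> a - 2 * t * (cmod z)\<^sup>2 + t\<^sup>2 * (cmod z)\<^sup>2 * N" for t
  proof -
    let ?c = "- of_real t * z"
    have "(\<lambda>p. u p + ?c * v p) \<in> H" using comb_mem[OF u v, of 1 ?c] by simp
    from nonneg[OF this] have "0 \<le> a + 2 * Re (cnj ?c * z) + (cmod ?c)\<^sup>2 * N"
      unfolding Re_diag_comb[OF u v] a_def N_def z_def .
    moreover have "Re (cnj ?c * z) = - t * (cmod z)\<^sup>2"
      unfolding cmod_power2 by (simp add: power2_eq_square algebra_simps)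
    moreover have "(cmod ?c)\<^sup>2 = t\<^sup>2 * (cmod z)\<^sup>2"
      by (simp add: norm_mult power_mult_distrib)
    ultimately show ?thesis by simp
  qed
  have "(cmod z)\<^sup>2 \<le> a * N"
  proof (cases "N = 0")
    case True
    have "cmod z = 0"
    proof (rule ccontr)
      assume "cmod z \<noteq> 0"
      \<comment> \<open>With N = 0 this t makes the right-hand side of \<open>q\<close> equal to
        -1.\<close>
      then show False using q[of "(a + 1) / (2 * (cmod z)\<^sup>2)"] True by simp
    qed
    then show ?thesis using True by simp
  next
    case False
    then have "0 < N" using N by simp
    \<comment> \<open>The value 1 / N minimizes the quadratic in t.\<close>
    moreover have "0 \<le> a - (cmod z)\<^sup>2 / N"
      using q[of "1 / N"] False by (simp add: power2_eq_square)
    ultimately show ?thesis by (simp add: field_simps)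
  qed
  also have "\<dots> = (nrm u * nrm v)\<^sup>2"
    using u v by (simp add: power_mult_distrib nrm_sq a_def N_def)
  finally show ?thesis
    unfolding z_def using nrm_nonneg u v by (meson mult_nonneg_nonneg power2_le_imp_le)
qed

lemma nrm_add_le:
  assumes u: "u \<in> H" and v: "v \<in> H"
  shows "nrm (\<lambda>p. u p + v p) \<le> nrm u + nrm v"
proof -
  have "Re (B u v) \<le> nrm u * nrm v"
    using Cauchy_Schwarz[OF u v] complex_Re_le_cmod[of "B u v"] by linarith
  then have "(nrm (\<lambda>p. u p + v p))\<^sup>2 \<le> (nrm u + nrm v)\<^sup>2"
    using Re_diag_comb[OF u v, of 1] u v add_mem[OF u v]
    by (simp add: nrm_sq power2_sum)
  then show ?thesis
    using nrm_nonneg u v by (meson add_nonneg_nonneg power2_le_imp_le)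
qed

lemma nrm_scale: "u \<in> H \<Longrightarrow> nrm (\<lambda>p. c * u p) = cmod c * nrm u"
proof -
  assume u: "u \<in> H"
  have "B (\<lambda>p. c * u p) (\<lambda>p. c * u p) = c * cnj c * B u u"
    using u scale_mem[OF u] by (simp add: scale_left scale_right)
  then have "Re (B (\<lambda>p. c * u p) (\<lambda>p. c * u p)) = (cmod c)\<^sup>2 * Re (B u u)"
    by (simp flip: complex_norm_square)
  then show ?thesis by (simp add: nrm_def real_sqrt_mult)
qed

lemma nrm_minus_commute:
  assumes "u \<in> H" "v \<in> H"
  shows "nrm (\<lambda>p. u p - v p) = nrm (\<lambda>p. v p - u p)"
  using nrm_scale[OF diff_mem[OF assms], of "-1"] by simp

lemma nrm_triangle_sub:
  assumes "u \<in> H" "v \<in> H" "w \<in> H"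
  shows "nrm (\<lambda>p. u p - w p) \<le> nrm (\<lambda>p. u p - v p) + nrm (\<lambda>p. v p - w p)"
  using nrm_add_le[OF diff_mem[OF assms(1,2)] diff_mem[OF assms(2,3)]] by simp

lemma nrm_diff_le:
  assumes "u \<in> H" "v \<in> H"
  shows "nrm (\<lambda>p. u p - v p) \<le> nrm u + nrm v"
  using nrm_add_le[OF assms(1) scale_mem[OF assms(2), of "-1"]] nrm_scale[OF assms(2), of "-1"] by simp

lemma tendsto_form_left:
  assumes s: "\<And>n. s n \<in> H" and u: "u \<in> H" and v: "v \<in> H"
    and lim: "((\<lambda>n. nrm (\<lambda>p. s n p - u p)) \<longlongrightarrow> 0) F"
  shows "((\<lambda>n. B (s n) v) \<longlongrightarrow> B u v) F"
proof (rule Lim_null[THEN iffD2], rule Lim_null_comparison)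
  show "\<forall>\<^sub>F n in F. norm (B (s n) v - B u v) \<le> nrm (\<lambda>p. s n p - u p) * nrm v"
    using Cauchy_Schwarz[OF diff_mem[OF s u] v] by (simp add: diff_left s u v)
  show "((\<lambda>n. nrm (\<lambda>p. s n p - u p) * nrm v) \<longlongrightarrow> 0) F"
    using tendsto_mult_right[OF lim, of "nrm v"] by simp
qed

text \<open>The minimizer of \<open>nrm u ^ 2 - 2 Re (G u)\<close> represents \<open>G\<close>; minimizing sequences are
  Cauchy by the parallelogram law.\<close>

theorem Riesz_representation:
  fixes G :: "('a \<Rightarrow> complex) \<Rightarrow> complex"
  assumes complete: "\<And>s :: nat \<Rightarrow> 'a \<Rightarrow> complex. \<lbrakk>\<And>n. s n \<in> H;
        \<And>e. e > 0 \<Longrightarrow> \<exists>N. \<forall>m\<ge>N. \<forall>n\<ge>N. nrm (\<lambda>p. s m p - s n p) < e\<rbrakk>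
      \<Longrightarrow> \<exists>u\<in>H. (\<lambda>n. nrm (\<lambda>p. s n p - u p)) \<longlonglongrightarrow> 0"
    and G_comb: "\<And>u v c d. \<lbrakk>u \<in> H; v \<in> H\<rbrakk> \<Longrightarrow> G (\<lambda>p. c * u p + d * v p) = cnj c * G u + cnj d * G v"
    and G_bound: "\<And>u. u \<in> H \<Longrightarrow> cmod (G u) \<le> K * nrm u"
  shows "\<exists>u\<in>H. \<forall>v\<in>H. B u v = G v"
proof -
  define J where "J u = Re (B u u) - 2 * Re (G u)" for u
  \<comment> \<open>Completing the square: J u is at least (nrm u - K)^2 - K^2.\<close>
  have J_lower: "- K\<^sup>2 \<le> J u" if "u \<in> H" for u
  proof -
    have "2 * Re (G u) \<le> 2 * (K * nrm u)"
      using G_bound[OF that] complex_Re_le_cmod[of "G u"] by linarith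
    moreover have "0 \<le> (nrm u - K)\<^sup>2" by simp
    ultimately show ?thesis using nrm_sq[OF that] unfolding J_def
      by (simp add: power2_diff algebra_simps)
  qed
  define m where "m = Inf (J ` H)"
  have bdd: "bdd_below (J ` H)" using J_lower by (intro bdd_belowI2[of _ "- K\<^sup>2"])
  have m_le: "m \<le> J u" if "u \<in> H" for u
    unfolding m_def by (rule cInf_lower) (use that bdd in auto)
  have "\<exists>u\<in>H. J u < m + inverse (real (Suc n))" for n
  proof -
    have "m < m + inverse (real (Suc n))" by simp
    then show ?thesis unfolding m_def using cInf_less_iff[OF _ bdd] zero_mem by blast
  qed
  then obtain s where s: "\<And>n. s n \<in> H" and Js: "\<And>n. J (s n) < m + inverse (real (Suc n))"
    by metis
  have par: "(nrm (\<lambda>p. s i p - s j p))\<^sup>2 \<le> 2 * inverse (real (Suc i)) + 2 * inverse (real (Suc j))" for i j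
  proof -
    let ?h = "\<lambda>p. (1/2) * s i p + (1/2) * s j p"
    have hH: "?h \<in> H" by (rule comb_mem[OF s s])
    have 1: "Re (B (\<lambda>p. s i p - s j p) (\<lambda>p. s i p - s j p))
        = Re (B (s i) (s i)) - 2 * Re (B (s i) (s j)) + Re (B (s j) (s j))"
      using Re_diag_comb[OF s s, of i "-1" j] by simp
    have ij: "B (s j) (s i) = cnj (B (s i) (s j))" by (rule hermitian[OF s s])
    have 2: "Re (B ?h ?h) = (Re (B (s i) (s i)) + 2 * Re (B (s i) (s j)) + Re (B (s j) (s j))) / 4"
      using hH by (simp only: comb_left[OF s s hH] comb_right[OF s s s] ij) (simp add: field_simps)
    have 3: "Re (G ?h) = (Re (G (s i)) + Re (G (s j))) / 2"
      using G_comb[OF s s, of "1/2" i "1/2" j] by simp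
    have "(nrm (\<lambda>p. s i p - s j p))\<^sup>2 = 2 * J (s i) + 2 * J (s j) - 4 * J ?h"
      unfolding nrm_sq[OF diff_mem[OF s s]] J_def 1 2 3 by (simp add: field_simps)
    then show ?thesis using m_le[OF hH] Js[of i] Js[of j] by linarith
  qed
  have inv0: "(\<lambda>n. inverse (real (Suc n))) \<longlonglongrightarrow> 0"
    by (rule LIMSEQ_inverse_real_of_nat)
  obtain u where u: "u \<in> H" and su: "(\<lambda>n. nrm (\<lambda>p. s n p - u p)) \<longlonglongrightarrow> 0"
  proof -
    have "\<exists>N. \<forall>i\<ge>N. \<forall>j\<ge>N. nrm (\<lambda>p. s i p - s j p) < e" if "e > 0" for e
    proof -
      have "0 < e\<^sup>2 / 4" using that by simp
      from order_tendstoD(2)[OF inv0 this]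
      obtain N where N: "\<And>n. n \<ge> N \<Longrightarrow> inverse (real (Suc n)) < e\<^sup>2 / 4"
        unfolding eventually_sequentially by blast
      have "nrm (\<lambda>p. s i p - s j p) < e" if "i \<ge> N" "j \<ge> N" for i j
      proof (rule power2_less_imp_less)
        show "(nrm (\<lambda>p. s i p - s j p))\<^sup>2 < e\<^sup>2" using par[of i j] N[OF that(1)] N[OF that(2)] by linarith
      qed (use \<open>e > 0\<close> in simp)
      then show ?thesis by blast
    qed
    from complete[OF s this] show ?thesis using that by blast
  qed
  have "B u v = G v" if v: "v \<in> H" for v
  proof -
    define z where "z = B u v - G v"
    \<comment> \<open>The first variation is taken along the minimizing sequence and then passed to
      the limit. Only \<open>B (s n) v\<close> has to converge, so continuity of J and of G is never
      invoked.\<close>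
    have var: "0 \<le> (cmod c)\<^sup>2 * Re (B v v) + 2 * Re (cnj c * z)" for c
    proof -
      have step: "- inverse (real (Suc n)) \<le> (cmod c)\<^sup>2 * Re (B v v) + 2 * Re (cnj c * (B (s n) v - G v))" for n
      proof -
        have w: "(\<lambda>p. s n p + c * v p) \<in> H" using comb_mem[OF s v, of 1 n c] by simp
        have "G (\<lambda>p. s n p + c * v p) = G (s n) + cnj c * G v" using G_comb[OF s v, of 1 n c] by simp
        then have "J (\<lambda>p. s n p + c * v p)
            = J (s n) + ((cmod c)\<^sup>2 * Re (B v v) + 2 * Re (cnj c * (B (s n) v - G v)))"
          unfolding J_def Re_diag_comb[OF s v] by (simp add: algebra_simps)
        then show ?thesis using m_le[OF w] Js[of n] by linarith
      qed
      have "(\<lambda>n. (cmod c)\<^sup>2 * Re (B v v) + 2 * Re (cnj c * (B (s n) v - G v)))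
          \<longlonglongrightarrow> (cmod c)\<^sup>2 * Re (B v v) + 2 * Re (cnj c * z)"
        unfolding z_def by (intro tendsto_intros tendsto_form_left s u v su)
      from LIMSEQ_le[OF _ this, of "\<lambda>n. - inverse (real (Suc n))" 0] show ?thesis
        using step tendsto_minus[OF inv0] by simp
    qed
    define N where "N = Re (B v v)"
    have N: "0 \<le> N" using nonneg[OF v] by (simp add: N_def)
    \<comment> \<open>For c = -e z the variation equals e |z|^2 (e N - 2), which is negative unless
      z = 0. The summand 1 keeps e defined when N = 0 and gives e N < 1.\<close>
    define e where "e = 1 / (N + 1)"
    have e: "e > 0" "e * N < 1" using N by (simp_all add: e_def divide_simps)
    have "0 \<le> e\<^sup>2 * (cmod z)\<^sup>2 * N - 2 * e * (cmod z)\<^sup>2"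
    proof -
      have "Re (cnj (- of_real e * z) * z) = - e * (cmod z)\<^sup>2"
        unfolding cmod_power2 by (simp add: power2_eq_square algebra_simps)
      moreover have "(cmod (- of_real e * z))\<^sup>2 = e\<^sup>2 * (cmod z)\<^sup>2"
        by (simp add: norm_mult power_mult_distrib)
      ultimately show ?thesis using var[of "- of_real e * z"] by (simp add: N_def)
    qed
    also have "\<dots> = e * (cmod z)\<^sup>2 * (e * N - 2)" by (simp add: power2_eq_square algebra_simps)
    finally have ge: "0 \<le> e * (cmod z)\<^sup>2 * (e * N - 2)" .
    have "z = 0"
    proof (rule ccontr)
      assume "z \<noteq> 0"
      then have "0 < e * (cmod z)\<^sup>2" using e(1) by simp
      then have "e * (cmod z)\<^sup>2 * (e * N - 2) < 0" using e(2) by (intro mult_pos_neg) auto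
      then show False using ge by simp
    qed
    then show ?thesis by (simp add: z_def)
  qed
  then show ?thesis using u by blast
qed

end

section \<open>Square-integrable functions\<close>

lemma borel_measurable_cnj [measurable (raw)]:
  "f \<in> borel_measurable M \<Longrightarrow> (\<lambda>x. cnj (f x)) \<in> borel_measurable M"
  by (rule borel_measurable_continuous_on[where f = cnj]) (auto intro: continuous_intros)

text \<open>L2 over an arbitrary measure, so that completeness and the form estimates are available
  before the rectangle enters; \<open>L2\<close> is the instance for
  \<open>lebesgue_on \<Omega>\<close>.\<close>

definition sqint :: "'a measure \<Rightarrow> ('a \<Rightarrow> complex) set" where
  "sqint M = {f \<in> borel_measurable M. integrable M (\<lambda>p. (cmod (f p))\<^sup>2)}"

lemma sqint_measurable: "f \<in> sqint M \<Longrightarrow> f \<in> borel_measurable M"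
  and sqint_integrable: "f \<in> sqint M \<Longrightarrow> integrable M (\<lambda>p. (cmod (f p))\<^sup>2)"
  by (auto simp: sqint_def)

lemma sqintI:
  assumes [measurable]: "f \<in> borel_measurable M"
    and g: "integrable M g" and le: "AE p in M. (cmod (f p))\<^sup>2 \<le> g p"
  shows "f \<in> sqint M"
proof -
  have "integrable M (\<lambda>p. (cmod (f p))\<^sup>2)"
    by (rule Bochner_Integration.integrable_bound[OF g]) (use le in auto)
  then show ?thesis by (simp add: sqint_def assms)
qed

lemma sqint_comb:
  assumes f: "f \<in> sqint M" and g: "g \<in> sqint M"
  shows "(\<lambda>p. c * f p + d * g p) \<in> sqint M"
proof (rule sqintI)
  note [measurable] = sqint_measurable[OF f] sqint_measurable[OF g]
  show "(\<lambda>p. c * f p + d * g p) \<in> borel_measurable M" by measurable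
  show "integrable M (\<lambda>p. 2 * (cmod c)\<^sup>2 * (cmod (f p))\<^sup>2 + 2 * (cmod d)\<^sup>2 * (cmod (g p))\<^sup>2)"
    by (intro Bochner_Integration.integrable_add integrable_mult_right sqint_integrable f g)
  have "(cmod (c * f p + d * g p))\<^sup>2 \<le> 2 * (cmod c)\<^sup>2 * (cmod (f p))\<^sup>2 + 2 * (cmod d)\<^sup>2 * (cmod (g p))\<^sup>2" for p
  proof -
    let ?x = "cmod c * cmod (f p)" and ?y = "cmod d * cmod (g p)"
    have "cmod (c * f p + d * g p) \<le> ?x + ?y"
      using norm_triangle_ineq[of "c * f p" "d * g p"] by (simp add: norm_mult)
    then have "(cmod (c * f p + d * g p))\<^sup>2 \<le> (?x + ?y)\<^sup>2" by (intro power_mono) auto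
    also have "\<dots> \<le> 2 * ?x\<^sup>2 + 2 * ?y\<^sup>2"
      using zero_le_power2[of "?x - ?y"] by (simp add: power2_sum power2_diff)
    finally show ?thesis by (simp add: power_mult_distrib mult.assoc)
  qed
  then show "AE p in M. (cmod (c * f p + d * g p))\<^sup>2 \<le> 2 * (cmod c)\<^sup>2 * (cmod (f p))\<^sup>2 + 2 * (cmod d)\<^sup>2 * (cmod (g p))\<^sup>2"
    by simp
qed

lemma sqint_zero: "(\<lambda>_. 0) \<in> sqint M"
  by (simp add: sqint_def)

lemma sqint_diff: "\<lbrakk>f \<in> sqint M; g \<in> sqint M\<rbrakk> \<Longrightarrow> (\<lambda>p. f p - g p) \<in> sqint M"
  using sqint_comb[of f M g 1 "-1"] by simp

lemma sqint_ae_cong: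
  assumes "f \<in> sqint M" "g \<in> borel_measurable M" "AE p in M. f p = g p"
  shows "g \<in> sqint M"
  by (rule sqintI[OF assms(2) sqint_integrable[OF assms(1)]]) (use assms(3) in auto)

lemma sqint_mult_integrable:
  assumes f: "f \<in> sqint M" and g: "g \<in> sqint M"
    and w[measurable]: "w \<in> borel_measurable M" and K: "\<And>p. p \<in> space M \<Longrightarrow> \<bar>w p :: real\<bar> \<le> K"
  shows "integrable M (\<lambda>p. of_real (w p) * f p * cnj (g p))"
proof (rule Bochner_Integration.integrable_bound)
  note [measurable] = sqint_measurable[OF f] sqint_measurable[OF g]
  show "integrable M (\<lambda>p. K * ((cmod (f p))\<^sup>2 + (cmod (g p))\<^sup>2))"
    by (intro Bochner_Integration.integrable_add integrable_mult_right sqint_integrable f g)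
  show "(\<lambda>p. of_real (w p) * f p * cnj (g p)) \<in> borel_measurable M" by measurable
  have "norm (of_real (w p) * f p * cnj (g p)) \<le> norm (K * ((cmod (f p))\<^sup>2 + (cmod (g p))\<^sup>2))"
    if "p \<in> space M" for p
  proof -
    have K0: "0 \<le> K" using K[OF that] by linarith
    have "0 \<le> (cmod (f p) - cmod (g p))\<^sup>2" by simp
    then have "cmod (f p) * cmod (g p) \<le> ((cmod (f p))\<^sup>2 + (cmod (g p))\<^sup>2) / 2"
      by (simp add: power2_diff)
    also have "\<dots> \<le> (cmod (f p))\<^sup>2 + (cmod (g p))\<^sup>2" by simp
    finally have "\<bar>w p\<bar> * (cmod (f p) * cmod (g p)) \<le> K * ((cmod (f p))\<^sup>2 + (cmod (g p))\<^sup>2)"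
      by (intro mult_mono K[OF that] K0) auto
    then show ?thesis using K0 by (simp add: norm_mult mult.assoc abs_mult)
  qed
  then show "AE p in M. norm (of_real (w p) * f p * cnj (g p)) \<le> norm (K * ((cmod (f p))\<^sup>2 + (cmod (g p))\<^sup>2))"
    by simp
qed

lemma sqint_prod_integrable:
  assumes "f \<in> sqint M" "g \<in> sqint M"
  shows "integrable M (\<lambda>p. f p * cnj (g p))"
  using sqint_mult_integrable[OF assms, of "\<lambda>_. 1" 1] by simp

definition weighted_inner :: "'a measure \<Rightarrow> ('a \<Rightarrow> real) \<Rightarrow> ('a \<Rightarrow> complex) \<Rightarrow> ('a \<Rightarrow> complex) \<Rightarrow> complex" where
  "weighted_inner M w f g = (LINT p|M. of_real (w p) * f p * cnj (g p))"

lemma weighted_inner_diag: "weighted_inner M w f f = of_real (LINT p|M. w p * (cmod (f p))\<^sup>2)"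
proof -
  have "of_real (w p) * f p * cnj (f p) = of_real (w p * (cmod (f p))\<^sup>2)" for p
    by (simp add: mult.assoc flip: complex_norm_square)
  then show ?thesis unfolding weighted_inner_def by (simp only: integral_complex_of_real)
qed

lemma semi_inner_weighted:
  assumes w[measurable]: "w \<in> borel_measurable M"
    and K: "\<And>p. p \<in> space M \<Longrightarrow> 0 \<le> w p \<and> w p \<le> K"
  shows "semi_inner (sqint M) (weighted_inner M w)"
proof
  note int = sqint_mult_integrable[OF _ _ w, of _ _ K]
  have K': "\<bar>w p\<bar> \<le> K" if "p \<in> space M" for p using K[OF that] by auto
  show "(\<lambda>_. 0) \<in> sqint M" by (rule sqint_zero)
  show "(\<lambda>p. c * u p + d * v p) \<in> sqint M" if "u \<in> sqint M" "v \<in> sqint M" for u v c d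
    by (rule sqint_comb[OF that])
  show "weighted_inner M w (\<lambda>p. c * u p + d * v p) x = c * weighted_inner M w u x + d * weighted_inner M w v x"
    if "u \<in> sqint M" "v \<in> sqint M" "x \<in> sqint M" for u v x c d
  proof -
    have "weighted_inner M w (\<lambda>p. c * u p + d * v p) x
        = (LINT p|M. c * (of_real (w p) * u p * cnj (x p)) + d * (of_real (w p) * v p * cnj (x p)))"
      unfolding weighted_inner_def by (rule Bochner_Integration.integral_cong) (simp_all add: algebra_simps)
    also have "\<dots> = (LINT p|M. c * (of_real (w p) * u p * cnj (x p))) + (LINT p|M. d * (of_real (w p) * v p * cnj (x p)))"
      using K' that by (intro Bochner_Integration.integral_add integrable_mult_right int) auto
    finally show ?thesis unfolding weighted_inner_def by simp
  qed
  show "weighted_inner M w v u = cnj (weighted_inner M w u v)" for u v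
    unfolding weighted_inner_def Bochner_Integration.integral_cnj[symmetric]
    by (rule Bochner_Integration.integral_cong) (simp_all add: algebra_simps)
  show "0 \<le> Re (weighted_inner M w u u)" for u
    unfolding weighted_inner_diag using K by (auto intro!: Bochner_Integration.integral_nonneg_AE)
qed

text \<open>The Riesz-Fischer argument: a fast subsequence converges almost everywhere, and Fatou's
  lemma turns the pointwise limit into a mean-square limit of the whole sequence.\<close>

theorem sqint_complete:
  fixes s :: "nat \<Rightarrow> 'a \<Rightarrow> complex"
  assumes s: "\<And>n. s n \<in> sqint M"
    and cauchy: "\<And>e. e > 0 \<Longrightarrow> \<exists>N. \<forall>m\<ge>N. \<forall>n\<ge>N. (LINT p|M. (cmod (s m p - s n p))\<^sup>2) < e"
  shows "\<exists>u\<in>sqint M. (\<lambda>n. LINT p|M. (cmod (s n p - u p))\<^sup>2) \<longlonglongrightarrow> 0"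
proof -
  have [measurable]: "s n \<in> borel_measurable M" for n using s by (rule sqint_measurable)
  have nn: "(\<integral>\<^sup>+ p. ennreal ((cmod (s m p - s n p))\<^sup>2) \<partial>M) = ennreal (LINT p|M. (cmod (s m p - s n p))\<^sup>2)" for m n
    by (rule nn_integral_eq_integral[OF sqint_integrable[OF sqint_diff[OF s s]]]) simp
  \<comment> \<open>The rate 4^-i beats the weights 2^n used below: the sum of the 2^n |d n|^2 then
    has integral at most the sum of the 2^-n.\<close>
  have "\<exists>N. \<forall>m\<ge>N. \<forall>n\<ge>N. (LINT p|M. (cmod (s m p - s n p))\<^sup>2) < (1/4)^i" for i :: nat
    by (rule cauchy) simp
  then obtain N where N: "\<And>i m n. \<lbrakk>m \<ge> N i; n \<ge> N i\<rbrakk> \<Longrightarrow> (LINT p|M. (cmod (s m p - s n p))\<^sup>2) < (1/4)^i"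
    by metis
  \<comment> \<open>Summing the thresholds puts both \<open>k n\<close> and \<open>k (Suc n)\<close>
    beyond \<open>N n\<close>; the summand n forces k to infinity.\<close>
  define k where "k n = n + (\<Sum>i\<le>n. N i)" for n
  have kN: "N n \<le> k n" and kN': "N n \<le> k (Suc n)" and kn: "n \<le> k n" for n
  proof -
    show "N n \<le> k n" unfolding k_def by (intro trans_le_add2 member_le_sum) auto
    show "N n \<le> k (Suc n)" unfolding k_def by (intro trans_le_add2 member_le_sum) auto
  qed (simp add: k_def)
  define d where "d n p = s (k (Suc n)) p - s (k n) p" for n p
  have [measurable]: "d n \<in> borel_measurable M" for n unfolding d_def by measurable
  have "(\<integral>\<^sup>+ p. (\<Sum>n. ennreal (2^n * (cmod (d n p))\<^sup>2)) \<partial>M) = (\<Sum>n. \<integral>\<^sup>+ p. ennreal (2^n * (cmod (d n p))\<^sup>2) \<partial>M)"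
    by (rule nn_integral_suminf) measurable
  also have "\<dots> \<le> (\<Sum>n. ennreal ((1/2)^n))"
  proof (rule suminf_le)
    fix n
    have "(\<integral>\<^sup>+ p. ennreal (2^n * (cmod (d n p))\<^sup>2) \<partial>M) = ennreal (2^n) * (\<integral>\<^sup>+ p. ennreal ((cmod (d n p))\<^sup>2) \<partial>M)"
      by (simp add: ennreal_mult nn_integral_cmult)
    also have "\<dots> \<le> ennreal (2^n) * ennreal ((1/4)^n)"
      unfolding d_def nn using N[OF kN' kN, of n] by (intro mult_left_mono ennreal_leI) auto
    also have "\<dots> = ennreal (2^n * (1/4)^n)" by (simp add: ennreal_mult)
    also have "(2::real)^n * (1/4)^n = (1/2)^n" by (simp flip: power_mult_distrib)
    finally show "(\<integral>\<^sup>+ p. ennreal (2^n * (cmod (d n p))\<^sup>2) \<partial>M) \<le> ennreal ((1/2)^n)" .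
  qed auto
  also have "\<dots> < \<infinity>" by (subst suminf_ennreal2) (auto simp: summable_geometric)
  finally have "(\<integral>\<^sup>+ p. (\<Sum>n. ennreal (2^n * (cmod (d n p))\<^sup>2)) \<partial>M) \<noteq> \<infinity>" by simp
  from nn_integral_PInf_AE[OF _ this]
  have "AE p in M. (\<Sum>n. ennreal (2^n * (cmod (d n p))\<^sup>2)) \<noteq> \<infinity>" by measurable
  then have conv: "AE p in M. convergent (\<lambda>n. s (k n) p)"
  proof eventually_elim
    fix p assume fin: "(\<Sum>n. ennreal (2^n * (cmod (d n p))\<^sup>2)) \<noteq> \<infinity>"
    have sm: "summable (\<lambda>n. 2^n * (cmod (d n p))\<^sup>2)"
      by (rule summable_suminf_not_top) (use fin in \<open>auto simp: top_ennreal_def\<close>)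
    have "summable (\<lambda>n. d n p)"
    proof (rule summable_comparison_test)
      show "summable (\<lambda>n. 2^n * (cmod (d n p))\<^sup>2 + (1/2)^n)"
        by (intro summable_add sm summable_geometric) simp
      \<comment> \<open>The arithmetic-geometric mean with weight 2^n trades weighted square
        summability for absolute summability, at the price of a geometric series.\<close>
      have "norm (d n p) \<le> 2^n * (cmod (d n p))\<^sup>2 + (1/2)^n" for n
      proof -
        have "0 \<le> (2^n * cmod (d n p) - 1)\<^sup>2 * (1/2)^n" by simp
        also have "\<dots> = 2^n * (cmod (d n p))\<^sup>2 - 2 * cmod (d n p) + (1/2)^n"
          by (simp add: power2_diff power_mult_distrib power_divide field_simps power2_eq_square)
        finally show ?thesis by (smt (verit) norm_ge_zero)
      qed
      then show "\<exists>N. \<forall>n\<ge>N. norm (d n p) \<le> 2^n * (cmod (d n p))\<^sup>2 + (1/2)^n" by blast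
    qed
    then have "convergent (\<lambda>n. \<Sum>i<n. d i p)" by (simp add: summable_iff_convergent)
    then have "convergent (\<lambda>n. s (k 0) p + (\<Sum>i<n. d i p))" by (intro convergent_add convergent_const)
    moreover have "s (k 0) p + (\<Sum>i<n. d i p) = s (k n) p" for n
      by (simp add: d_def sum_lessThan_telescope[where f = "\<lambda>i. s (k i) p"])
    ultimately show "convergent (\<lambda>n. s (k n) p)" by simp
  qed
  define u where "u p = lim (\<lambda>n. s (k n) p)" for p
  have u[measurable]: "u \<in> borel_measurable M" unfolding u_def by measurable
  have lim: "AE p in M. (\<lambda>n. s (k n) p) \<longlonglongrightarrow> u p"
    using conv unfolding u_def by eventually_elim (simp add: convergent_LIMSEQ_iff)
  have fatou: "(\<integral>\<^sup>+ p. ennreal ((cmod (s m p - u p))\<^sup>2) \<partial>M) \<le> ennreal e"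
    if L: "\<And>m n. \<lbrakk>m \<ge> L; n \<ge> L\<rbrakk> \<Longrightarrow> (LINT p|M. (cmod (s m p - s n p))\<^sup>2) < e" and m: "m \<ge> L" for m L e
  proof -
    have "(\<integral>\<^sup>+ p. ennreal ((cmod (s m p - u p))\<^sup>2) \<partial>M)
        = (\<integral>\<^sup>+ p. liminf (\<lambda>n. ennreal ((cmod (s m p - s (k n) p))\<^sup>2)) \<partial>M)"
    proof (rule nn_integral_cong_AE, use lim in eventually_elim)
      fix p assume "(\<lambda>n. s (k n) p) \<longlonglongrightarrow> u p"
      then have "(\<lambda>n. ennreal ((cmod (s m p - s (k n) p))\<^sup>2)) \<longlonglongrightarrow> ennreal ((cmod (s m p - u p))\<^sup>2)"
        by (intro tendsto_intros)
      then show "ennreal ((cmod (s m p - u p))\<^sup>2) = liminf (\<lambda>n. ennreal ((cmod (s m p - s (k n) p))\<^sup>2))"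
        by (rule lim_imp_Liminf[OF sequentially_bot, symmetric])
    qed
    also have "\<dots> \<le> liminf (\<lambda>n. \<integral>\<^sup>+ p. ennreal ((cmod (s m p - s (k n) p))\<^sup>2) \<partial>M)"
      by (rule nn_integral_liminf) measurable
    also have "\<dots> \<le> liminf (\<lambda>n::nat. ennreal e)"
    proof (rule Liminf_mono, use eventually_ge_at_top[of L] in eventually_elim)
      fix n assume "L \<le> n"
      then have "L \<le> k n" using kn[of n] by simp
      then show "(\<integral>\<^sup>+ p. ennreal ((cmod (s m p - s (k n) p))\<^sup>2) \<partial>M) \<le> ennreal e"
        unfolding nn using L[OF m] by (intro ennreal_leI) (simp add: less_imp_le)
    qed
    finally show ?thesis by (simp add: Liminf_const)
  qed
  \<comment> \<open>The limit is square-integrable because its distance from a single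
    \<open>s L\<close> is finite.\<close>
  have u_mem: "u \<in> sqint M"
  proof -
    obtain L where L: "\<And>m n. \<lbrakk>m \<ge> L; n \<ge> L\<rbrakk> \<Longrightarrow> (LINT p|M. (cmod (s m p - s n p))\<^sup>2) < 1"
      using cauchy[of 1] by auto
    have "(\<integral>\<^sup>+ p. ennreal ((cmod (s L p - u p))\<^sup>2) \<partial>M) \<le> ennreal 1"
      by (rule fatou[OF L order_refl])
    then have "(\<integral>\<^sup>+ p. ennreal ((cmod (s L p - u p))\<^sup>2) \<partial>M) < \<infinity>"
      unfolding infinity_ennreal_def by (rule order_le_less_trans) (rule ennreal_less_top)
    then have "(\<lambda>p. s L p - u p) \<in> sqint M"
      unfolding sqint_def by (auto intro!: integrableI_bounded)
    from sqint_diff[OF s[of L] this] show ?thesis by simp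
  qed
  have "(\<lambda>n. LINT p|M. (cmod (s n p - u p))\<^sup>2) \<longlonglongrightarrow> 0"
  proof (rule LIMSEQ_I)
    fix e :: real assume "0 < e"
    then have "0 < e / 2" by simp
    from cauchy[OF this] obtain L where
      L: "\<And>m n. \<lbrakk>m \<ge> L; n \<ge> L\<rbrakk> \<Longrightarrow> (LINT p|M. (cmod (s m p - s n p))\<^sup>2) < e / 2" by auto
    have "norm ((LINT p|M. (cmod (s m p - u p))\<^sup>2) - 0) < e" if "m \<ge> L" for m
    proof -
      have "(\<integral>\<^sup>+ p. ennreal ((cmod (s m p - u p))\<^sup>2) \<partial>M) \<le> ennreal (e / 2)"
        by (rule fatou[OF L that])
      then have "ennreal (LINT p|M. (cmod (s m p - u p))\<^sup>2) \<le> ennreal (e / 2)"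
        by (subst (asm) nn_integral_eq_integral[OF sqint_integrable[OF sqint_diff[OF s u_mem]]]) simp_all
      then have "(LINT p|M. (cmod (s m p - u p))\<^sup>2) \<le> e / 2"
        using \<open>0 < e\<close> by (subst (asm) ennreal_le_iff) auto
      moreover have "0 \<le> (LINT p|M. (cmod (s m p - u p))\<^sup>2)" by simp
      ultimately show ?thesis using \<open>0 < e\<close> by simp
    qed
    then show "\<exists>no. \<forall>n\<ge>no. norm ((LINT p|M. (cmod (s n p - u p))\<^sup>2) - 0) < e" by blast
  qed
  with u_mem show ?thesis by blast
qed

section \<open>The fundamental lemma of the calculus of variations\<close>

text \<open>One-variable test functions with support strictly inside (p, q). The derivative is an
  argument, so that none has to be chosen; if c > d the function is identically zero.\<close>

definition C1_supported :: "real \<Rightarrow> real \<Rightarrow> (real \<Rightarrow> real) \<Rightarrow> (real \<Rightarrow> real) \<Rightarrow> bool" where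
  "C1_supported p q a a' \<longleftrightarrow>
     (\<forall>r. (a has_real_derivative a' r) (at r)) \<and> continuous_on UNIV a' \<and>
     (\<exists>c d. p < c \<and> d < q \<and> (\<forall>r. r \<notin> {c..d} \<longrightarrow> a r = 0))"

lemma C1_supported_continuous: "C1_supported p q a a' \<Longrightarrow> continuous_on UNIV a"
  unfolding C1_supported_def by (meson DERIV_isCont continuous_at_imp_continuous_on)

lemma C1_supported_zero: "\<lbrakk>C1_supported p q a a'; r \<notin> {p..q}\<rbrakk> \<Longrightarrow> a r = 0"
  unfolding C1_supported_def by fastforce

lemma C1_supported_mono:
  assumes "C1_supported p q a a'" "p' \<le> p" "q \<le> q'"
  shows "C1_supported p' q' a a'"
  using assms unfolding C1_supported_def by (meson le_less_trans less_le_trans)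

lemma continuous_on_compose_fst: "continuous_on UNIV f \<Longrightarrow> continuous_on UNIV (\<lambda>p. f (fst p))"
  and continuous_on_compose_snd: "continuous_on UNIV f \<Longrightarrow> continuous_on UNIV (\<lambda>p. f (snd p))"
  by (erule continuous_on_compose2; auto intro!: continuous_intros)+

text \<open>Products are the only test functions against which weak derivatives will be exploited;
  both uniqueness and the slice formula rest on them.\<close>

lemma test_function_tensor:
  assumes a: "C1_supported r0 r1 a a'" and b: "C1_supported x0 x1 b b'"
  shows "test_function ({r0..r1} \<times> {x0..x1}) (\<lambda>p. a (fst p) * b (snd p))
    (\<lambda>p h. a' (fst p) * fst h * b (snd p) + a (fst p) * (b' (snd p) * snd h))"
  unfolding test_function_def
proof (intro conjI allI)
  fix p :: "real \<times> real"
  have da: "((\<lambda>p. a (fst p)) has_derivative (\<lambda>h. fst h * a' (fst p))) (at p)"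
    using a unfolding C1_supported_def
    by (intro DERIV_compose_FDERIV[where g = fst] has_derivative_fst has_derivative_ident) auto
  have db: "((\<lambda>p. b (snd p)) has_derivative (\<lambda>h. snd h * b' (snd p))) (at p)"
    using b unfolding C1_supported_def
    by (intro DERIV_compose_FDERIV[where g = snd] has_derivative_snd has_derivative_ident) auto
  show "((\<lambda>p. a (fst p) * b (snd p)) has_derivative
      (\<lambda>h. a' (fst p) * fst h * b (snd p) + a (fst p) * (b' (snd p) * snd h))) (at p)"
    using has_derivative_mult[OF da db] by (simp add: algebra_simps)
next
  fix h :: "real \<times> real"
  have "continuous_on UNIV a'" "continuous_on UNIV b'" using a b unfolding C1_supported_def by auto
  then show "continuous_on UNIV (\<lambda>p. a' (fst p) * fst h * b (snd p) + a (fst p) * (b' (snd p) * snd h))"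
    using C1_supported_continuous[OF a] C1_supported_continuous[OF b]
    by (intro continuous_on_add continuous_on_mult continuous_on_const continuous_on_compose_fst continuous_on_compose_snd)
next
  from a obtain c d where cd: "r0 < c" "d < r1" "\<And>r. r \<notin> {c..d} \<Longrightarrow> a r = 0"
    unfolding C1_supported_def by auto
  from b obtain e f where ef: "x0 < e" "f < x1" "\<And>r. r \<notin> {e..f} \<Longrightarrow> b r = 0"
    unfolding C1_supported_def by auto
  have "{c..d} \<times> {e..f} \<subseteq> interior ({r0..r1} \<times> {x0..x1})"
    using cd(1,2) ef(1,2) by (auto simp: interior_Times)
  moreover have "compact ({c..d} \<times> {e..f})" by (intro compact_Times compact_Icc)
  moreover have "a (fst p) * b (snd p) = 0" if "p \<notin> {c..d} \<times> {e..f}" for p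
    using that cd(3)[of "fst p"] ef(3)[of "snd p"] by (auto simp: mem_Times_iff)
  ultimately show "\<exists>K. compact K \<and> K \<subseteq> interior ({r0..r1} \<times> {x0..x1}) \<and>
      (\<forall>p. p \<notin> K \<longrightarrow> a (fst p) * b (snd p) = 0)" by blast
qed

lemma measurable_compose_fst_borel:
  "f \<in> borel_measurable borel \<Longrightarrow> (\<lambda>p :: real \<times> real. f (fst p)) \<in> borel_measurable borel"
  and measurable_compose_snd_borel:
  "f \<in> borel_measurable borel \<Longrightarrow> (\<lambda>p :: real \<times> real. f (snd p)) \<in> borel_measurable borel"
  by (simp_all flip: borel_prod)

text \<open>Subtracting 1 before taking the positive part keeps the support away from p and q,
  squaring makes the edge C^1, and z / (1 + z) confines the values to [0, 1) while letting them tend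
  to 1 inside the interval as n grows.\<close>

definition bump :: "real \<Rightarrow> real \<Rightarrow> nat \<Rightarrow> real \<Rightarrow> real" where
  "bump p q n r = (let z = (max 0 (real n * ((r - p) * (q - r)) - 1))\<^sup>2 in z / (1 + z))"

lemma bump_bounds: "0 \<le> bump p q n r" "bump p q n r \<le> 1"
proof -
  define z where "z = (max 0 (real n * ((r - p) * (q - r)) - 1))\<^sup>2"
  have "0 \<le> z" by (simp add: z_def)
  then show "0 \<le> bump p q n r" "bump p q n r \<le> 1"
    unfolding bump_def Let_def z_def[symmetric] by simp_all
qed

lemma bump_C1_supported:
  assumes "p < q"
  shows "\<exists>a'. C1_supported p q (bump p q n) a'"
proof -
  define m where "m r = real n * ((r - p) * (q - r)) - 1" for r
  define m' where "m' r = real n * (q - r - (r - p))" for r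
  define z where "z r = (max 0 (m r))\<^sup>2" for r
  define z' where "z' r = 2 * max 0 (m r) * m' r" for r
  have dm: "(m has_real_derivative m' r) (at r)" for r
    unfolding m_def m'_def by (auto intro!: derivative_eq_intros simp: algebra_simps)
  \<comment> \<open>The delicate point is y = 0, where the difference quotient is at most
    |h|.\<close>
  have dsq: "((\<lambda>y::real. (max 0 y)\<^sup>2) has_real_derivative 2 * max 0 y) (at y)" for y
  proof (cases "y = 0")
    case False
    then consider "y > 0" | "y < 0" by linarith
    then show ?thesis
    proof cases
      case 1
      have "((\<lambda>y::real. y\<^sup>2) has_real_derivative 2 * max 0 y) (at y)"
        using 1 by (auto intro!: derivative_eq_intros)
      then show ?thesis
      proof (rule has_field_derivative_transform_within_open[of _ _ _ "{0<..}"])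
      qed (use 1 in auto)
    next
      case 2
      have "((\<lambda>y::real. 0) has_real_derivative 2 * max 0 y) (at y)"
        using 2 by (auto intro!: derivative_eq_intros)
      then show ?thesis
      proof (rule has_field_derivative_transform_within_open[of _ _ _ "{..<0}"])
      qed (use 2 in auto)
    qed
  next
    case True
    have "((\<lambda>h::real. (max 0 h)\<^sup>2 / h) \<longlongrightarrow> 0) (at 0)"
    proof (rule Lim_null_comparison)
      show "\<forall>\<^sub>F h::real in at 0. norm ((max 0 h)\<^sup>2 / h) \<le> \<bar>h\<bar>"
        by (intro always_eventually) (auto simp: max_def power2_eq_square)
      show "((\<lambda>h::real. \<bar>h\<bar>) \<longlongrightarrow> 0) (at 0)" by (auto intro!: tendsto_eq_intros)
    qed
    then show ?thesis using True by (simp add: DERIV_def)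
  qed
  have dz: "(z has_real_derivative z' r) (at r)" for r
    using DERIV_chain2[OF dsq dm] unfolding z_def z'_def by simp
  have z0: "0 \<le> z r" for r by (simp add: z_def)
  have b: "bump p q n = (\<lambda>r. z r / (1 + z r))" by (simp add: bump_def Let_def z_def m_def fun_eq_iff)
  have nz: "1 + z r \<noteq> 0" for r using z0[of r] by linarith
  have "(bump p q n has_real_derivative z' r / (1 + z r)\<^sup>2) (at r)" for r
    unfolding b using nz[of r]
    by (auto intro!: derivative_eq_intros dz simp: field_simps power2_eq_square)
  moreover have "continuous_on UNIV (\<lambda>r. z' r / (1 + z r)\<^sup>2)"
    unfolding z'_def z_def m_def m'_def
    using nz by (intro continuous_intros) (auto simp: z_def m_def)
  moreover have "\<exists>c d. p < c \<and> d < q \<and> (\<forall>r. r \<notin> {c..d} \<longrightarrow> bump p q n r = 0)"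
  proof -
    \<comment> \<open>Within distance e of an endpoint, (r - p) (q - r) is at most (q - p) e = 1 /
      (n + 1), so n times it does not exceed 1 and the positive part vanishes. \<open>Suc n\<close>
      keeps e finite for n = 0.\<close>
    define e where "e = 1 / ((q - p) * real (Suc n))"
    have e: "0 < e" using assms by (simp add: e_def)
    have "(q - p) * e = 1 / real (Suc n)" using assms by (simp add: e_def)
    then have ne: "real n * ((q - p) * e) \<le> 1" by simp
    have "bump p q n r = 0" if "r \<notin> {p + e..q - e}" for r
    proof -
      have "(r - p) * (q - r) \<le> (q - p) * e"
      proof (cases "p < r \<and> r < q")
        case False
        then have "(r - p) * (q - r) \<le> 0" using assms by (auto simp: mult_le_0_iff)
        also have "0 \<le> (q - p) * e" using e assms by simp
        finally show ?thesis .
      next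
        case True
        from that consider "r - p \<le> e" | "q - r \<le> e" by fastforce
        then show ?thesis
        proof cases
          case 1
          then have "(r - p) * (q - r) \<le> e * (q - p)" using True e by (intro mult_mono) auto
          then show ?thesis by (simp only: mult.commute)
        next
          case 2
          then show ?thesis using True e by (intro mult_mono) auto
        qed
      qed
      then have "real n * ((r - p) * (q - r)) \<le> real n * ((q - p) * e)" by (intro mult_left_mono) auto
      with ne have "m r \<le> 0" by (simp add: m_def)
      then show ?thesis by (simp add: b z_def)
    qed
    then show ?thesis using e by (intro exI[of _ "p + e"] exI[of _ "q - e"]) auto
  qed
  ultimately show ?thesis
    unfolding C1_supported_def by (intro exI[of _ "\<lambda>r. z' r / (1 + z r)\<^sup>2"] conjI allI)
qed

lemma bump_tendsto:
  assumes "p < q"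
  shows "(\<lambda>n. bump p q n r) \<longlonglongrightarrow> indicator {p<..<q} r"
proof (cases "r \<in> {p<..<q}")
  case True
  define k where "k = (r - p) * (q - r)"
  have k: "0 < k" using True by (simp add: k_def)
  have "filterlim (\<lambda>n. (real n * k - 1)\<^sup>2) at_top sequentially"
  proof -
    have "filterlim (\<lambda>n. real n * k - 1) at_top sequentially"
      using filterlim_at_top_mult_tendsto_pos[OF tendsto_const k filterlim_real_sequentially]
        filterlim_tendsto_add_at_top[OF tendsto_const, of "\<lambda>n. real n * k" sequentially "-1"]
      by (simp add: mult.commute)
    then show ?thesis by (intro filterlim_pow_at_top) auto
  qed
  then have "(\<lambda>n. inverse (1 + (real n * k - 1)\<^sup>2)) \<longlonglongrightarrow> 0"
    by (intro tendsto_inverse_0_at_top filterlim_tendsto_add_at_top[OF tendsto_const])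
  then have "(\<lambda>n. 1 - inverse (1 + (real n * k - 1)\<^sup>2)) \<longlonglongrightarrow> 1 - 0"
    by (intro tendsto_intros)
  then have 1: "(\<lambda>n. 1 - inverse (1 + (real n * k - 1)\<^sup>2)) \<longlonglongrightarrow> 1" by simp
  have ev: "\<forall>\<^sub>F n in sequentially. 1 - inverse (1 + (real n * k - 1)\<^sup>2) = bump p q n r"
  proof -
    have "\<forall>\<^sub>F n in sequentially. 1 / k \<le> real n"
      by (rule eventually_sequentiallyI[of "nat \<lceil>1 / k\<rceil>"]) linarith
    then show ?thesis
    proof eventually_elim
      case (elim n)
      then have "1 \<le> real n * k" using k by (simp add: field_simps)
      then have "max 0 (real n * k - 1) = real n * k - 1" by simp
      moreover have "1 + (real n * k - 1)\<^sup>2 \<noteq> 0"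
        by (smt (verit) zero_le_power2)
      ultimately show ?case unfolding bump_def Let_def k_def[symmetric]
        by (simp add: field_simps)
    qed
  qed
  from Lim_transform_eventually[OF 1 ev] show ?thesis using True by simp
next
  case False
  then have "(r - p) * (q - r) \<le> 0" using assms by (auto simp: mult_le_0_iff)
  then have "real n * ((r - p) * (q - r)) \<le> 0" for n by (simp add: mult_nonneg_nonpos)
  then have "max 0 (real n * ((r - p) * (q - r)) - 1) = 0" for n
    by (smt (verit) max_def)
  then show ?thesis using False by (simp add: bump_def)
qed

text \<open>Products of bumps approximate the indicators of boxes, which generate the Borel sets.\<close>

lemma fundamental_lemma_tensor:
  fixes w :: "real \<times> real \<Rightarrow> complex"
  assumes w: "integrable lborel w"
    and orth: "\<And>a a' b b'. \<lbrakk>C1_supported r0 r1 a a'; C1_supported x0 x1 b b'\<rbrakk>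
      \<Longrightarrow> (LINT p|lborel. w p * of_real (a (fst p) * b (snd p))) = 0"
  shows "AE p in lborel. p \<in> {r0..r1} \<times> {x0..x1} \<longrightarrow> w p = 0"
proof -
  let ?O = "{r0<..<r1} \<times> {x0<..<x1} :: (real \<times> real) set"
  have w_meas[measurable]: "w \<in> borel_measurable borel" using borel_measurable_integrable[OF w] by simp
  have O[measurable]: "?O \<in> sets borel" by (intro borel_open open_Times) auto
  \<comment> \<open>The bumps are bounded by 1 and converge to the indicator of the open box, so
    dominated convergence with majorant |w| applies.\<close>
  have small: "(LINT p|lborel. indicator ({p0<..<q0} \<times> {p1<..<q1}) p *\<^sub>R w p) = 0"
    if "r0 \<le> p0" "q0 \<le> r1" "x0 \<le> p1" "q1 \<le> x1" for p0 q0 p1 q1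
  proof (cases "p0 < q0 \<and> p1 < q1")
    case False
    then have "{p0<..<q0} \<times> {p1<..<q1} = ({} :: (real \<times> real) set)" by auto
    then show ?thesis by (simp only: indicator_def empty_iff if_False of_bool_eq scaleR_zero_left integral_zero)
  next
    case True
    let ?b = "\<lambda>n p. bump p0 q0 n (fst p) * bump p1 q1 n (snd p)"
    have [measurable]: "bump p q n \<in> borel_measurable borel" for p q n
      unfolding bump_def[abs_def] Let_def by measurable
    have "(\<lambda>n. LINT p|lborel. w p * of_real (?b n p)) \<longlonglongrightarrow>
        (LINT p|lborel. indicator ({p0<..<q0} \<times> {p1<..<q1}) p *\<^sub>R w p)"
    proof (rule integral_dominated_convergence)
      show "integrable lborel (\<lambda>p. norm (w p))" using w by simp
      show "AE p in lborel. (\<lambda>n. w p * of_real (?b n p)) \<longlonglongrightarrow> indicator ({p0<..<q0} \<times> {p1<..<q1}) p *\<^sub>R w p"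
      proof (intro AE_I2)
        fix p :: "real \<times> real"
        have "(\<lambda>n. w p * of_real (?b n p)) \<longlonglongrightarrow>
            w p * of_real (indicator {p0<..<q0} (fst p) * indicator {p1<..<q1} (snd p))"
          using True by (intro tendsto_intros bump_tendsto) auto
        also have "w p * of_real (indicator {p0<..<q0} (fst p) * indicator {p1<..<q1} (snd p))
            = indicator ({p0<..<q0} \<times> {p1<..<q1}) p *\<^sub>R w p"
          by (auto simp: indicator_def mem_Times_iff)
        finally show "(\<lambda>n. w p * of_real (?b n p)) \<longlonglongrightarrow> indicator ({p0<..<q0} \<times> {p1<..<q1}) p *\<^sub>R w p" .
      qed
      show "AE p in lborel. norm (w p * of_real (?b n p)) \<le> norm (w p)" for n
      proof (intro AE_I2)
        fix p :: "real \<times> real"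
        have "\<bar>?b n p\<bar> \<le> 1"
          using bump_bounds[of p0 q0 n "fst p"] bump_bounds[of p1 q1 n "snd p"]
          by (auto simp: abs_mult intro!: mult_le_one)
        then show "norm (w p * of_real (?b n p)) \<le> norm (w p)"
          unfolding norm_mult norm_of_real by (simp add: mult_left_le)
      qed
      have [measurable]: "{p0<..<q0} \<times> {p1<..<q1} \<in> sets borel" by (intro borel_open open_Times) auto
      show "(\<lambda>p. indicator ({p0<..<q0} \<times> {p1<..<q1}) p *\<^sub>R w p) \<in> borel_measurable lborel" by measurable
      show "(\<lambda>p. w p * of_real (?b n p)) \<in> borel_measurable lborel" for n
      proof -
        have "bump p q n \<in> borel_measurable borel" for p q by measurable
        then have "(\<lambda>p. w p * of_real (?b n p)) \<in> borel_measurable borel"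
          by (intro borel_measurable_times w_meas measurable_compose[OF _ borel_measurable_of_real]
              measurable_compose_fst_borel measurable_compose_snd_borel)
        then show ?thesis by simp
      qed
    qed
    moreover have "(LINT p|lborel. w p * of_real (?b n p)) = 0" for n
    proof -
      obtain a' b' where "C1_supported p0 q0 (bump p0 q0 n) a'" "C1_supported p1 q1 (bump p1 q1 n) b'"
        using bump_C1_supported True by meson
      then show ?thesis using that by (intro orth[of _ a' _ b']) (auto elim: C1_supported_mono)
    qed
    ultimately show ?thesis by (simp only: LIMSEQ_const_iff)
  qed
  define w0 where "w0 p = indicator ?O p *\<^sub>R w p" for p
  have w0: "integrable lborel w0" unfolding w0_def using w by (intro integrable_mult_indicator) auto
  have set0: "set_integrable lborel A w0" if "A \<in> sets borel" for A
    unfolding set_integrable_def using w0 that by (intro integrable_mult_indicator) auto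
  have "(LINT p:A|lborel. w0 p) = 0" if "A \<in> sets borel" for A
  proof -
    let ?G = "range (\<lambda>(a, b). box a b :: (real \<times> real) set)"
    have sb: "sets borel = sigma_sets UNIV ?G" by (simp add: borel_eq_box)
    \<comment> \<open>Open boxes generate the Borel sets and are stable under intersection, so a
      vanishing integral propagates through complements and countable disjoint unions.\<close>
    have "Int_stable ?G" by (auto simp: Int_stable_def box_Int_box)
    moreover have "?G \<subseteq> Pow UNIV" by simp
    moreover have "A \<in> sigma_sets UNIV ?G" using that sb by simp
    ultimately show ?thesis
    proof (induction rule: sigma_sets_induct_disjoint)
      case (basic A)
      then obtain l u where A: "A = box l u" by auto
      have "A \<inter> ?O = {max (fst l) r0<..<min (fst u) r1} \<times> {max (snd l) x0<..<min (snd u) x1}"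
        unfolding A by (cases l; cases u) (auto simp: box_def Basis_prod_def)
      moreover have "indicator A p *\<^sub>R w0 p = indicator (A \<inter> ?O) p *\<^sub>R w p" for p
        by (auto simp: w0_def indicator_def)
      ultimately show ?case unfolding set_lebesgue_integral_def by (simp add: small)
    next
      case (compl A)
      \<comment> \<open>The complement step needs the integral of w0 over the whole plane, which is
        the integral of w over the full open rectangle.\<close>
      have "(LINT p|lborel. w0 p) = 0" unfolding w0_def by (rule small) auto
      moreover have "indicator (UNIV - A) p *\<^sub>R w0 p = w0 p - indicator A p *\<^sub>R w0 p" for p
        by (auto simp: indicator_def)
      moreover have "A \<in> sets borel" using compl sb by simp
      ultimately show ?case
        using compl(2) set0[of A] w0 unfolding set_lebesgue_integral_def set_integrable_def
        by simp
    next
      case (union A)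
      have "A i \<in> sets borel" for i using union(2) sb by auto
      then have "(LINT p:(\<Union>i. A i)|lborel. w0 p) = (\<Sum>i. LINT p:A i|lborel. w0 p)"
        using union(1) by (intro lebesgue_integral_countable_add set0) (auto simp: disjoint_family_on_def)
      then show ?case using union(3) by simp
    next
      case empty
      show ?case by (simp add: set_lebesgue_integral_def)
    qed
  qed
  then have "AE p in lborel. w0 p = 0" using w0 by (intro sigma_finite_measure.density_zero[OF sigma_finite_lborel]) auto
  \<comment> \<open>Test functions supported in the interior say nothing about the boundary, but the
    boundary is a null set.\<close>
  moreover have "AE p in lborel. p \<notin> cbox (r0, x0) (r1, x1) - box (r0, x0) (r1, x1)"
    using AE_not_in[of "cbox (r0, x0) (r1, x1) - box (r0, x0) (r1, x1)" lebesgue]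
      negligible_frontier_interval[of "(r0, x0)" "(r1, x1)"]
    by (simp add: negligible_iff_null_sets AE_completion_iff)
  ultimately show ?thesis
    by eventually_elim (auto simp: w0_def indicator_def box_def Basis_prod_def split: if_splits)
qed

section \<open>Weak derivatives on a rectangle\<close>

lemma AE_lebesgue_on_borel:
  assumes "\<Omega> \<in> sets borel"
  shows "(AE p in lebesgue_on \<Omega>. P p) \<longleftrightarrow> (AE p in lborel. p \<in> \<Omega> \<longrightarrow> P p)"
  using assms by (subst AE_restrict_space_iff) (auto simp: AE_completion_iff)

lemma
  fixes F :: "'a::euclidean_space \<Rightarrow> 'b::{banach, second_countable_topology}"
  assumes \<Omega>: "\<Omega> \<in> sets borel" and F: "F \<in> borel_measurable borel" and zero: "\<And>p. p \<notin> \<Omega> \<Longrightarrow> F p = 0"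
  shows integrable_lebesgue_on_borel: "integrable (lebesgue_on \<Omega>) F \<longleftrightarrow> integrable lborel F"
    and integral_lebesgue_on_borel: "integral\<^sup>L (lebesgue_on \<Omega>) F = integral\<^sup>L lborel F"
proof -
  have ind: "(\<lambda>p. indicator \<Omega> p *\<^sub>R F p) = F" using zero by (auto simp: indicator_def)
  have s: "\<Omega> \<inter> space lebesgue \<in> sets lebesgue" using \<Omega> by auto
  show "integrable (lebesgue_on \<Omega>) F \<longleftrightarrow> integrable lborel F"
    unfolding integrable_restrict_space[OF s] ind using F by (simp add: integrable_completion)
  show "integral\<^sup>L (lebesgue_on \<Omega>) F = integral\<^sup>L lborel F"
    unfolding integral_restrict_space[OF s] ind using F by (simp add: integral_completion)
qed

text \<open>Sections of a Lebesgue measurable function need not be measurable, so every argument by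
  slices starts from a Borel representative extended by zero.\<close>

lemma borel_version:
  fixes f :: "'a::euclidean_space \<Rightarrow> complex"
  assumes \<Omega>[measurable]: "\<Omega> \<in> sets borel" and f: "f \<in> borel_measurable (lebesgue_on \<Omega>)"
  obtains f' where "f' \<in> borel_measurable borel" "AE p in lebesgue_on \<Omega>. f' p = f p"
    "\<And>p. p \<notin> \<Omega> \<Longrightarrow> f' p = 0"
proof -
  let ?F = "\<lambda>p. if p \<in> \<Omega> then f p else 0"
  have F[measurable]: "?F \<in> borel_measurable lebesgue" using \<Omega> f by (subst borel_measurable_if) auto
  have "(\<lambda>p. Re (?F p)) \<in> borel_measurable lebesgue" "(\<lambda>p. Im (?F p)) \<in> borel_measurable lebesgue"
    by measurable
  from this[THEN completion_ex_borel_measurable_real]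
  obtain g h where gh: "g \<in> borel_measurable lborel" "h \<in> borel_measurable lborel"
    and g: "AE p in lborel. Re (?F p) = g p" and h: "AE p in lborel. Im (?F p) = h p" by blast
  have [measurable]: "g \<in> borel_measurable borel" "h \<in> borel_measurable borel" using gh by simp_all
  define f' where "f' p = (if p \<in> \<Omega> then Complex (g p) (h p) else 0)" for p
  have "f' = (\<lambda>p. if p \<in> \<Omega> then of_real (g p) + \<i> * of_real (h p) else 0)"
    by (simp add: f'_def fun_eq_iff Complex_eq)
  then have "f' \<in> borel_measurable borel" by simp
  moreover have "AE p in lborel. p \<in> \<Omega> \<longrightarrow> f' p = f p"
    using g h by eventually_elim (auto simp: f'_def complex_eq_iff)
  ultimately show ?thesis
    using \<Omega> by (intro that[of f']) (auto simp: AE_lebesgue_on_borel f'_def)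
qed

section \<open>Weak derivatives and H1 on the slab\<close>

locale slab =
  fixes r0 r1 x0 x1 :: real and \<Omega> :: "(real \<times> real) set"
  assumes r01: "r0 < r1" and x01: "x0 < x1" and \<Omega>_eq: "\<Omega> = {r0..r1} \<times> {x0..x1}"
begin

abbreviation M where "M \<equiv> lebesgue_on \<Omega>"

lemma compact_\<Omega>: "compact \<Omega>"
  unfolding \<Omega>_eq by (intro compact_Times compact_Icc)

lemma \<Omega>_borel[measurable]: "\<Omega> \<in> sets borel"
  using compact_\<Omega> by (simp add: borel_compact)

lemma \<Omega>_lmeasurable: "\<Omega> \<in> lmeasurable"
  using compact_\<Omega> by (rule lmeasurable_compact)

lemma finite_M: "finite_measure M"
  using \<Omega>_lmeasurable by (rule finite_measure_lebesgue_on)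

lemma measure_\<Omega>: "measure lebesgue \<Omega> = (r1 - r0) * (x1 - x0)"
proof -
  have "\<Omega> = cbox (r0, x0) (r1, x1)" by (simp add: \<Omega>_eq cbox_Pair_eq)
  then show ?thesis using r01 x01 by (simp add: content_Pair)
qed

lemma L2_eq: "L2 \<Omega> = sqint M"
  by (simp add: L2_def sqint_def)

lemma continuous_measurable: "continuous_on \<Omega> f \<Longrightarrow> f \<in> borel_measurable M"
  by (rule continuous_imp_measurable_on_sets_lebesgue) auto

lemma continuous_bounded:
  fixes f :: "real \<times> real \<Rightarrow> 'b::real_normed_vector"
  assumes "continuous_on \<Omega> f"
  shows "\<exists>K. \<forall>p\<in>\<Omega>. norm (f p) \<le> K"
  using compact_imp_bounded[OF compact_continuous_image[OF assms compact_\<Omega>]]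
  by (auto simp: bounded_iff)

lemma continuous_sqint:
  assumes "continuous_on \<Omega> f"
  shows "f \<in> sqint M"
proof -
  obtain K where K: "\<And>p. p \<in> \<Omega> \<Longrightarrow> cmod (f p) \<le> K" using continuous_bounded[OF assms] by auto
  show ?thesis
  proof (rule sqintI[OF continuous_measurable[OF assms]])
    show "integrable M (\<lambda>_. K\<^sup>2)"
      using finite_M by (simp add: finite_measure.emeasure_finite integrable_const finite_measure.integrable_const)
    show "AE p in M. (cmod (f p))\<^sup>2 \<le> K\<^sup>2" by (intro AE_I2 power_mono K) auto
  qed
qed

lemma const_sqint: "(\<lambda>_. c) \<in> sqint M"
  by (intro continuous_sqint continuous_on_const)

lemma sqint_imp_integrable: "f \<in> sqint M \<Longrightarrow> integrable M f"
  using sqint_prod_integrable[OF _ const_sqint[of 1]] by simp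

lemma test_function_continuous:
  assumes "test_function \<Omega> \<phi> \<phi>'"
  shows "continuous_on \<Omega> \<phi>" "continuous_on \<Omega> (\<lambda>p. \<phi>' p h)"
proof -
  have "\<And>p. isCont \<phi> p" using assms unfolding test_function_def by (blast intro: has_derivative_continuous)
  then show "continuous_on \<Omega> \<phi>" by (simp add: continuous_at_imp_continuous_on)
  show "continuous_on \<Omega> (\<lambda>p. \<phi>' p h)"
    using assms unfolding test_function_def by (meson continuous_on_subset subset_UNIV)
qed

lemma integrable_mult_continuous:
  assumes u: "u \<in> sqint M" and f: "continuous_on \<Omega> (f :: _ \<Rightarrow> real)"
  shows "integrable M (\<lambda>p. u p * of_real (f p))"
  using sqint_prod_integrable[OF u continuous_sqint[of "\<lambda>p. of_real (f p)"]] f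
  by (simp add: continuous_on_of_real)

lemma integral_mult_continuous_comb:
  assumes u: "u \<in> sqint M" and v: "v \<in> sqint M" and f: "continuous_on \<Omega> (f :: _ \<Rightarrow> real)"
  shows "(LINT p|M. (c * u p + d * v p) * of_real (f p))
    = c * (LINT p|M. u p * of_real (f p)) + d * (LINT p|M. v p * of_real (f p))"
proof -
  have "(LINT p|M. (c * u p + d * v p) * of_real (f p))
      = (LINT p|M. c * (u p * of_real (f p)) + d * (v p * of_real (f p)))"
    by (simp add: algebra_simps)
  also have "\<dots> = (LINT p|M. c * (u p * of_real (f p))) + (LINT p|M. d * (v p * of_real (f p)))"
    by (intro Bochner_Integration.integral_add integrable_mult_right integrable_mult_continuous u v f)
  finally show ?thesis by simp
qed

lemma weak_derivative_comb:
  assumes "u \<in> sqint M" "v \<in> sqint M" "g \<in> sqint M" "h \<in> sqint M"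
    and "weak_derivative \<Omega> b u g" "weak_derivative \<Omega> b v h"
  shows "weak_derivative \<Omega> b (\<lambda>p. c * u p + d * v p) (\<lambda>p. c * g p + d * h p)"
  unfolding weak_derivative_def
proof (intro allI impI)
  fix \<phi> \<phi>' assume t: "test_function \<Omega> \<phi> \<phi>'"
  note c = test_function_continuous[OF t]
  show "(LINT p|M. (c * u p + d * v p) * of_real (\<phi>' p b)) = - (LINT p|M. (c * g p + d * h p) * of_real (\<phi> p))"
    unfolding integral_mult_continuous_comb[OF assms(1,2) c(2)] integral_mult_continuous_comb[OF assms(3,4) c(1)]
    using assms(5,6) t unfolding weak_derivative_def by simp
qed

lemma integral_borel_version:
  assumes u: "u \<in> sqint M" and u': "u' \<in> borel_measurable borel" "AE p in M. u' p = u p" "\<And>p. p \<notin> \<Omega> \<Longrightarrow> u' p = 0"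
    and f: "continuous_on UNIV (f :: _ \<Rightarrow> real)"
  shows "(LINT p|M. u p * of_real (f p)) = (LINT p|lborel. u' p * of_real (f p))"
proof -
  have f_meas[measurable]: "f \<in> borel_measurable borel" using f by (rule borel_measurable_continuous_onI)
  have f\<Omega>: "continuous_on \<Omega> f" using f continuous_on_subset by blast
  have u'f: "(\<lambda>p. u' p * of_real (f p)) \<in> borel_measurable borel" using u'(1) by measurable
  have m1: "(\<lambda>p. u' p * of_real (f p)) \<in> borel_measurable M"
    using u'f by (intro measurable_restrict_space1 measurable_completion) simp
  have "(LINT p|M. u p * of_real (f p)) = (LINT p|M. u' p * of_real (f p))"
    using u'(2) m1 borel_measurable_integrable[OF integrable_mult_continuous[OF u f\<Omega>]]
    by (intro integral_cong_AE) auto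
  also have "\<dots> = (LINT p|lborel. u' p * of_real (f p))"
    using u'(3) by (intro integral_lebesgue_on_borel \<Omega>_borel u'f) auto
  finally show ?thesis .
qed

text \<open>The difference of two weak derivatives is orthogonal to all product test functions, and
  the fundamental lemma applies to its Borel version. This makes the choice in \<open>wd_r\<close>
  and \<open>wd_x\<close> harmless.\<close>

lemma weak_derivative_unique:
  assumes g: "g \<in> sqint M" and h: "h \<in> sqint M"
    and "weak_derivative \<Omega> b u g" "weak_derivative \<Omega> b u h"
  shows "AE p in M. g p = h p"
proof -
  define k where "k p = g p - h p" for p
  have k: "k \<in> sqint M" unfolding k_def by (rule sqint_diff[OF g h])
  have orth: "(LINT p|M. k p * of_real (\<phi> p)) = 0" if t: "test_function \<Omega> \<phi> \<phi>'" for \<phi> \<phi>'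
    using integral_mult_continuous_comb[OF g h test_function_continuous(1)[OF t], of 1 "-1"]
      assms(3,4)[unfolded weak_derivative_def, rule_format, OF t] unfolding k_def by simp
  obtain k' where k': "k' \<in> borel_measurable borel" "AE p in M. k' p = k p" "\<And>p. p \<notin> \<Omega> \<Longrightarrow> k' p = 0"
    using borel_version[OF \<Omega>_borel sqint_measurable[OF k]] by blast
  have "integrable M k'"
    using k'(1,2) sqint_imp_integrable[OF k]
    by (subst integrable_cong_AE) (auto intro!: measurable_restrict_space1 measurable_completion)
  then have int: "integrable lborel k'" using integrable_lebesgue_on_borel[OF \<Omega>_borel k'(1,3)] by simp
  have "AE p in lborel. p \<in> {r0..r1} \<times> {x0..x1} \<longrightarrow> k' p = 0"
  proof (rule fundamental_lemma_tensor[OF int])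
    fix a a' c c' assume ac: "C1_supported r0 r1 a a'" "C1_supported x0 x1 c c'"
    have cont: "continuous_on UNIV (\<lambda>p :: real \<times> real. a (fst p) * c (snd p))"
      using C1_supported_continuous[OF ac(1)] C1_supported_continuous[OF ac(2)]
      by (intro continuous_on_mult continuous_on_compose_fst continuous_on_compose_snd)
    show "(LINT p|lborel. k' p * of_real (a (fst p) * c (snd p))) = 0"
      using orth[OF test_function_tensor[OF ac, folded \<Omega>_eq]] integral_borel_version[OF k k' cont] by simp
  qed
  then have "AE p in M. k' p = 0" by (simp add: AE_lebesgue_on_borel \<Omega>_eq[symmetric])
  with k'(2) show ?thesis by eventually_elim (simp add: k_def)
qed

lemma weak_derivative_cong:
  assumes "AE p in M. u p = v p" "u \<in> sqint M" "v \<in> sqint M" "weak_derivative \<Omega> b u g"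
  shows "weak_derivative \<Omega> b v g"
  unfolding weak_derivative_def
proof (intro allI impI)
  fix \<phi> \<phi>' assume t: "test_function \<Omega> \<phi> \<phi>'"
  note c = test_function_continuous(2)[OF t]
  have "(LINT p|M. v p * of_real (\<phi>' p b)) = (LINT p|M. u p * of_real (\<phi>' p b))"
    using assms(1) borel_measurable_integrable[OF integrable_mult_continuous[OF assms(2) c]]
      borel_measurable_integrable[OF integrable_mult_continuous[OF assms(3) c]]
    by (intro integral_cong_AE) auto
  then show "(LINT p|M. v p * of_real (\<phi>' p b)) = - (LINT p|M. g p * of_real (\<phi> p))"
    using assms(4) t unfolding weak_derivative_def by simp
qed

lemma H1_sqint: "u \<in> H1 \<Omega> \<Longrightarrow> u \<in> sqint M"
  by (simp add: H1_def L2_eq)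

lemma wd_r: "u \<in> H1 \<Omega> \<Longrightarrow> wd_r \<Omega> u \<in> sqint M \<and> weak_derivative \<Omega> (1, 0) u (wd_r \<Omega> u)"
  unfolding wd_r_def L2_eq[symmetric]
  by (rule someI_ex[of "\<lambda>g. g \<in> L2 \<Omega> \<and> weak_derivative \<Omega> (1, 0) u g"]) (auto simp: H1_def)

lemma wd_x: "u \<in> H1 \<Omega> \<Longrightarrow> wd_x \<Omega> u \<in> sqint M \<and> weak_derivative \<Omega> (0, 1) u (wd_x \<Omega> u)"
  unfolding wd_x_def L2_eq[symmetric]
  by (rule someI_ex[of "\<lambda>g. g \<in> L2 \<Omega> \<and> weak_derivative \<Omega> (0, 1) u g"]) (auto simp: H1_def)

lemma wd_sqint:
  assumes "u \<in> H1 \<Omega>"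
  shows "wd_r \<Omega> u \<in> sqint M" "wd_x \<Omega> u \<in> sqint M"
  using wd_r[OF assms] wd_x[OF assms] by simp_all

lemmas wd_measurable = wd_sqint[THEN sqint_measurable]

text \<open>The gateway to the chosen derivatives: whatever square-integrable weak derivative can be
  exhibited, \<open>wd_r\<close> and \<open>wd_x\<close> agree with it almost everywhere.\<close>

lemma H1I:
  assumes "u \<in> sqint M" "g \<in> sqint M" "h \<in> sqint M"
    and "weak_derivative \<Omega> (1, 0) u g" "weak_derivative \<Omega> (0, 1) u h"
  shows "u \<in> H1 \<Omega>" "AE p in M. wd_r \<Omega> u p = g p" "AE p in M. wd_x \<Omega> u p = h p"
proof -
  show u: "u \<in> H1 \<Omega>" using assms by (auto simp: H1_def L2_eq)
  show "AE p in M. wd_r \<Omega> u p = g p"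
    using wd_r[OF u] assms by (intro weak_derivative_unique[of _ _ "(1, 0)" u]) auto
  show "AE p in M. wd_x \<Omega> u p = h p"
    using wd_x[OF u] assms by (intro weak_derivative_unique[of _ _ "(0, 1)" u]) auto
qed

lemma H1_comb:
  assumes u: "u \<in> H1 \<Omega>" and v: "v \<in> H1 \<Omega>"
  shows "(\<lambda>p. c * u p + d * v p) \<in> H1 \<Omega>"
    and "AE p in M. wd_r \<Omega> (\<lambda>p. c * u p + d * v p) p = c * wd_r \<Omega> u p + d * wd_r \<Omega> v p"
    and "AE p in M. wd_x \<Omega> (\<lambda>p. c * u p + d * v p) p = c * wd_x \<Omega> u p + d * wd_x \<Omega> v p"
  using wd_r[OF u] wd_r[OF v] wd_x[OF u] wd_x[OF v] H1_sqint[OF u] H1_sqint[OF v]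
  by (intro H1I[of _ "\<lambda>p. c * wd_r \<Omega> u p + d * wd_r \<Omega> v p" "\<lambda>p. c * wd_x \<Omega> u p + d * wd_x \<Omega> v p"]
      sqint_comb weak_derivative_comb; simp)+

lemma H1_cong:
  assumes u: "u \<in> H1 \<Omega>" and v: "v \<in> borel_measurable M" and eq: "AE p in M. u p = v p"
  shows "v \<in> H1 \<Omega>" "AE p in M. wd_r \<Omega> v p = wd_r \<Omega> u p" "AE p in M. wd_x \<Omega> v p = wd_x \<Omega> u p"
proof -
  have "v \<in> sqint M" by (rule sqint_ae_cong[OF H1_sqint[OF u] v eq])
  then show "v \<in> H1 \<Omega>" "AE p in M. wd_r \<Omega> v p = wd_r \<Omega> u p" "AE p in M. wd_x \<Omega> v p = wd_x \<Omega> u p"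
    using wd_r[OF u] wd_x[OF u] weak_derivative_cong[OF eq H1_sqint[OF u]]
    by (intro H1I[of v "wd_r \<Omega> u" "wd_x \<Omega> u"]; simp)+
qed

text \<open>The complement of the compact set K is open, so the function is locally zero there and
  its derivative vanishes as well.\<close>

lemma test_function_zero:
  assumes "test_function \<Omega> \<phi> \<phi>'" "p \<notin> interior \<Omega>"
  shows "\<phi> p = 0" "\<phi>' p h = 0"
proof -
  from assms obtain K where K: "compact K" "K \<subseteq> interior \<Omega>" and z: "\<And>p. p \<notin> K \<Longrightarrow> \<phi> p = 0"
    and d: "(\<phi> has_derivative \<phi>' p) (at p)"
    unfolding test_function_def by blast
  have p: "p \<in> - K" using K(2) assms(2) by auto
  then show "\<phi> p = 0" using z by simp
  have "open (- K)" using K(1) by (simp add: compact_imp_closed open_Compl)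
  have "((\<lambda>_. 0) has_derivative \<phi>' p) (at p)"
    by (rule has_derivative_transform_within_open[OF d \<open>open (- K)\<close> p]) (use z in auto)
  then have "\<phi>' p = (\<lambda>h. 0)" using has_derivative_const by (rule has_derivative_unique)
  then show "\<phi>' p h = 0" by simp
qed

text \<open>Test functions vanish on the boundary, so the fundamental theorem of calculus kills each
  line integral and Fubini does the rest. The purpose is that constants have weak derivative
  zero.\<close>

lemma test_function_integral_zero:
  assumes t: "test_function \<Omega> \<phi> \<phi>'"
  shows "(LINT p|lborel. \<phi>' p (1, 0)) = 0" "(LINT p|lborel. \<phi>' p (0, 1)) = 0"
proof -
  have d: "(\<phi> has_derivative \<phi>' p) (at p)" and c: "continuous_on UNIV (\<lambda>p. \<phi>' p h)" for p h
    using t unfolding test_function_def by blast+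
  have out: "\<phi>' p h = 0" if "p \<notin> \<Omega>" for p h
    using test_function_zero(2)[OF t] that interior_subset by blast
  have int: "integrable lborel (\<lambda>p. \<phi>' p h)" for h
  proof -
    have "integrable lborel (\<lambda>p. indicator \<Omega> p *\<^sub>R \<phi>' p h)"
      by (intro borel_integrable_compact compact_\<Omega> continuous_on_subset[OF c]) simp
    moreover have "indicator \<Omega> p *\<^sub>R \<phi>' p h = \<phi>' p h" for p
      using out[of p h] by (cases "p \<in> \<Omega>") simp_all
    ultimately show ?thesis by (simp only:)
  qed
  have bd: "\<phi> (r0, x) = 0" "\<phi> (r1, x) = 0" "\<phi> (r, x0) = 0" "\<phi> (r, x1) = 0" for r x
    by (rule test_function_zero(1)[OF t]; simp add: \<Omega>_eq interior_Times)+
  have lin: "\<phi>' p (c *\<^sub>R h) = c * \<phi>' p h" for p c h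
    using linear_scale[OF has_derivative_linear[OF d[of p]]] by simp
  \<comment> \<open>One statement for both coordinate directions: g runs along a line with velocity
    b and lies in the rectangle at most between the parameters l and m.\<close>
  have line: "(LINT t|lborel. \<phi>' (g t) b) = 0"
    if g: "\<And>t. (g has_derivative (\<lambda>k. k *\<^sub>R b)) (at t)" and lm: "l \<le> m" and ends: "\<phi> (g l) = 0" "\<phi> (g m) = 0"
      and outside: "\<And>t. t \<notin> {l..m} \<Longrightarrow> g t \<notin> \<Omega>" for g :: "real \<Rightarrow> real \<times> real" and b l m
  proof -
    have der: "((\<lambda>t. \<phi> (g t)) has_vector_derivative \<phi>' (g t) b) (at t)" for t
      using has_derivative_compose[OF g[of t] d[of "g t"]] unfolding lin has_vector_derivative_def by simp
    have "continuous_on UNIV g"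
      using g has_derivative_continuous by (intro continuous_at_imp_continuous_on) blast
    then have cont: "continuous_on {l..m} (\<lambda>t. \<phi>' (g t) b)"
      by (intro continuous_on_subset[OF continuous_on_compose2[OF c]]) auto
    have "(LINT t|lborel. indicator {l..m} t *\<^sub>R \<phi>' (g t) b) = \<phi> (g m) - \<phi> (g l)"
      by (rule integral_FTC_atLeastAtMost[OF lm has_vector_derivative_at_within[OF der] cont])
    moreover have "indicator {l..m} t *\<^sub>R \<phi>' (g t) b = \<phi>' (g t) b" for t
      using out[OF outside[of t], of b] by (cases "t \<in> {l..m}") simp_all
    ultimately show ?thesis by (simp only: ends diff_self)
  qed
  have r: "(LINT r|lborel. \<phi>' (r, x) (1, 0)) = 0" for x
    by (rule line[of "\<lambda>r. (r, x)" _ r0 r1]) (use r01 bd in \<open>auto intro!: derivative_eq_intros simp: \<Omega>_eq\<close>)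
  have x: "(LINT x|lborel. \<phi>' (r, x) (0, 1)) = 0" for r
    by (rule line[of "\<lambda>x. (r, x)" _ x0 x1]) (use x01 bd in \<open>auto intro!: derivative_eq_intros simp: \<Omega>_eq\<close>)
  have split: "integrable (lborel \<Otimes>\<^sub>M lborel) (case_prod (\<lambda>r x. \<phi>' (r, x) h))" for h
    using int[of h] by (simp add: lborel_prod split_beta')
  show "(LINT p|lborel. \<phi>' p (1, 0)) = 0"
    using lborel_pair.integral_snd[OF split[of "(1, 0)"]] by (simp add: r lborel_prod split_beta')
  show "(LINT p|lborel. \<phi>' p (0, 1)) = 0"
    using lborel_pair.integral_fst[OF split[of "(0, 1)"]] by (simp add: x lborel_prod split_beta')
qed

lemma weak_derivative_const:
  "weak_derivative \<Omega> (1, 0) (\<lambda>_. c) (\<lambda>_. 0)" "weak_derivative \<Omega> (0, 1) (\<lambda>_. c) (\<lambda>_. 0)"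
proof -
  have "(LINT p|M. c * of_real (\<phi>' p b)) = 0"
    if t: "test_function \<Omega> \<phi> \<phi>'" and z: "(LINT p|lborel. \<phi>' p b) = 0" for \<phi> \<phi>' b
  proof -
    have "continuous_on UNIV (\<lambda>p. \<phi>' p b)" using t unfolding test_function_def by blast
    then have "(LINT p|M. \<phi>' p b) = (LINT p|lborel. \<phi>' p b)"
      using test_function_zero(2)[OF t] interior_subset
      by (intro integral_lebesgue_on_borel \<Omega>_borel borel_measurable_continuous_onI) blast+
    then show ?thesis using z by simp
  qed
  then show "weak_derivative \<Omega> (1, 0) (\<lambda>_. c) (\<lambda>_. 0)" "weak_derivative \<Omega> (0, 1) (\<lambda>_. c) (\<lambda>_. 0)"
    using test_function_integral_zero unfolding weak_derivative_def by auto
qed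

lemma H1_const:
  "(\<lambda>_. c) \<in> H1 \<Omega>" "AE p in M. wd_r \<Omega> (\<lambda>_. c) p = 0" "AE p in M. wd_x \<Omega> (\<lambda>_. c) p = 0"
  by (intro H1I[of _ "\<lambda>_. 0" "\<lambda>_. 0"] const_sqint weak_derivative_const)+

end

section \<open>The Poincare inequality\<close>

text \<open>No integrability is assumed: the integral of a non-integrable function is 0 by
  convention, so the bound survives. This spares a discussion of exceptional lines later.\<close>

lemma norm_integral_le_nn_integral:
  fixes f :: "'a \<Rightarrow> 'b::{banach, second_countable_topology}"
  shows "ennreal (norm (integral\<^sup>L M f)) \<le> (\<integral>\<^sup>+ x. norm (f x) \<partial>M)"
  by (cases "integrable M f") (simp_all add: integral_norm_bound_ennreal not_integrable_integral_eq)

lemma integrable_mult_bounded: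
  fixes f :: "'a \<Rightarrow> complex"
  assumes f: "integrable M f" and [measurable]: "b \<in> borel_measurable M" and B: "\<And>p. \<bar>b p\<bar> \<le> B"
  shows "integrable M (\<lambda>p. f p * of_real (b p))"
proof (rule Bochner_Integration.integrable_bound)
  have [measurable]: "f \<in> borel_measurable M" using f by (rule borel_measurable_integrable)
  show "(\<lambda>p. f p * of_real (b p)) \<in> borel_measurable M" by measurable
  show "integrable M (\<lambda>p. B * norm (f p))" using f by simp
  have "norm (f p * of_real (b p)) \<le> norm (B * norm (f p))" for p
    using B[of p] mult_right_mono[OF B, of "norm (f p)" p] by (simp add: norm_mult mult.commute abs_mult)
  then show "AE p in M. norm (f p * of_real (b p)) \<le> norm (B * norm (f p))" by simp
qed

lemma primitive_compact_support:
  fixes f :: "real \<Rightarrow> real"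
  assumes f: "continuous_on UNIV f" and supp: "\<And>r. r \<notin> {c..d} \<Longrightarrow> f r = 0"
  shows "((\<lambda>r. LINT s|lborel. indicator {..r} s * f s) has_real_derivative f r) (at r)"
proof -
  \<comment> \<open>l lies below the support and below r, so the integral from minus infinity starts
    at l; m = r + 1 makes r an interior point, which turns the one-sided derivative statement into a
    full one.\<close>
  define l m where "l = min c r - 1" and "m = r + 1"
  have fl: "continuous_on S f" for S using f continuous_on_subset by blast
  have eq: "(LINT s|lborel. indicator {..y} s * f s) = integral {l..y} f" for y
  proof -
    have "indicator {..y} s * f s = indicator {l..y} s *\<^sub>R f s" for s
      using supp[of s] by (cases "s \<in> {c..d}") (auto simp: indicator_def l_def)
    then have "(LINT s|lborel. indicator {..y} s * f s) = (LINT s:{l..y}|lborel. f s)"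
      unfolding set_lebesgue_integral_def by (simp only:)
    also have "\<dots> = integral {l..y} f"
      by (intro set_borel_integral_eq_integral borel_integrable_atLeastAtMost' fl)
    finally show ?thesis .
  qed
  have "((\<lambda>y. integral {l..y} f) has_real_derivative f r) (at r within {l..m})"
    by (rule integral_has_real_derivative[OF fl]) (auto simp: l_def m_def)
  moreover have "at r within {l..m} = at r"
    by (rule at_within_interior) (simp add: l_def m_def)
  ultimately show ?thesis by (simp add: eq)
qed

lemma integrable_prod_lborel:
  fixes f :: "'a::euclidean_space \<Rightarrow> real"
    and g :: "'b::euclidean_space \<Rightarrow> 'c::{banach, second_countable_topology}"
  assumes f: "integrable lborel f" and g: "integrable lborel g"
  shows "integrable lborel (\<lambda>p. f (fst p) *\<^sub>R g (snd p))"
proof -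
  have [measurable]: "f \<in> borel_measurable borel" "g \<in> borel_measurable borel"
    using borel_measurable_integrable[OF f] borel_measurable_integrable[OF g] by simp_all
  have "integrable (lborel \<Otimes>\<^sub>M lborel) (\<lambda>p. f (fst p) *\<^sub>R g (snd p))"
  proof (rule lborel_pair.Fubini_integrable)
    show "(\<lambda>p. f (fst p) *\<^sub>R g (snd p)) \<in> borel_measurable (lborel \<Otimes>\<^sub>M lborel)" by measurable
    show "integrable lborel (\<lambda>x. LINT y|lborel. norm (f (fst (x, y)) *\<^sub>R g (snd (x, y))))"
      using f by simp
    show "AE x in lborel. integrable lborel (\<lambda>y. f (fst (x, y)) *\<^sub>R g (snd (x, y)))"
      using g by simp
  qed
  then show ?thesis by (simp add: lborel_prod)
qed

lemma compact_support_bounded: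
  fixes f :: "real \<Rightarrow> real"
  assumes f: "continuous_on UNIV f" and z: "\<And>r. r \<notin> {c..d} \<Longrightarrow> f r = 0"
  obtains B where "0 \<le> B" "\<And>r. \<bar>f r\<bar> \<le> B"
proof -
  have "bounded (f ` {c..d})"
    using f by (intro compact_imp_bounded compact_continuous_image) (auto intro: continuous_on_subset)
  then obtain B where "\<forall>y\<in>f ` {c..d}. norm y \<le> B" unfolding bounded_iff by blast
  then have B: "\<bar>f r\<bar> \<le> B" if "r \<in> {c..d}" for r using that by auto
  have "\<bar>f r\<bar> \<le> max B 0" for r using B[of r] z[of r] by (cases "r \<in> {c..d}") auto
  then show ?thesis using that[of "max B 0"] by simp
qed

lemma compact_support_integrable:
  fixes f :: "real \<Rightarrow> real"
  assumes f: "continuous_on UNIV f" and z: "\<And>r. r \<notin> {c..d} \<Longrightarrow> f r = 0"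
  shows "integrable lborel f"
proof -
  have "integrable lborel (\<lambda>r. indicator {c..d} r *\<^sub>R f r)"
    using f by (intro borel_integrable_compact) (auto intro: continuous_on_subset)
  moreover have "indicator {c..d} r *\<^sub>R f r = f r" for r
    using z[of r] by (cases "r \<in> {c..d}") simp_all
  ultimately show ?thesis by (simp only:)
qed

text \<open>A weight for averages along coordinate lines. Continuity is enough, because it enters
  only through \<alpha> - (\<integral>\<alpha>) \<eta>, which plays the part of a derivative.
  Support strictly inside (l, m) keeps the primitive of that function an admissible test
  function.\<close>

locale cutoff =
  fixes l m :: real and \<eta> :: "real \<Rightarrow> real"
  assumes continuous: "continuous_on UNIV \<eta>"
    and nonneg: "0 \<le> \<eta> r"
    and support: "\<exists>c d. l < c \<and> d < m \<and> (\<forall>r. r \<notin> {c..d} \<longrightarrow> \<eta> r = 0)"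
    and integral: "(LINT r|lborel. \<eta> r) = 1"
begin

lemma measurable_eta[measurable]: "\<eta> \<in> borel_measurable borel"
  using continuous by (rule borel_measurable_continuous_onI)

lemma zero: "r \<notin> {l..m} \<Longrightarrow> \<eta> r = 0"
  using support by fastforce

lemma integrable_eta: "integrable lborel \<eta>"
  using continuous zero by (rule compact_support_integrable)

text \<open>With H the primitive of \<eta>, this is the step at s minus H. Integration by parts
  shows that for smooth u the difference of u(s) and the \<eta>-average of u is minus the integral
  of u' against \<open>kernel s\<close> over [l, m].\<close>

definition kernel :: "real \<Rightarrow> real \<Rightarrow> real" where
  "kernel s r = indicator {s<..} r - (LINT t|lborel. indicator {..r} t * \<eta> t)"

lemma kernel_measurable[measurable (raw)]:
  assumes [measurable]: "f \<in> borel_measurable N" "g \<in> borel_measurable N"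
  shows "(\<lambda>p. kernel (f p) (g p)) \<in> borel_measurable N"
proof -
  have "(\<lambda>p. (if f p < g p then 1 else 0) - (LINT t|lborel. (if t \<le> g p then 1 else 0) * \<eta> t)) \<in> borel_measurable N"
    by measurable
  then show ?thesis unfolding kernel_def by (simp add: indicator_def of_bool_def)
qed

text \<open>Both the indicator and the primitive of \<eta> take values in [0, 1].\<close>

lemma kernel_bound: "\<bar>kernel s r\<bar> \<le> 1"
proof -
  have "integrable lborel (\<lambda>t. indicator {..r} t * \<eta> t)"
    using integrable_mult_indicator[OF _ integrable_eta, of "{..r}"] by simp
  then have "(LINT t|lborel. indicator {..r} t * \<eta> t) \<le> (LINT t|lborel. \<eta> t)"
    by (intro integral_mono integrable_eta) (auto simp: indicator_def nonneg)
  moreover have "0 \<le> (LINT t|lborel. indicator {..r} t * \<eta> t)"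
    by (intro Bochner_Integration.integral_nonneg) (auto simp: indicator_def nonneg)
  ultimately show ?thesis unfolding kernel_def integral by (auto simp: indicator_def)
qed

text \<open>Subtracting the multiple of \<eta> makes the total integral zero, which is exactly what
  lets the primitive vanish to the right of the support.\<close>

lemma kernel_primitive:
  assumes a: "C1_supported l m \<alpha> \<alpha>'"
  shows "C1_supported l m (\<lambda>r. LINT s|lborel. kernel s r * \<alpha> s) (\<lambda>r. \<alpha> r - (LINT s|lborel. \<alpha> s) * \<eta> r)"
proof -
  define c where "c = (LINT s|lborel. \<alpha> s)"
  define g where "g r = \<alpha> r - c * \<eta> r" for r
  obtain e1 d1 where 1: "l < e1" "d1 < m" "\<And>r. r \<notin> {e1..d1} \<Longrightarrow> \<alpha> r = 0"
    using a unfolding C1_supported_def by blast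
  obtain e2 d2 where 2: "l < e2" "d2 < m" "\<And>r. r \<notin> {e2..d2} \<Longrightarrow> \<eta> r = 0" using support by blast
  define e d where "e = min e1 e2" and "d = max d1 d2"
  have ed: "l < e" "d < m" using 1 2 by (auto simp: e_def d_def)
  have g0: "g r = 0" if "r \<notin> {e..d}" for r
  proof -
    have "r \<notin> {e1..d1}" "r \<notin> {e2..d2}" using that by (auto simp: e_def d_def)
    from 1(3)[OF this(1)] 2(3)[OF this(2)] show ?thesis by (simp add: g_def)
  qed
  note ca = C1_supported_continuous[OF a]
  have [measurable]: "\<alpha> \<in> borel_measurable borel" using ca by (rule borel_measurable_continuous_onI)
  have ia: "integrable lborel \<alpha>"
    using ca C1_supported_zero[OF a] by (rule compact_support_integrable)
  have ind: "integrable lborel (\<lambda>s. indicator S s * f s)" if "integrable lborel f" "S \<in> sets borel" for f :: "real \<Rightarrow> real" and S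
    using integrable_mult_indicator[OF _ that(1), of S] that(2) by simp
  have prim: "(LINT s|lborel. kernel s r * \<alpha> s) = (LINT s|lborel. indicator {..r} s * g s)" for r
  proof -
    let ?H = "LINT t|lborel. indicator {..r} t * \<eta> t"
    \<comment> \<open>The step in \<open>kernel\<close> is strict while \<open>{..r}\<close>
      includes its endpoint; the two conventions differ only on the diagonal s = r.\<close>
    have "AE s in lborel. s \<noteq> r" by (rule AE_lborel_singleton)
    then have "(LINT s|lborel. kernel s r * \<alpha> s) = (LINT s|lborel. indicator {..r} s * \<alpha> s - ?H * \<alpha> s)"
      by (intro integral_cong_AE) (auto elim!: eventually_mono simp: kernel_def indicator_def algebra_simps)
    also have "\<dots> = (LINT s|lborel. indicator {..r} s * \<alpha> s) - ?H * c"
      unfolding c_def using ia ind[OF ia] by (subst Bochner_Integration.integral_diff) auto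
    also have "\<dots> = (LINT s|lborel. indicator {..r} s * \<alpha> s) - (LINT s|lborel. c * (indicator {..r} s * \<eta> s))"
      by simp
    also have "\<dots> = (LINT s|lborel. indicator {..r} s * \<alpha> s - c * (indicator {..r} s * \<eta> s))"
      using ind[OF ia] ind[OF integrable_eta] by (subst Bochner_Integration.integral_diff) auto
    also have "\<dots> = (LINT s|lborel. indicator {..r} s * g s)" by (simp add: g_def algebra_simps)
    finally show ?thesis .
  qed
  have cg: "continuous_on UNIV g" unfolding g_def using ca continuous by (intro continuous_intros)
  note pd = primitive_compact_support[OF cg g0]
  have out: "(LINT s|lborel. indicator {..r} s * g s) = 0" if "r \<notin> {e..d}" for r
  proof (cases "r < e")
    case True
    then have "indicator {..r} s * g s = 0" for s using g0[of s] by (auto simp: indicator_def)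
    then show ?thesis by (simp only: Bochner_Integration.integral_zero)
  next
    case False
    then have "indicator {..r} s * g s = g s" for s using g0[of s] that by (auto simp: indicator_def)
    then have "(LINT s|lborel. indicator {..r} s * g s) = (LINT s|lborel. \<alpha> s - c * \<eta> s)" by (simp only: g_def)
    also have "\<dots> = 0" using ia integrable_eta by (simp add: c_def integral)
    finally show ?thesis .
  qed
  have "C1_supported l m (\<lambda>r. LINT s|lborel. indicator {..r} s * g s) g"
    unfolding C1_supported_def using pd cg out ed by blast
  then show ?thesis unfolding prim g_def c_def .
qed

text \<open>Testing with \<open>\<alpha> - (\<integral>\<alpha>) \<eta>\<close>, which has a compactly supported primitive, expresses the
  deviation of \<open>u\<close> from its \<open>\<eta>\<close>-average on almost every line through its weak derivative \<open>g\<close>.\<close>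

lemma slice_identity:
  fixes u g :: "real \<times> real \<Rightarrow> complex"
  assumes u: "integrable lborel u" and g: "integrable lborel g"
    and weak: "\<And>a a' b b'. \<lbrakk>C1_supported l m a a'; C1_supported y0 y1 b b'\<rbrakk> \<Longrightarrow>
      (LINT p|lborel. u p * of_real (a' (fst p) * b (snd p))) = - (LINT p|lborel. g p * of_real (a (fst p) * b (snd p)))"
  shows "AE p in lborel. p \<in> {l..m} \<times> {y0..y1} \<longrightarrow>
    u p - (LINT r|lborel. u (r, snd p) * of_real (\<eta> r)) =
    - (LINT r|lborel. g (r, snd p) * of_real (kernel (fst p) r))"
proof -
  have [measurable]: "u \<in> borel_measurable (borel \<Otimes>\<^sub>M borel)" "g \<in> borel_measurable (borel \<Otimes>\<^sub>M borel)"
    using borel_measurable_integrable[OF u] borel_measurable_integrable[OF g] by (simp_all add: borel_prod)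
  define U where "U x = (LINT r|lborel. u (r, x) * of_real (\<eta> r))" for x
  define G where "G p = (LINT r|lborel. g (r, snd p) * of_real (kernel (fst p) r))" for p
  have [measurable]: "U \<in> borel_measurable borel" unfolding U_def by measurable
  have [measurable]: "G \<in> borel_measurable (borel \<Otimes>\<^sub>M borel)" unfolding G_def by measurable
  \<comment> \<open>U does not depend on the first coordinate and G need not decay in it; both are
    cut off to the strip so as to become integrable on the plane.\<close>
  let ?I = "indicator {l..m} :: real \<Rightarrow> real"
  have intI: "integrable lborel ?I" by (rule integrable_real_indicator) (auto simp: emeasure_lborel_Icc_eq)
  have bounded_mult: "integrable lborel (\<lambda>p. f p * of_real (b p))"
    if f: "integrable lborel f" and [measurable]: "b \<in> borel_measurable (borel \<Otimes>\<^sub>M borel)"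
      and B: "\<And>p. \<bar>b p\<bar> \<le> B" for f :: "real \<times> real \<Rightarrow> complex" and b B
    using that by (intro integrable_mult_bounded[OF f _ B]) (simp add: borel_prod)
  have split: "integrable (lborel \<Otimes>\<^sub>M lborel) (case_prod (\<lambda>r x. f (r, x)))" if "integrable lborel f"
    for f :: "real \<times> real \<Rightarrow> complex" using that by (simp add: lborel_prod split_beta')
  obtain E where E: "\<And>r. \<bar>\<eta> r\<bar> \<le> E" using compact_support_bounded[OF continuous zero] by blast
  have u\<eta>: "integrable lborel (\<lambda>p. u p * of_real (\<eta> (fst p)))"
    by (rule bounded_mult[OF u _ E]) measurable
  have U_int: "integrable lborel U"
    using lborel_pair.integrable_snd[OF split[OF u\<eta>]] by (simp add: U_def[abs_def])
  have U_int2: "integrable lborel (\<lambda>p. ?I (fst p) *\<^sub>R U (snd p))"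
    by (rule integrable_prod_lborel[OF intI U_int])
  \<comment> \<open>The bound of |G (s, x)| by the integral of |g (r, x)| over r is uniform in s;
    the cut-off supplies integrability in s.\<close>
  have G_int: "integrable lborel (\<lambda>p. ?I (fst p) *\<^sub>R G p)"
  proof (rule integrableI_bounded)
    have "(\<lambda>p. ?I (fst p) *\<^sub>R G p) \<in> borel_measurable (borel \<Otimes>\<^sub>M borel)" by measurable
    then show "(\<lambda>p. ?I (fst p) *\<^sub>R G p) \<in> borel_measurable lborel" by (simp add: borel_prod)
    have pt: "ennreal (norm (?I s *\<^sub>R G (s, x))) \<le> ennreal (?I s) * (\<integral>\<^sup>+ r. norm (g (r, x)) \<partial>lborel)" for s x
    proof -
      have "ennreal (norm (G (s, x))) \<le> (\<integral>\<^sup>+ r. norm (g (r, x) * of_real (kernel s r)) \<partial>lborel)"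
        unfolding G_def using norm_integral_le_nn_integral by simp
      also have "\<dots> \<le> (\<integral>\<^sup>+ r. norm (g (r, x)) \<partial>lborel)"
        using kernel_bound by (intro nn_integral_mono ennreal_leI) (simp add: norm_mult mult_left_le)
      finally show ?thesis by (cases "s \<in> {l..m}") (auto simp: indicator_def)
    qed
    have "(\<integral>\<^sup>+ p. norm (?I (fst p) *\<^sub>R G p) \<partial>lborel) = (\<integral>\<^sup>+ s. \<integral>\<^sup>+ x. norm (?I s *\<^sub>R G (s, x)) \<partial>lborel \<partial>lborel)"
      by (subst lborel_prod[symmetric], subst lborel.nn_integral_fst[symmetric]) simp_all
    also have "\<dots> \<le> (\<integral>\<^sup>+ s. \<integral>\<^sup>+ x. ennreal (?I s) * (\<integral>\<^sup>+ r. norm (g (r, x)) \<partial>lborel) \<partial>lborel \<partial>lborel)"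
      by (intro nn_integral_mono pt)
    also have "\<dots> = (\<integral>\<^sup>+ s. ennreal (?I s) * (\<integral>\<^sup>+ x. (\<integral>\<^sup>+ r. norm (g (r, x)) \<partial>lborel) \<partial>lborel) \<partial>lborel)"
      by (intro nn_integral_cong nn_integral_cmult) measurable
    also have "\<dots> = (\<integral>\<^sup>+ s. ennreal (?I s) \<partial>lborel) * (\<integral>\<^sup>+ x. (\<integral>\<^sup>+ r. norm (g (r, x)) \<partial>lborel) \<partial>lborel)"
      by (intro nn_integral_multc) measurable
    also have "(\<integral>\<^sup>+ x. (\<integral>\<^sup>+ r. norm (g (r, x)) \<partial>lborel) \<partial>lborel) = (\<integral>\<^sup>+ p. norm (g p) \<partial>lborel)"
    proof -
      have "(\<integral>\<^sup>+ x. (\<integral>\<^sup>+ r. norm (g (r, x)) \<partial>lborel) \<partial>lborel) = (\<integral>\<^sup>+ p. norm (g p) \<partial>(lborel \<Otimes>\<^sub>M lborel))"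
        by (rule lborel_pair.nn_integral_snd) measurable
      then show ?thesis by (simp add: lborel_prod)
    qed
    also have "(\<integral>\<^sup>+ s. ennreal (?I s) \<partial>lborel) * (\<integral>\<^sup>+ p. norm (g p) \<partial>lborel) < \<infinity>"
    proof -
      have "(\<integral>\<^sup>+ s. ennreal (?I s) \<partial>lborel) < \<infinity>" "(\<integral>\<^sup>+ p. norm (g p) \<partial>lborel) < \<infinity>"
        using intI g unfolding integrable_iff_bounded by auto
      then show ?thesis by (simp only: infinity_ennreal_def ennreal_mult_less_top) simp
    qed
    finally show "(\<integral>\<^sup>+ p. norm (?I (fst p) *\<^sub>R G p) \<partial>lborel) < \<infinity>" .
  qed
  have u_int: "integrable lborel (\<lambda>p. ?I (fst p) *\<^sub>R u p)"
    using bounded_mult[OF u, of "\<lambda>p. ?I (fst p)" 1] by (simp add: scaleR_conv_of_real mult.commute)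
  define w where "w p = ?I (fst p) *\<^sub>R u p - ?I (fst p) *\<^sub>R U (snd p) + ?I (fst p) *\<^sub>R G p" for p
  have w_int: "integrable lborel w" unfolding w_def
    by (intro Bochner_Integration.integrable_add Bochner_Integration.integrable_diff u_int U_int2 G_int)
  have "AE p in lborel. p \<in> {l..m} \<times> {y0..y1} \<longrightarrow> w p = 0"
  proof (rule fundamental_lemma_tensor[OF w_int])
    fix \<alpha> \<alpha>' \<beta> \<beta>' assume a: "C1_supported l m \<alpha> \<alpha>'" and b: "C1_supported y0 y1 \<beta> \<beta>'"
    note ca = C1_supported_continuous[OF a] and cb = C1_supported_continuous[OF b]
    have [measurable]: "\<alpha> \<in> borel_measurable borel" "\<beta> \<in> borel_measurable borel"
      using ca cb by (auto intro: borel_measurable_continuous_onI)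
    obtain A where A: "0 \<le> A" "\<And>r. \<bar>\<alpha> r\<bar> \<le> A" using compact_support_bounded[OF ca C1_supported_zero[OF a]] by blast
    obtain B where B: "0 \<le> B" "\<And>r. \<bar>\<beta> r\<bar> \<le> B" using compact_support_bounded[OF cb C1_supported_zero[OF b]] by blast
    have ia: "integrable lborel \<alpha>" using ca C1_supported_zero[OF a] by (rule compact_support_integrable)
    define c where "c = (LINT s|lborel. \<alpha> s)"
    let ?ab = "\<lambda>p. \<alpha> (fst p) * \<beta> (snd p)"
    have ab_int: "integrable lborel (\<lambda>p. f p * of_real (?ab p))" if "integrable lborel f" for f :: "real \<times> real \<Rightarrow> complex"
    proof (rule bounded_mult[OF that])
      show "\<bar>?ab p\<bar> \<le> A * B" for p
        unfolding abs_mult using A B by (intro mult_mono) auto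
    qed measurable
    have Ia: "?I r * \<alpha> r = \<alpha> r" for r using C1_supported_zero[OF a, of r] by (cases "r \<in> {l..m}") auto
    have Iab: "(?I (fst p) *\<^sub>R z) * of_real (?ab p) = z * of_real (?ab p)" for z :: complex and p
    proof -
      have "(?I (fst p) *\<^sub>R z) * of_real (?ab p) = z * of_real ((?I (fst p) * \<alpha> (fst p)) * \<beta> (snd p))"
        by (simp add: scaleR_conv_of_real)
      then show ?thesis unfolding Ia .
    qed
    \<comment> \<open>Integrating out the first coordinate leaves c times a pairing of u with
      \<eta>, the very term that the test function \<alpha> - c \<eta> subtracts.\<close>
    have T2: "(LINT p|lborel. (?I (fst p) *\<^sub>R U (snd p)) * of_real (?ab p))
        = of_real c * (LINT p|lborel. u p * of_real (\<eta> (fst p) * \<beta> (snd p)))"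
    proof -
      have "integrable lborel (\<lambda>p. (u p * of_real (\<eta> (fst p))) * of_real (\<beta> (snd p)))"
        by (rule bounded_mult[OF u\<eta> _ B(2)]) measurable
      then have uhb: "integrable lborel (\<lambda>p. u p * of_real (\<eta> (fst p) * \<beta> (snd p)))" by (simp add: mult.assoc)
      have "(LINT p|lborel. (?I (fst p) *\<^sub>R U (snd p)) * of_real (?ab p))
          = (LINT s|lborel. LINT x|lborel. of_real (\<alpha> s) * (U x * of_real (\<beta> x)))"
        using lborel_pair.integral_fst[OF split[OF ab_int[OF U_int2]]]
        unfolding Iab by (simp add: lborel_prod split_beta' mult.commute mult.left_commute)
      also have "\<dots> = of_real c * (LINT x|lborel. U x * of_real (\<beta> x))"
        by (simp add: c_def)
      also have "(LINT x|lborel. U x * of_real (\<beta> x)) = (LINT x|lborel. LINT r|lborel. u (r, x) * of_real (\<eta> r * \<beta> x))"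
        unfolding U_def by (simp add: mult.assoc flip: Bochner_Integration.integral_mult_left_zero)
      also have "\<dots> = (LINT p|lborel. u p * of_real (\<eta> (fst p) * \<beta> (snd p)))"
        using lborel_pair.integral_snd[OF split[OF uhb]] by (simp add: lborel_prod split_beta')
      finally show ?thesis .
    qed
    \<comment> \<open>Interchanging s with the integration point moves the kernel from g onto
      \<alpha>, so that g is tested against the primitive of
      \<open>kernel_primitive\<close>.\<close>
    have T3: "(LINT p|lborel. (?I (fst p) *\<^sub>R G p) * of_real (?ab p))
        = (LINT p|lborel. g p * of_real ((LINT s|lborel. kernel s (fst p) * \<alpha> s) * \<beta> (snd p)))"
    proof -
      define F where "F s p = g p * of_real (kernel s (fst p) * \<alpha> s * \<beta> (snd p))" for s and p :: "real \<times> real"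
      have Fs: "integrable lborel (F s)" for s unfolding F_def
      proof (rule bounded_mult[OF g])
        show "\<bar>kernel s (fst p) * \<alpha> s * \<beta> (snd p)\<bar> \<le> 1 * A * B" for p
          unfolding abs_mult using A B kernel_bound by (intro mult_mono) auto
      qed measurable
      have F_int: "integrable (lborel \<Otimes>\<^sub>M lborel) (case_prod F)"
      proof (rule Bochner_Integration.integrable_bound)
        have "integrable lborel (\<lambda>q :: real \<times> real \<times> real. \<bar>\<alpha> (fst q)\<bar> *\<^sub>R (B * norm (g (snd q))))"
          using ia g by (intro integrable_prod_lborel[of "\<lambda>s. \<bar>\<alpha> s\<bar>" "\<lambda>p. B * norm (g p)"]) auto
        then show "integrable (lborel \<Otimes>\<^sub>M lborel) (\<lambda>q. \<bar>\<alpha> (fst q)\<bar> *\<^sub>R (B * norm (g (snd q))))"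
          by (simp add: lborel_prod)
        have "(\<lambda>q. F (fst q) (snd q)) \<in> borel_measurable (borel \<Otimes>\<^sub>M (borel \<Otimes>\<^sub>M borel))"
          unfolding F_def by measurable
        then show "case_prod F \<in> borel_measurable (lborel \<Otimes>\<^sub>M lborel)"
          by (simp add: split_beta' borel_prod lborel_prod)
        have "norm (F s p) \<le> \<bar>\<alpha> s\<bar> * (B * norm (g p))" for s p
        proof -
          have "\<bar>kernel s (fst p)\<bar> * \<bar>\<alpha> s\<bar> * \<bar>\<beta> (snd p)\<bar> * norm (g p) \<le> 1 * \<bar>\<alpha> s\<bar> * B * norm (g p)"
            using B kernel_bound by (intro mult_mono) auto
          then show ?thesis by (simp add: F_def norm_mult abs_mult mult.commute mult.left_commute)
        qed
        then show "AE q in lborel \<Otimes>\<^sub>M lborel. norm (case_prod F q) \<le> norm (\<bar>\<alpha> (fst q)\<bar> *\<^sub>R (B * norm (g (snd q))))"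
          using B(1) by (auto simp: split_beta abs_mult)
      qed
      have "(LINT p|lborel. (?I (fst p) *\<^sub>R G p) * of_real (?ab p))
          = (LINT s|lborel. LINT x|lborel. G (s, x) * of_real (\<alpha> s * \<beta> x))"
        using lborel_pair.integral_fst[OF split[OF ab_int[OF G_int]]]
        unfolding Iab by (simp add: lborel_prod split_beta')
      also have "\<dots> = (LINT s|lborel. LINT x|lborel. LINT r|lborel. F s (r, x))"
        unfolding G_def F_def
        by (simp add: mult.assoc flip: Bochner_Integration.integral_mult_left_zero)
      also have "\<dots> = (LINT s|lborel. LINT p|lborel. F s p)"
        using lborel_pair.integral_snd[OF split[OF Fs]] by (simp add: lborel_prod split_beta')
      also have "\<dots> = (LINT p|lborel. LINT s|lborel. F s p)"
        by (rule lborel_pair.Fubini_integral[OF F_int, symmetric])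
      also have "\<dots> = (LINT p|lborel. g p * of_real ((LINT s|lborel. kernel s (fst p) * \<alpha> s) * \<beta> (snd p)))"
        unfolding F_def
        by (simp only: Bochner_Integration.integral_mult_right_zero integral_complex_of_real
            Bochner_Integration.integral_mult_left_zero)
      finally show ?thesis .
    qed
    have T1: "(LINT p|lborel. u p * of_real (?ab p)) - of_real c * (LINT p|lborel. u p * of_real (\<eta> (fst p) * \<beta> (snd p)))
        = - (LINT p|lborel. g p * of_real ((LINT s|lborel. kernel s (fst p) * \<alpha> s) * \<beta> (snd p)))"
    proof -
      have "integrable lborel (\<lambda>p. (u p * of_real (\<eta> (fst p))) * of_real (\<beta> (snd p)))"
        by (rule bounded_mult[OF u\<eta> _ B(2)]) measurable
      then have uhb: "integrable lborel (\<lambda>p. of_real c * (u p * of_real (\<eta> (fst p) * \<beta> (snd p))))" by (simp add: mult.assoc)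
      have "(LINT p|lborel. u p * of_real (?ab p)) - of_real c * (LINT p|lborel. u p * of_real (\<eta> (fst p) * \<beta> (snd p)))
          = (LINT p|lborel. u p * of_real (?ab p) - of_real c * (u p * of_real (\<eta> (fst p) * \<beta> (snd p))))"
        by (subst Bochner_Integration.integral_diff[OF ab_int[OF u] uhb]) simp
      also have "\<dots> = (LINT p|lborel. u p * of_real ((\<alpha> (fst p) - c * \<eta> (fst p)) * \<beta> (snd p)))"
        by (simp add: algebra_simps)
      also have "\<dots> = - (LINT p|lborel. g p * of_real ((LINT s|lborel. kernel s (fst p) * \<alpha> s) * \<beta> (snd p)))"
        unfolding c_def by (rule weak[OF kernel_primitive[OF a] b])
      finally show ?thesis .
    qed
    have "(LINT p|lborel. w p * of_real (?ab p)) =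
        (LINT p|lborel. (?I (fst p) *\<^sub>R u p) * of_real (?ab p)) - (LINT p|lborel. (?I (fst p) *\<^sub>R U (snd p)) * of_real (?ab p))
        + (LINT p|lborel. (?I (fst p) *\<^sub>R G p) * of_real (?ab p))"
      unfolding w_def ring_distribs
      by (simp only: Bochner_Integration.integral_add[OF Bochner_Integration.integrable_diff[OF ab_int[OF u_int] ab_int[OF U_int2]] ab_int[OF G_int]]
          Bochner_Integration.integral_diff[OF ab_int[OF u_int] ab_int[OF U_int2]])
    then show "(LINT p|lborel. w p * of_real (?ab p)) = 0"
      using T1 unfolding T2 T3 by (simp only: Iab left_minus)
  qed
  then show ?thesis
    by eventually_elim (auto simp: w_def U_def G_def mem_Times_iff algebra_simps eq_neg_iff_add_eq_0)
qed

text \<open>The kernel is bounded by 1, so Cauchy-Schwarz on a line costs one factor m - l, and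
  integrating the resulting bound, which is independent of s, over s in [l, m] costs a second
  one.\<close>

lemma slice_bound:
  fixes u g :: "real \<times> real \<Rightarrow> complex"
  assumes lm: "l \<le> m" and u: "integrable lborel u" and g: "integrable lborel g"
    and weak: "\<And>a a' b b'. \<lbrakk>C1_supported l m a a'; C1_supported y0 y1 b b'\<rbrakk> \<Longrightarrow>
      (LINT p|lborel. u p * of_real (a' (fst p) * b (snd p))) = - (LINT p|lborel. g p * of_real (a (fst p) * b (snd p)))"
    and g0: "\<And>p. fst p \<notin> {l..m} \<Longrightarrow> g p = 0"
  shows "(\<integral>\<^sup>+ p. ennreal ((cmod (u p - (LINT r|lborel. u (r, snd p) * of_real (\<eta> r))))\<^sup>2) * indicator ({l..m} \<times> {y0..y1}) p \<partial>lborel)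
    \<le> ennreal ((m - l)\<^sup>2) * (\<integral>\<^sup>+ p. ennreal ((cmod (g p))\<^sup>2) \<partial>lborel)"
proof -
  have [measurable]: "g \<in> borel_measurable (borel \<Otimes>\<^sub>M borel)"
    using borel_measurable_integrable[OF g] by (simp add: borel_prod)
  define N where "N x = (\<integral>\<^sup>+ r. ennreal ((cmod (g (r, x)))\<^sup>2) \<partial>lborel)" for x
  have [measurable]: "N \<in> borel_measurable borel" unfolding N_def by measurable
  have AE_id: "AE p in lborel. p \<in> {l..m} \<times> {y0..y1} \<longrightarrow>
      u p - (LINT r|lborel. u (r, snd p) * of_real (\<eta> r)) = - (LINT r|lborel. g (r, snd p) * of_real (kernel (fst p) r))"
    by (rule slice_identity[OF u g weak])
  have line: "(ennreal (cmod (LINT r|lborel. g (r, x) * of_real (kernel s r))))\<^sup>2 \<le> ennreal (m - l) * N x" for s x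
  proof -
    have "ennreal (cmod (LINT r|lborel. g (r, x) * of_real (kernel s r)))
        \<le> (\<integral>\<^sup>+ r. cmod (g (r, x) * of_real (kernel s r)) \<partial>lborel)"
      by (rule norm_integral_le_nn_integral)
    also have "\<dots> \<le> (\<integral>\<^sup>+ r. indicator {l..m} r * ennreal (cmod (g (r, x))) \<partial>lborel)"
    proof (rule nn_integral_mono)
      fix r
      have "cmod (g (r, x) * of_real (kernel s r)) \<le> cmod (g (r, x))"
        using kernel_bound by (simp add: norm_mult mult_left_le)
      then show "ennreal (cmod (g (r, x) * of_real (kernel s r))) \<le> indicator {l..m} r * ennreal (cmod (g (r, x)))"
        using g0[of "(r, x)"] by (cases "r \<in> {l..m}") (simp_all add: ennreal_leI)
    qed
    finally have "(ennreal (cmod (LINT r|lborel. g (r, x) * of_real (kernel s r))))\<^sup>2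
        \<le> (\<integral>\<^sup>+ r. indicator {l..m} r * ennreal (cmod (g (r, x))) \<partial>lborel)\<^sup>2"
      by (rule power_mono) simp
    also have "\<dots> \<le> (\<integral>\<^sup>+ r. (indicator {l..m} r)\<^sup>2 \<partial>lborel) * (\<integral>\<^sup>+ r. (ennreal (cmod (g (r, x))))\<^sup>2 \<partial>lborel)"
      by (rule Cauchy_Schwarz_nn_integral) measurable
    also have "(\<integral>\<^sup>+ r. (indicator {l..m} r)\<^sup>2 \<partial>lborel) = ennreal (m - l)"
    proof -
      have "(\<integral>\<^sup>+ r. (indicator {l..m} r :: ennreal)\<^sup>2 \<partial>lborel) = (\<integral>\<^sup>+ r. indicator {l..m} r \<partial>lborel)"
        by (intro nn_integral_cong) (simp add: indicator_def)
      then show ?thesis using lm by simp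
    qed
    finally show ?thesis by (simp add: N_def ennreal_power)
  qed
  have "(\<integral>\<^sup>+ p. ennreal ((cmod (u p - (LINT r|lborel. u (r, snd p) * of_real (\<eta> r))))\<^sup>2) * indicator ({l..m} \<times> {y0..y1}) p \<partial>lborel)
      \<le> (\<integral>\<^sup>+ p. indicator {l..m} (fst p) * (ennreal (m - l) * N (snd p)) \<partial>lborel)"
  proof (rule nn_integral_mono_AE, use AE_id in eventually_elim)
    fix p :: "real \<times> real"
    assume id: "p \<in> {l..m} \<times> {y0..y1} \<longrightarrow> u p - (LINT r|lborel. u (r, snd p) * of_real (\<eta> r)) =
      - (LINT r|lborel. g (r, snd p) * of_real (kernel (fst p) r))"
    show "ennreal ((cmod (u p - (LINT r|lborel. u (r, snd p) * of_real (\<eta> r))))\<^sup>2) * indicator ({l..m} \<times> {y0..y1}) p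
        \<le> indicator {l..m} (fst p) * (ennreal (m - l) * N (snd p))"
    proof (cases "p \<in> {l..m} \<times> {y0..y1}")
      case True
      then have "fst p \<in> {l..m}" by auto
      with True show ?thesis using line[of "snd p" "fst p"] id by (simp add: ennreal_power)
    qed simp
  qed
  also have "\<dots> = (\<integral>\<^sup>+ s. \<integral>\<^sup>+ x. indicator {l..m} s * (ennreal (m - l) * N x) \<partial>lborel \<partial>lborel)"
    by (subst lborel_prod[symmetric], subst lborel.nn_integral_fst[symmetric]) simp_all
  also have "\<dots> = (\<integral>\<^sup>+ s. indicator {l..m} s * (\<integral>\<^sup>+ x. ennreal (m - l) * N x \<partial>lborel) \<partial>lborel)"
    by (intro nn_integral_cong nn_integral_cmult) measurable
  also have "\<dots> = (\<integral>\<^sup>+ s. indicator {l..m} s \<partial>lborel) * (\<integral>\<^sup>+ x. ennreal (m - l) * N x \<partial>lborel)"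
    by (intro nn_integral_multc) measurable
  also have "\<dots> = ennreal (m - l) * (ennreal (m - l) * (\<integral>\<^sup>+ x. N x \<partial>lborel))"
    using lm by (simp add: nn_integral_cmult)
  also have "(\<integral>\<^sup>+ x. N x \<partial>lborel) = (\<integral>\<^sup>+ p. ennreal ((cmod (g p))\<^sup>2) \<partial>lborel)"
  proof -
    have "(\<integral>\<^sup>+ x. N x \<partial>lborel) = (\<integral>\<^sup>+ p. ennreal ((cmod (g p))\<^sup>2) \<partial>(lborel \<Otimes>\<^sub>M lborel))"
      unfolding N_def by (rule lborel_pair.nn_integral_snd) measurable
    then show ?thesis by (simp add: lborel_prod)
  qed
  also have "ennreal (m - l) * (ennreal (m - l) * (\<integral>\<^sup>+ p. ennreal ((cmod (g p))\<^sup>2) \<partial>lborel))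
      = ennreal ((m - l)\<^sup>2) * (\<integral>\<^sup>+ p. ennreal ((cmod (g p))\<^sup>2) \<partial>lborel)"
    using lm by (simp add: power2_eq_square ennreal_mult mult.assoc)
  finally show ?thesis .
qed

text \<open>Averaging u - X against \<eta> costs the L2 norm of \<eta>. With X the line average in
  the other coordinate, the oscillation of the averages is reduced to a slice estimate in that
  coordinate.\<close>

lemma average_bound:
  fixes u :: "real \<times> real \<Rightarrow> complex" and X :: "real \<Rightarrow> complex"
  assumes lm: "l \<le> m" and u: "integrable lborel u"
    and X: "X \<in> borel_measurable borel" and X_int: "integrable lborel (\<lambda>r. X r * of_real (\<eta> r))"
  shows "(\<integral>\<^sup>+ p. ennreal ((cmod ((LINT r|lborel. u (r, snd p) * of_real (\<eta> r)) - (LINT r|lborel. X r * of_real (\<eta> r))))\<^sup>2)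
        * indicator ({l..m} \<times> {y0..y1}) p \<partial>lborel)
    \<le> ennreal (m - l) * (\<integral>\<^sup>+ r. (ennreal (\<eta> r))\<^sup>2 \<partial>lborel) *
      (\<integral>\<^sup>+ p. ennreal ((cmod (u p - X (fst p)))\<^sup>2) * indicator ({l..m} \<times> {y0..y1}) p \<partial>lborel)"
proof -
  have um[measurable]: "u \<in> borel_measurable (borel \<Otimes>\<^sub>M borel)"
    using borel_measurable_integrable[OF u] by (simp add: borel_prod)
  note [measurable] = X
  define c where "c = (LINT r|lborel. X r * of_real (\<eta> r))"
  define U where "U x = (LINT r|lborel. u (r, x) * of_real (\<eta> r))" for x
  have [measurable]: "U \<in> borel_measurable borel" unfolding U_def by measurable
  define K where "K = (\<integral>\<^sup>+ r. (ennreal (\<eta> r))\<^sup>2 \<partial>lborel)"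
  define D where "D x = (\<integral>\<^sup>+ r. ennreal ((cmod (u (r, x) - X r))\<^sup>2) * indicator {l..m} r \<partial>lborel)" for x
  have [measurable]: "D \<in> borel_measurable borel" unfolding D_def by measurable
  obtain E where E: "\<And>r. \<bar>\<eta> r\<bar> \<le> E" using compact_support_bounded[OF continuous zero] by blast
  \<comment> \<open>Splitting the average of u - X into two integrals requires an integrable
    section, which Fubini grants for almost every x.\<close>
  have "AE x in lborel. integrable lborel (\<lambda>r. u (r, x))"
    using lborel_pair.AE_integrable_snd[of "\<lambda>r x. u (r, x)"] u by (simp add: lborel_prod split_beta')
  then have line: "AE x in lborel. ennreal ((cmod (U x - c))\<^sup>2) \<le> D x * K"
  proof eventually_elim
    fix x assume ux: "integrable lborel (\<lambda>r. u (r, x))"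
    have "integrable lborel (\<lambda>r. u (r, x) * of_real (\<eta> r))"
      by (rule integrable_mult_bounded[OF ux _ E]) measurable
    then have "U x - c = (LINT r|lborel. (u (r, x) - X r) * of_real (\<eta> r))"
      unfolding U_def c_def by (subst Bochner_Integration.integral_diff[OF _ X_int, symmetric]) (simp_all add: algebra_simps)
    then have "ennreal (cmod (U x - c)) \<le> (\<integral>\<^sup>+ r. cmod ((u (r, x) - X r) * of_real (\<eta> r)) \<partial>lborel)"
      using norm_integral_le_nn_integral by simp
    also have "\<dots> = (\<integral>\<^sup>+ r. (ennreal (cmod (u (r, x) - X r)) * indicator {l..m} r) * ennreal (\<eta> r) \<partial>lborel)"
    proof (rule nn_integral_cong)
      fix r
      show "ennreal (cmod ((u (r, x) - X r) * of_real (\<eta> r))) = (ennreal (cmod (u (r, x) - X r)) * indicator {l..m} r) * ennreal (\<eta> r)"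
        using zero[of r] nonneg[of r] by (cases "r \<in> {l..m}") (simp_all add: norm_mult ennreal_mult)
    qed
    finally have "(ennreal (cmod (U x - c)))\<^sup>2 \<le> (\<integral>\<^sup>+ r. (ennreal (cmod (u (r, x) - X r)) * indicator {l..m} r) * ennreal (\<eta> r) \<partial>lborel)\<^sup>2"
      by (rule power_mono) simp
    also have "\<dots> \<le> (\<integral>\<^sup>+ r. (ennreal (cmod (u (r, x) - X r)) * indicator {l..m} r)\<^sup>2 \<partial>lborel) * K"
      unfolding K_def by (rule Cauchy_Schwarz_nn_integral) measurable
    also have "(\<integral>\<^sup>+ r. (ennreal (cmod (u (r, x) - X r)) * indicator {l..m} r)\<^sup>2 \<partial>lborel) = D x"
      unfolding D_def by (intro nn_integral_cong) (simp add: indicator_def power_mult_distrib ennreal_power)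
    finally show "ennreal ((cmod (U x - c))\<^sup>2) \<le> D x * K" by (simp add: ennreal_power)
  qed
  have I_prod: "indicator ({l..m} \<times> {y0..y1}) (s, x) = (indicator {l..m} s * indicator {y0..y1} x :: ennreal)" for s x
    by (simp add: indicator_def)
  have "(\<integral>\<^sup>+ p. ennreal ((cmod (U (snd p) - c))\<^sup>2) * indicator ({l..m} \<times> {y0..y1}) p \<partial>lborel)
      = (\<integral>\<^sup>+ s. \<integral>\<^sup>+ x. indicator {l..m} s * (ennreal ((cmod (U x - c))\<^sup>2) * indicator {y0..y1} x) \<partial>lborel \<partial>lborel)"
    by (subst lborel_prod[symmetric], subst lborel.nn_integral_fst[symmetric]) (simp_all add: I_prod mult_ac)
  also have "\<dots> = (\<integral>\<^sup>+ s. indicator {l..m} s * (\<integral>\<^sup>+ x. ennreal ((cmod (U x - c))\<^sup>2) * indicator {y0..y1} x \<partial>lborel) \<partial>lborel)"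
    by (intro nn_integral_cong nn_integral_cmult) measurable
  also have "\<dots> = (\<integral>\<^sup>+ s. indicator {l..m} s \<partial>lborel) * (\<integral>\<^sup>+ x. ennreal ((cmod (U x - c))\<^sup>2) * indicator {y0..y1} x \<partial>lborel)"
    by (intro nn_integral_multc) measurable
  also have "\<dots> \<le> ennreal (m - l) * (\<integral>\<^sup>+ x. K * (D x * indicator {y0..y1} x) \<partial>lborel)"
  proof (rule mult_mono)
    show "(\<integral>\<^sup>+ x. ennreal ((cmod (U x - c))\<^sup>2) * indicator {y0..y1} x \<partial>lborel) \<le> (\<integral>\<^sup>+ x. K * (D x * indicator {y0..y1} x) \<partial>lborel)"
      by (rule nn_integral_mono_AE, use line in eventually_elim) (simp add: indicator_def mult.commute)
  qed (use lm in simp_all)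
  also have "(\<integral>\<^sup>+ x. K * (D x * indicator {y0..y1} x) \<partial>lborel) = K * (\<integral>\<^sup>+ x. D x * indicator {y0..y1} x \<partial>lborel)"
    by (rule nn_integral_cmult) measurable
  also have "(\<integral>\<^sup>+ x. D x * indicator {y0..y1} x \<partial>lborel)
      = (\<integral>\<^sup>+ x. \<integral>\<^sup>+ r. ennreal ((cmod (u (r, x) - X r))\<^sup>2) * indicator ({l..m} \<times> {y0..y1}) (r, x) \<partial>lborel \<partial>lborel)"
    unfolding D_def I_prod
    by (intro nn_integral_cong) (subst nn_integral_multc[symmetric], simp_all add: mult.assoc)
  also have "\<dots> = (\<integral>\<^sup>+ p. ennreal ((cmod (u p - X (fst p)))\<^sup>2) * indicator ({l..m} \<times> {y0..y1}) p \<partial>lborel)"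
  proof -
    have "(\<lambda>p. ennreal ((cmod (u p - X (fst p)))\<^sup>2) * indicator ({l..m} \<times> {y0..y1}) p)
        \<in> borel_measurable (lborel \<Otimes>\<^sub>M lborel)" by measurable
    from lborel_pair.nn_integral_snd[OF this] show ?thesis by (simp add: lborel_prod)
  qed
  finally show ?thesis unfolding U_def c_def K_def by (simp add: mult.assoc)
qed

end

lemma cutoff_exists:
  assumes "l < m"
  shows "\<exists>\<eta>. cutoff l m \<eta>"
proof -
  \<comment> \<open>The middle third of the interval; a parabolic cap over it, normalized by its
    integral, will be the cutoff.\<close>
  define p q where "p = (2 * l + m) / 3" and "q = (l + 2 * m) / 3"
  have pq: "l < p" "p < q" "q < m" using assms by (auto simp: p_def q_def)
  define f where "f r = max 0 ((r - p) * (q - r))" for r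
  define c where "c = (LINT r|lborel. f r)"
  have f0: "f r = 0" if "r \<notin> {p..q}" for r
  proof -
    have "(r - p) * (q - r) \<le> 0" using that pq by (auto simp: mult_le_0_iff)
    then show ?thesis by (simp add: f_def)
  qed
  have fc: "continuous_on UNIV f" unfolding f_def by (intro continuous_intros)
  have fi: "integrable lborel f" using fc f0 by (rule compact_support_integrable)
  \<comment> \<open>On the middle third of [p, q] the cap is at least h^2, so its integral is at
    least h^3 and the normalization is legitimate.\<close>
  define h where "h = (q - p) / 3"
  have h: "0 < h" using pq by (simp add: h_def)
  have "h\<^sup>2 * indicator {p + h..q - h} r \<le> f r" for r
  proof (cases "r \<in> {p + h..q - h}")
    case True
    then have "h * h \<le> (r - p) * (q - r)" using h by (intro mult_mono) auto
    then show ?thesis using True by (simp add: f_def power2_eq_square)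
  qed (simp add: f_def)
  then have "(LINT r|lborel. h\<^sup>2 * indicator {p + h..q - h} r) \<le> c"
    unfolding c_def
    by (intro integral_mono fi integrable_mult_right integrable_real_indicator)
      (auto simp: emeasure_lborel_Icc_eq)
  moreover have "(LINT r|lborel. h\<^sup>2 * indicator {p + h..q - h} r) = h\<^sup>2 * h"
  proof -
    have "p + h \<le> q - h" "q - h - (p + h) = h" using pq by (simp_all add: h_def field_simps)
    then show ?thesis by simp
  qed
  ultimately have c: "0 < c" using h by (smt (verit) mult_pos_pos zero_less_power)
  have "cutoff l m (\<lambda>r. f r / c)"
  proof
    show "continuous_on UNIV (\<lambda>r. f r / c)" using fc by (intro continuous_intros) (use c in auto)
    show "0 \<le> f r / c" for r using c by (simp add: f_def)
    show "\<exists>p' q'. l < p' \<and> q' < m \<and> (\<forall>r. r \<notin> {p'..q'} \<longrightarrow> f r / c = 0)"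
      using pq f0 by (intro exI[of _ p] exI[of _ q]) auto
    show "(LINT r|lborel. f r / c) = 1" using c by (simp add: c_def)
  qed
  then show ?thesis by blast
qed

text \<open>\<open>slice_bound\<close> is formulated for the first coordinate only; interchanging
  the coordinates makes it available for the second.\<close>

lemma nn_integral_swap_lborel:
  fixes f :: "real \<times> real \<Rightarrow> ennreal"
  assumes f: "f \<in> borel_measurable borel"
  shows "(\<integral>\<^sup>+ p. f (snd p, fst p) \<partial>lborel) = (\<integral>\<^sup>+ p. f p \<partial>lborel)"
proof -
  have m[measurable]: "f \<in> borel_measurable (borel \<Otimes>\<^sub>M borel)" using f by (simp add: borel_prod)
  have "(\<integral>\<^sup>+ p. f (snd p, fst p) \<partial>lborel) = (\<integral>\<^sup>+ x. \<integral>\<^sup>+ r. f (r, x) \<partial>lborel \<partial>lborel)"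
    by (subst lborel_prod[symmetric], subst lborel.nn_integral_fst[symmetric]) simp_all
  also have "\<dots> = (\<integral>\<^sup>+ p. f p \<partial>(lborel \<Otimes>\<^sub>M lborel))"
    by (rule lborel_pair.nn_integral_snd) simp
  finally show ?thesis by (simp add: lborel_prod)
qed

lemma
  fixes f :: "real \<times> real \<Rightarrow> 'b::{banach, second_countable_topology}"
  assumes "integrable lborel f"
  shows integrable_swap_lborel: "integrable lborel (\<lambda>p. f (snd p, fst p))"
    and integral_swap_lborel: "(LINT p|lborel. f (snd p, fst p)) = (LINT p|lborel. f p)"
  using lborel_pair.integrable_product_swap[of f] lborel_pair.integral_product_swap[of f] assms
    borel_measurable_integrable[OF assms]
  by (simp_all add: lborel_prod split_beta')

section \<open>From slices to the rectangle\<close>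

context slab
begin

lemma integrable_borel_version:
  fixes f f' :: "real \<times> real \<Rightarrow> complex"
  assumes f: "integrable M f" and f': "f' \<in> borel_measurable borel" "AE p in M. f' p = f p" "\<And>p. p \<notin> \<Omega> \<Longrightarrow> f' p = 0"
  shows "integrable lborel f'"
proof -
  have "integrable M f'"
    using f' f borel_measurable_integrable[OF f]
    by (subst integrable_cong_AE) (auto intro!: measurable_restrict_space1 measurable_completion)
  then show ?thesis using integrable_lebesgue_on_borel[OF \<Omega>_borel f'(1,3)] by simp
qed

lemma nn_integral_sqint:
  assumes f: "f \<in> sqint M" and f': "AE p in M. f' p = f p"
  shows "(\<integral>\<^sup>+ p. ennreal ((cmod (f' p))\<^sup>2) * indicator \<Omega> p \<partial>lborel) = ennreal (LINT p|M. (cmod (f p))\<^sup>2)"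
proof -
  have "ennreal (LINT p|M. (cmod (f p))\<^sup>2) = (\<integral>\<^sup>+ p. ennreal ((cmod (f p))\<^sup>2) \<partial>M)"
    by (rule nn_integral_eq_integral[OF sqint_integrable[OF f], symmetric]) simp
  also have "\<dots> = (\<integral>\<^sup>+ p. ennreal ((cmod (f' p))\<^sup>2) \<partial>M)"
    by (rule nn_integral_cong_AE) (use f' in auto)
  also have "\<dots> = (\<integral>\<^sup>+ p. ennreal ((cmod (f' p))\<^sup>2) * indicator \<Omega> p \<partial>lborel)"
    by (subst nn_integral_restrict_space) (auto simp: nn_integral_completion)
  finally show ?thesis ..
qed

lemma weak_derivative_tensor:
  assumes u: "u \<in> sqint M" "u' \<in> borel_measurable borel" "AE p in M. u' p = u p" "\<And>p. p \<notin> \<Omega> \<Longrightarrow> u' p = 0"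
    and g: "g \<in> sqint M" "g' \<in> borel_measurable borel" "AE p in M. g' p = g p" "\<And>p. p \<notin> \<Omega> \<Longrightarrow> g' p = 0"
    and a: "C1_supported r0 r1 a a'" and b: "C1_supported x0 x1 b b'"
  shows "weak_derivative \<Omega> (1, 0) u g \<Longrightarrow>
      (LINT p|lborel. u' p * of_real (a' (fst p) * b (snd p))) = - (LINT p|lborel. g' p * of_real (a (fst p) * b (snd p)))"
    and "weak_derivative \<Omega> (0, 1) u g \<Longrightarrow>
      (LINT p|lborel. u' p * of_real (a (fst p) * b' (snd p))) = - (LINT p|lborel. g' p * of_real (a (fst p) * b (snd p)))"
proof -
  note t = test_function_tensor[OF a b, folded \<Omega>_eq]
  have "continuous_on UNIV a'" "continuous_on UNIV b'" using a b unfolding C1_supported_def by auto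
  note c = this C1_supported_continuous[OF a] C1_supported_continuous[OF b]
  have tr: "(LINT p|M. v p * of_real (f (fst p) * k (snd p))) = (LINT p|lborel. v' p * of_real (f (fst p) * k (snd p)))"
    if "v \<in> sqint M" "v' \<in> borel_measurable borel" "AE p in M. v' p = v p" "\<And>p. p \<notin> \<Omega> \<Longrightarrow> v' p = 0"
      "continuous_on UNIV f" "continuous_on UNIV k" for v v' and f k :: "real \<Rightarrow> real"
    by (intro integral_borel_version that continuous_on_mult continuous_on_compose_fst continuous_on_compose_snd)
  show "(LINT p|lborel. u' p * of_real (a' (fst p) * b (snd p))) = - (LINT p|lborel. g' p * of_real (a (fst p) * b (snd p)))"
    if "weak_derivative \<Omega> (1, 0) u g"
  proof -
    have "(LINT p|M. u p * of_real (a' (fst p) * b (snd p))) = - (LINT p|M. g p * of_real (a (fst p) * b (snd p)))"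
      using that[unfolded weak_derivative_def, rule_format, OF t] by simp
    moreover have "(LINT p|M. u p * of_real (a' (fst p) * b (snd p))) = (LINT p|lborel. u' p * of_real (a' (fst p) * b (snd p)))"
      by (intro tr u c)
    moreover have "(LINT p|M. g p * of_real (a (fst p) * b (snd p))) = (LINT p|lborel. g' p * of_real (a (fst p) * b (snd p)))"
      by (intro tr g c)
    ultimately show ?thesis by (simp only:)
  qed
  show "(LINT p|lborel. u' p * of_real (a (fst p) * b' (snd p))) = - (LINT p|lborel. g' p * of_real (a (fst p) * b (snd p)))"
    if "weak_derivative \<Omega> (0, 1) u g"
  proof -
    have "(LINT p|M. u p * of_real (a (fst p) * b' (snd p))) = - (LINT p|M. g p * of_real (a (fst p) * b (snd p)))"
      using that[unfolded weak_derivative_def, rule_format, OF t] by simp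
    moreover have "(LINT p|M. u p * of_real (a (fst p) * b' (snd p))) = (LINT p|lborel. u' p * of_real (a (fst p) * b' (snd p)))"
      by (intro tr u c)
    moreover have "(LINT p|M. g p * of_real (a (fst p) * b (snd p))) = (LINT p|lborel. g' p * of_real (a (fst p) * b (snd p)))"
      by (intro tr g c)
    ultimately show ?thesis by (simp only:)
  qed
qed

text \<open>The path from u to a constant goes through the average U over r. The distance from u to
  U costs the r-derivative. The distance from U to c is bounded by that of u to its average X over
  x, which costs the x-derivative.\<close>

theorem Poincare_inequality:
  "\<exists>C\<ge>0. \<forall>u\<in>H1 \<Omega>. \<exists>c. (LINT p|M. (cmod (u p - c))\<^sup>2)
    \<le> C * ((LINT p|M. (cmod (wd_r \<Omega> u p))\<^sup>2) + (LINT p|M. (cmod (wd_x \<Omega> u p))\<^sup>2))"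
proof -
  obtain \<eta> \<theta> where "cutoff r0 r1 \<eta>" "cutoff x0 x1 \<theta>" using cutoff_exists r01 x01 by blast
  interpret \<eta>: cutoff r0 r1 \<eta> by fact
  interpret \<theta>: cutoff x0 x1 \<theta> by fact
  define k where "k = (LINT r|lborel. (\<eta> r)\<^sup>2)"
  have k: "(\<integral>\<^sup>+ r. (ennreal (\<eta> r))\<^sup>2 \<partial>lborel) = ennreal k" "0 \<le> k"
  proof -
    have "integrable lborel (\<lambda>r. (\<eta> r)\<^sup>2)"
      by (rule compact_support_integrable[of _ r0 r1]) (auto intro!: continuous_intros \<eta>.continuous simp: \<eta>.zero)
    from nn_integral_eq_integral[OF this] show "(\<integral>\<^sup>+ r. (ennreal (\<eta> r))\<^sup>2 \<partial>lborel) = ennreal k"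
      by (simp add: k_def ennreal_power \<eta>.nonneg)
  qed (simp add: k_def)
  \<comment> \<open>The factor 2 comes from squaring a sum of two terms. A1 is the slice constant in
    r; A2 is the constant of \<open>average_bound\<close>, with k the squared L2 norm of \<eta>,
    times the slice constant in x.\<close>
  define A1 A2 where "A1 = 2 * (r1 - r0)\<^sup>2" and "A2 = 2 * (r1 - r0) * k * (x1 - x0)\<^sup>2"
  have A: "0 \<le> A1" "0 \<le> A2" using r01 x01 k by (auto simp: A1_def A2_def)
  obtain E where E: "\<And>r. \<bar>\<eta> r\<bar> \<le> E" using compact_support_bounded[OF \<eta>.continuous \<eta>.zero] by blast
  obtain T where T: "\<And>r. \<bar>\<theta> r\<bar> \<le> T" using compact_support_bounded[OF \<theta>.continuous \<theta>.zero] by blast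
  have "\<exists>c. (LINT p|M. (cmod (u p - c))\<^sup>2)
      \<le> (A1 + A2) * ((LINT p|M. (cmod (wd_r \<Omega> u p))\<^sup>2) + (LINT p|M. (cmod (wd_x \<Omega> u p))\<^sup>2))"
    if u: "u \<in> H1 \<Omega>" for u
  proof -
    let ?g = "wd_r \<Omega> u" and ?h = "wd_x \<Omega> u"
    have us: "u \<in> sqint M" and gs: "?g \<in> sqint M" and hs: "?h \<in> sqint M"
      and wr: "weak_derivative \<Omega> (1, 0) u ?g" and wx: "weak_derivative \<Omega> (0, 1) u ?h"
      using u H1_sqint wd_r wd_x by auto
    obtain u' where u': "u' \<in> borel_measurable borel" "AE p in M. u' p = u p" "\<And>p. p \<notin> \<Omega> \<Longrightarrow> u' p = 0"
      using borel_version[OF \<Omega>_borel sqint_measurable[OF us]] by blast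
    obtain g where g: "g \<in> borel_measurable borel" "AE p in M. g p = ?g p" "\<And>p. p \<notin> \<Omega> \<Longrightarrow> g p = 0"
      using borel_version[OF \<Omega>_borel sqint_measurable[OF gs]] by blast
    obtain h where h: "h \<in> borel_measurable borel" "AE p in M. h p = ?h p" "\<And>p. p \<notin> \<Omega> \<Longrightarrow> h p = 0"
      using borel_version[OF \<Omega>_borel sqint_measurable[OF hs]] by blast
    have ui: "integrable lborel u'" and gi: "integrable lborel g" and hi: "integrable lborel h"
      using integrable_borel_version[OF sqint_imp_integrable[OF us] u']
        integrable_borel_version[OF sqint_imp_integrable[OF gs] g]
        integrable_borel_version[OF sqint_imp_integrable[OF hs] h] by auto
    have um[measurable]: "u' \<in> borel_measurable (borel \<Otimes>\<^sub>M borel)" using u'(1) by (simp add: borel_prod)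
    define U where "U x = (LINT r|lborel. u' (r, x) * of_real (\<eta> r))" for x
    define X where "X r = (LINT x|lborel. u' (r, x) * of_real (\<theta> x))" for r
    \<comment> \<open>The average of u against the product of \<eta> and \<theta>.\<close>
    define c where "c = (LINT r|lborel. X r * of_real (\<eta> r))"
    have X[measurable]: "X \<in> borel_measurable borel" unfolding X_def by measurable
    have U[measurable]: "U \<in> borel_measurable borel" unfolding U_def by measurable
    have sq_g: "(\<integral>\<^sup>+ p. ennreal ((cmod (g p))\<^sup>2) \<partial>lborel) = ennreal (LINT p|M. (cmod (?g p))\<^sup>2)"
      unfolding nn_integral_sqint[OF gs g(2), symmetric]
      by (rule nn_integral_cong) (use g(3) in \<open>auto simp: indicator_def\<close>)
    have sq_h: "(\<integral>\<^sup>+ p. ennreal ((cmod (h p))\<^sup>2) \<partial>lborel) = ennreal (LINT p|M. (cmod (?h p))\<^sup>2)"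
      unfolding nn_integral_sqint[OF hs h(2), symmetric]
      by (rule nn_integral_cong) (use h(3) in \<open>auto simp: indicator_def\<close>)
    have B1: "(\<integral>\<^sup>+ p. ennreal ((cmod (u' p - U (snd p)))\<^sup>2) * indicator \<Omega> p \<partial>lborel)
        \<le> ennreal ((r1 - r0)\<^sup>2) * ennreal (LINT p|M. (cmod (?g p))\<^sup>2)"
      unfolding \<Omega>_eq U_def sq_g[unfolded \<Omega>_eq, symmetric]
      using r01 weak_derivative_tensor(1)[OF us u' gs g _ _ wr] g(3)
      by (intro \<eta>.slice_bound ui gi) (auto simp: \<Omega>_eq)
    \<comment> \<open>The estimate of B1 with the two coordinates interchanged.\<close>
    have B2: "(\<integral>\<^sup>+ p. ennreal ((cmod (u' p - X (fst p)))\<^sup>2) * indicator \<Omega> p \<partial>lborel)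
        \<le> ennreal ((x1 - x0)\<^sup>2) * ennreal (LINT p|M. (cmod (?h p))\<^sup>2)"
    proof -
      let ?u = "\<lambda>p. u' (snd p, fst p)" and ?hs = "\<lambda>p. h (snd p, fst p)"
      have weak: "(LINT p|lborel. ?u p * of_real (a' (fst p) * b (snd p))) = - (LINT p|lborel. ?hs p * of_real (a (fst p) * b (snd p)))"
        if a: "C1_supported x0 x1 a a'" and b: "C1_supported r0 r1 b b'" for a a' b b'
      proof -
        have swap: "(LINT p|lborel. f (snd p, fst p) * of_real (a (fst p) * b (snd p))) = (LINT p|lborel. f p * of_real (b (fst p) * a (snd p)))"
          if f: "integrable lborel f" and ca: "continuous_on UNIV a" and za: "\<forall>x. x \<notin> {x0..x1} \<longrightarrow> a x = 0" for f :: "real \<times> real \<Rightarrow> complex" and a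
        proof -
          have cb: "continuous_on UNIV b" by (rule C1_supported_continuous[OF b])
          obtain A where A: "0 \<le> A" "\<And>r. \<bar>a r\<bar> \<le> A" using compact_support_bounded[OF ca, of x0 x1] za by blast
          obtain B where B: "0 \<le> B" "\<And>r. \<bar>b r\<bar> \<le> B" using compact_support_bounded[OF cb C1_supported_zero[OF b]] by blast
          have "integrable lborel (\<lambda>p. f p * of_real (b (fst p) * a (snd p)))"
          proof (rule integrable_mult_bounded[OF f])
            show "(\<lambda>p. b (fst p) * a (snd p)) \<in> borel_measurable lborel"
              using ca cb by (simp, intro borel_measurable_continuous_onI continuous_on_mult continuous_on_compose_fst continuous_on_compose_snd)
            show "\<bar>b (fst p) * a (snd p)\<bar> \<le> B * A" for p
              unfolding abs_mult using A B by (intro mult_mono) auto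
          qed
          from integral_swap_lborel[OF this] show ?thesis by (simp add: mult.commute)
        qed
        have ca': "continuous_on UNIV a'" using a unfolding C1_supported_def by auto
        \<comment> \<open>Exchanging coordinates in the pairing with a' needs a' bounded, hence
          supported in the interval. It is, since a vanishes on an open set around every outer
          point.\<close>
        have za': "\<forall>x. x \<notin> {x0..x1} \<longrightarrow> a' x = 0"
        proof (intro allI impI)
          fix x assume that: "x \<notin> {x0..x1}"
          obtain e d where ed: "x0 < e" "d < x1" "\<And>r. r \<notin> {e..d} \<Longrightarrow> a r = 0" and da: "(a has_real_derivative a' x) (at x)"
            using a unfolding C1_supported_def by blast
          have "((\<lambda>_. 0) has_real_derivative a' x) (at x)"
            by (rule has_field_derivative_transform_within_open[OF da, of "- {e..d}"]) (use ed that in auto)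
          then show "a' x = 0" using DERIV_const DERIV_unique by blast
        qed
        have za: "\<forall>x. x \<notin> {x0..x1} \<longrightarrow> a x = 0" using C1_supported_zero[OF a] by blast
        show ?thesis
          unfolding swap[OF ui ca' za'] swap[OF hi C1_supported_continuous[OF a] za]
          by (intro weak_derivative_tensor(2)[of u u' ?h h b b' a a'] us u' hs h b a wx)
      qed
      have "(\<integral>\<^sup>+ p. ennreal ((cmod (u' p - X (fst p)))\<^sup>2) * indicator \<Omega> p \<partial>lborel)
          = (\<integral>\<^sup>+ p. ennreal ((cmod (u' (snd p, fst p) - X (snd p)))\<^sup>2) * indicator \<Omega> (snd p, fst p) \<partial>lborel)"
      proof -
        have "(\<lambda>p. ennreal ((cmod (u' p - X (fst p)))\<^sup>2) * indicator \<Omega> p) \<in> borel_measurable (borel \<Otimes>\<^sub>M borel)"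
          unfolding \<Omega>_eq by measurable
        then have "(\<lambda>p. ennreal ((cmod (u' p - X (fst p)))\<^sup>2) * indicator \<Omega> p) \<in> borel_measurable borel"
          by (simp add: borel_prod)
        from nn_integral_swap_lborel[OF this] show ?thesis by simp
      qed
      also have "\<dots> = (\<integral>\<^sup>+ p. ennreal ((cmod (?u p - (LINT x|lborel. ?u (x, snd p) * of_real (\<theta> x))))\<^sup>2) * indicator ({x0..x1} \<times> {r0..r1}) p \<partial>lborel)"
        by (rule nn_integral_cong) (auto simp: X_def \<Omega>_eq indicator_def)
      also have "\<dots> \<le> ennreal ((x1 - x0)\<^sup>2) * (\<integral>\<^sup>+ p. ennreal ((cmod (?hs p))\<^sup>2) \<partial>lborel)"
        using x01 h(3) by (intro \<theta>.slice_bound integrable_swap_lborel ui hi weak) (auto simp: \<Omega>_eq)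
      also have "(\<integral>\<^sup>+ p. ennreal ((cmod (?hs p))\<^sup>2) \<partial>lborel) = (\<integral>\<^sup>+ p. ennreal ((cmod (h p))\<^sup>2) \<partial>lborel)"
        using h(1) by (intro nn_integral_swap_lborel[of "\<lambda>p. ennreal ((cmod (h p))\<^sup>2)"]) measurable
      finally show ?thesis unfolding sq_h .
    qed
    have X_int: "integrable lborel (\<lambda>r. X r * of_real (\<eta> r))"
    proof -
      have "integrable lborel (\<lambda>p. u' p * of_real (\<theta> (snd p)))"
        using T by (intro integrable_mult_bounded[OF ui])
          (simp_all add: measurable_compose_snd_borel)
      from lborel_pair.integrable_fst[of "\<lambda>r x. u' (r, x) * of_real (\<theta> x)"] this
      have "integrable lborel X" by (simp add: X_def[abs_def] lborel_prod split_beta')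
      then show ?thesis using E by (intro integrable_mult_bounded) simp_all
    qed
    have B3: "(\<integral>\<^sup>+ p. ennreal ((cmod (U (snd p) - c))\<^sup>2) * indicator \<Omega> p \<partial>lborel)
        \<le> ennreal (r1 - r0) * ennreal k * (\<integral>\<^sup>+ p. ennreal ((cmod (u' p - X (fst p)))\<^sup>2) * indicator \<Omega> p \<partial>lborel)"
      unfolding \<Omega>_eq U_def c_def k(1)[symmetric] using r01 by (intro \<eta>.average_bound ui X X_int) simp
    have uc: "(\<lambda>p. u p - c) \<in> sqint M" by (rule sqint_diff[OF us const_sqint])
    let ?N = "\<lambda>f. \<integral>\<^sup>+ p. ennreal ((cmod (f p))\<^sup>2) * indicator \<Omega> p \<partial>lborel"
    let ?G = "LINT p|M. (cmod (?g p))\<^sup>2" and ?H = "LINT p|M. (cmod (?h p))\<^sup>2"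
    have GH: "0 \<le> ?G" "0 \<le> ?H" by simp_all
    have pt: "ennreal ((cmod (u' p - c))\<^sup>2) \<le> 2 * ennreal ((cmod (u' p - U (snd p)))\<^sup>2) + 2 * ennreal ((cmod (U (snd p) - c))\<^sup>2)" for p
    proof -
      let ?x = "cmod (u' p - U (snd p))" and ?y = "cmod (U (snd p) - c)"
      have "cmod (u' p - c) \<le> ?x + ?y"
        using norm_triangle_ineq[of "u' p - U (snd p)" "U (snd p) - c"] by simp
      then have "(cmod (u' p - c))\<^sup>2 \<le> (?x + ?y)\<^sup>2" by (intro power_mono) auto
      also have "\<dots> \<le> 2 * ?x\<^sup>2 + 2 * ?y\<^sup>2"
        using zero_le_power2[of "?x - ?y"] by (simp add: power2_sum power2_diff)
      finally have "ennreal ((cmod (u' p - c))\<^sup>2) \<le> ennreal (2 * ?x\<^sup>2 + 2 * ?y\<^sup>2)" by (rule ennreal_leI)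
      then show ?thesis by (simp add: ennreal_mult)
    qed
    have "ennreal (LINT p|M. (cmod (u p - c))\<^sup>2) = ?N (\<lambda>p. u' p - c)"
      by (rule nn_integral_sqint[OF uc, symmetric]) (use u'(2) in auto)
    also have "\<dots> \<le> (\<integral>\<^sup>+ p. 2 * (ennreal ((cmod (u' p - U (snd p)))\<^sup>2) * indicator \<Omega> p) + 2 * (ennreal ((cmod (U (snd p) - c))\<^sup>2) * indicator \<Omega> p) \<partial>lborel)"
      by (rule nn_integral_mono) (use pt in \<open>auto simp: indicator_def\<close>)
    also have "\<dots> = 2 * ?N (\<lambda>p. u' p - U (snd p)) + 2 * ?N (\<lambda>p. U (snd p) - c)"
    proof -
      have "(\<lambda>p. ennreal ((cmod (u' p - U (snd p)))\<^sup>2) * indicator \<Omega> p) \<in> borel_measurable (borel \<Otimes>\<^sub>M borel)"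
        "(\<lambda>p. ennreal ((cmod (U (snd p) - c))\<^sup>2) * indicator \<Omega> p) \<in> borel_measurable (borel \<Otimes>\<^sub>M borel)"
        unfolding \<Omega>_eq by measurable
      then show ?thesis by (simp add: borel_prod nn_integral_add nn_integral_cmult)
    qed
    also have "\<dots> \<le> 2 * (ennreal ((r1 - r0)\<^sup>2) * ennreal ?G)
        + 2 * (ennreal (r1 - r0) * ennreal k * (ennreal ((x1 - x0)\<^sup>2) * ennreal ?H))"
      using B1 order_trans[OF B3 mult_left_mono[OF B2]] by (intro add_mono mult_left_mono) auto
    also have "\<dots> = ennreal (A1 * ?G + A2 * ?H)"
    proof -
      have comb: "ennreal 2 * (ennreal a * ennreal G) + ennreal 2 * (ennreal d * ennreal k * (ennreal e * ennreal H))
          = ennreal (2 * (a * G) + 2 * (d * k * (e * H)))"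
        if "0 \<le> a" "0 \<le> G" "0 \<le> d" "0 \<le> k" "0 \<le> e" "0 \<le> H" for a G d k e H :: real
        by (simp only: that ennreal_mult[symmetric] ennreal_plus[symmetric] mult_nonneg_nonneg zero_le_numeral)
      from comb[of "(r1 - r0)\<^sup>2" ?G "r1 - r0" k "(x1 - x0)\<^sup>2" ?H] show ?thesis
        using r01 k(2) GH by (simp add: A1_def A2_def mult.assoc)
    qed
    also have "\<dots> \<le> ennreal ((A1 + A2) * (?G + ?H))"
      using A GH by (intro ennreal_leI) (simp add: algebra_simps)
    finally have "(LINT p|M. (cmod (u p - c))\<^sup>2) \<le> (A1 + A2) * (?G + ?H)"
      using A GH by (subst (asm) ennreal_le_iff) auto
    then show ?thesis by blast
  qed
  then show ?thesis using A by (intro exI[of _ "A1 + A2"]) auto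
qed

end

section \<open>Weighted gradient forms\<close>

lemma semi_inner_subspace:
  assumes "semi_inner H B" "V \<subseteq> H" "(\<lambda>_. 0) \<in> V"
    and "\<And>u v c d. \<lbrakk>u \<in> V; v \<in> V\<rbrakk> \<Longrightarrow> (\<lambda>p. c * u p + d * v p) \<in> V"
  shows "semi_inner V B"
proof -
  interpret semi_inner H B by fact
  have VH: "u \<in> H" if "u \<in> V" for u using assms(2) that by blast
  show ?thesis
    by (intro semi_inner.intro assms(3,4) comb_left hermitian nonneg VH)
qed

lemma weighted_inner_cong:
  assumes "f \<in> sqint M" "f' \<in> sqint M" "g \<in> sqint M" "g' \<in> sqint M" "w \<in> borel_measurable M"
    and "AE p in M. f p = f' p" "AE p in M. g p = g' p"
  shows "weighted_inner M w f g = weighted_inner M w f' g'"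
proof -
  note [measurable] = assms(1-4)[THEN sqint_measurable] assms(5)
  have "AE p in M. of_real (w p) * f p * cnj (g p) = of_real (w p) * f' p * cnj (g' p)"
    using assms(6,7) by eventually_elim simp
  then show ?thesis unfolding weighted_inner_def by (intro integral_cong_AE) measurable
qed

text \<open>Completeness of Lebesgue measure. It lets membership in V, in the domain of
  \<open>L0\<close> and in its kernel depend on almost-everywhere equality alone, with no separate
  measurability condition.\<close>

lemma borel_measurable_lebesgue_on_AE:
  fixes f g :: "'a::euclidean_space \<Rightarrow> 'b::euclidean_space"
  assumes S: "S \<in> sets lebesgue" and f: "f \<in> borel_measurable (lebesgue_on S)"
    and eq: "AE x in lebesgue_on S. f x = g x"
  shows "g \<in> borel_measurable (lebesgue_on S)"
proof -
  have "(\<lambda>x. if x \<in> S then f x else 0) \<in> borel_measurable lebesgue"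
    using S f by (simp add: borel_measurable_if)
  moreover have "AE x in lebesgue. (if x \<in> S then f x else 0) = (if x \<in> S then g x else 0)"
    using eq S by (subst (asm) AE_restrict_space_iff) auto
  ultimately have "(\<lambda>x. if x \<in> S then g x else 0) \<in> borel_measurable lebesgue"
    by (rule borel_measurable_AE)
  then show ?thesis using S by (simp add: borel_measurable_if)
qed

section \<open>Gradient forms and completeness of H1\<close>

context slab
begin

definition weight :: "(real \<times> real \<Rightarrow> real) \<Rightarrow> bool" where
  "weight w \<longleftrightarrow> w \<in> borel_measurable M \<and> (\<exists>K. \<forall>p\<in>\<Omega>. 0 \<le> w p \<and> w p \<le> K)"

lemma weight_measurable: "weight w \<Longrightarrow> w \<in> borel_measurable M"
  by (simp add: weight_def)

lemma weight_const: "0 \<le> c \<Longrightarrow> weight (\<lambda>_. c)"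
  by (auto simp: weight_def)

lemma weight_scale: "\<lbrakk>0 \<le> c; weight w\<rbrakk> \<Longrightarrow> weight (\<lambda>p. c * w p)"
  unfolding weight_def
  by (intro conjI borel_measurable_times borel_measurable_const; meson mult_left_mono mult_nonneg_nonneg)

lemma semi_inner_weight: "weight w \<Longrightarrow> semi_inner (sqint M) (weighted_inner M w)"
  unfolding weight_def by (auto intro!: semi_inner_weighted)

text \<open>Three weights cover three forms: all equal to 1 for the H1 inner product, 0 in front for
  \<open>q0\<close>, and a multiple of \<open>A_weight\<close> in front for the form of the
  resolvent.\<close>

definition grad_form ::
    "(real \<times> real \<Rightarrow> real) \<Rightarrow> (real \<times> real \<Rightarrow> real) \<Rightarrow> (real \<times> real \<Rightarrow> real) \<Rightarrow> scalar_field \<Rightarrow> scalar_field \<Rightarrow> complex" where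
  "grad_form w0 w1 w2 u v = weighted_inner M w0 u v + weighted_inner M w1 (wd_r \<Omega> u) (wd_r \<Omega> v)
     + weighted_inner M w2 (wd_x \<Omega> u) (wd_x \<Omega> v)"

lemma H1_zero: "(\<lambda>_. 0) \<in> H1 \<Omega>"
  by (rule H1_const)

text \<open>Linearity is not pointwise: the chosen derivatives of a combination agree with the
  combination of derivatives only off a null set, so each gradient term is first rewritten by
  \<open>weighted_inner_cong\<close>.\<close>

lemma semi_inner_grad_form:
  assumes w: "weight w0" "weight w1" "weight w2"
  shows "semi_inner (H1 \<Omega>) (grad_form w0 w1 w2)"
proof -
  interpret s0: semi_inner "sqint M" "weighted_inner M w0" by (rule semi_inner_weight) fact
  interpret s1: semi_inner "sqint M" "weighted_inner M w1" by (rule semi_inner_weight) fact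
  interpret s2: semi_inner "sqint M" "weighted_inner M w2" by (rule semi_inner_weight) fact
  note mem = H1_sqint wd_sqint(1) wd_sqint(2)
  show ?thesis
  proof
    show "(\<lambda>_. 0) \<in> H1 \<Omega>" by (rule H1_zero)
    fix u assume u: "u \<in> H1 \<Omega>"
    show "0 \<le> Re (grad_form w0 w1 w2 u u)"
      using s0.nonneg s1.nonneg s2.nonneg mem[OF u] by (simp add: grad_form_def)
    fix v assume v: "v \<in> H1 \<Omega>"
    show "(\<lambda>p. c * u p + d * v p) \<in> H1 \<Omega>" for c d by (rule H1_comb(1)[OF u v])
    show "grad_form w0 w1 w2 v u = cnj (grad_form w0 w1 w2 u v)"
      using s0.hermitian[of u v] s1.hermitian[of "wd_r \<Omega> u" "wd_r \<Omega> v"] s2.hermitian[of "wd_x \<Omega> u" "wd_x \<Omega> v"]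
        mem[OF u] mem[OF v] by (simp add: grad_form_def)
    fix x c d assume x: "x \<in> H1 \<Omega>"
    let ?z = "\<lambda>p. c * u p + d * v p"
    note z = H1_comb[OF u v, of c d]
    have "weighted_inner M w1 (wd_r \<Omega> ?z) (wd_r \<Omega> x)
        = weighted_inner M w1 (\<lambda>p. c * wd_r \<Omega> u p + d * wd_r \<Omega> v p) (wd_r \<Omega> x)"
      using z mem[OF z(1)] mem[OF u] mem[OF v] mem[OF x] weight_measurable[OF w(2)]
      by (intro weighted_inner_cong sqint_comb) auto
    moreover have "weighted_inner M w2 (wd_x \<Omega> ?z) (wd_x \<Omega> x)
        = weighted_inner M w2 (\<lambda>p. c * wd_x \<Omega> u p + d * wd_x \<Omega> v p) (wd_x \<Omega> x)"
      using z mem[OF z(1)] mem[OF u] mem[OF v] mem[OF x] weight_measurable[OF w(3)]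
      by (intro weighted_inner_cong sqint_comb) auto
    ultimately show "grad_form w0 w1 w2 ?z x = c * grad_form w0 w1 w2 u x + d * grad_form w0 w1 w2 v x"
      unfolding grad_form_def
      using s0.comb_left[of u v x c d] s1.comb_left[of "wd_r \<Omega> u" "wd_r \<Omega> v" "wd_r \<Omega> x" c d]
        s2.comb_left[of "wd_x \<Omega> u" "wd_x \<Omega> v" "wd_x \<Omega> x" c d] mem[OF u] mem[OF v] mem[OF x]
      by (simp add: algebra_simps)
  qed
qed

lemma Re_grad_form_diag:
  "Re (grad_form w0 w1 w2 u u) = (LINT p|M. w0 p * (cmod (u p))\<^sup>2)
    + (LINT p|M. w1 p * (cmod (wd_r \<Omega> u p))\<^sup>2) + (LINT p|M. w2 p * (cmod (wd_x \<Omega> u p))\<^sup>2)"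
  by (simp add: grad_form_def weighted_inner_diag)

sublocale l2: semi_inner "sqint M" "weighted_inner M (\<lambda>_. 1)"
  by (rule semi_inner_weight[OF weight_const]) simp

sublocale h1: semi_inner "H1 \<Omega>" "grad_form (\<lambda>_. 1) (\<lambda>_. 1) (\<lambda>_. 1)"
  by (intro semi_inner_grad_form weight_const) simp_all

lemma L2_norm_eq: "L2_norm \<Omega> = l2.nrm"
  by (simp add: L2_norm_def l2.nrm_def weighted_inner_diag fun_eq_iff)

lemma L2_norm_sq: "(L2_norm \<Omega> u)\<^sup>2 = (LINT p|M. (cmod (u p))\<^sup>2)"
  by (simp add: L2_norm_def)

lemma H1_norm_eq: "H1_norm \<Omega> = h1.nrm"
  by (simp add: H1_norm_def h1.nrm_def L2_norm_sq Re_grad_form_diag fun_eq_iff)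

lemma H1_norm_sq: "(H1_norm \<Omega> u)\<^sup>2 = (L2_norm \<Omega> u)\<^sup>2 + (L2_norm \<Omega> (wd_r \<Omega> u))\<^sup>2 + (L2_norm \<Omega> (wd_x \<Omega> u))\<^sup>2"
  by (simp add: H1_norm_def)

lemma L2_norm_le_H1_norm: "L2_norm \<Omega> u \<le> H1_norm \<Omega> u"
  unfolding H1_norm_def by (rule real_le_rsqrt) simp

lemma L2_norm_zero_iff:
  assumes u: "u \<in> sqint M"
  shows "L2_norm \<Omega> u = 0 \<longleftrightarrow> (AE p in M. u p = 0)"
  unfolding L2_norm_def using integral_nonneg_eq_0_iff_AE[OF sqint_integrable[OF u]] by simp

lemma wd_diff:
  assumes u: "u \<in> H1 \<Omega>" and v: "v \<in> H1 \<Omega>"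
  shows "(LINT p|M. (cmod (wd_r \<Omega> (\<lambda>p. u p - v p) p))\<^sup>2) = (LINT p|M. (cmod (wd_r \<Omega> u p - wd_r \<Omega> v p))\<^sup>2)"
    and "(LINT p|M. (cmod (wd_x \<Omega> (\<lambda>p. u p - v p) p))\<^sup>2) = (LINT p|M. (cmod (wd_x \<Omega> u p - wd_x \<Omega> v p))\<^sup>2)"
proof -
  note z = H1_comb[OF u v, of 1 "-1", simplified]
  note [measurable] = wd_measurable(1)[OF u] wd_measurable(1)[OF v]
    wd_measurable(2)[OF u] wd_measurable(2)[OF v]
    wd_measurable(1)[OF z(1)] wd_measurable(2)[OF z(1)]
  show "(LINT p|M. (cmod (wd_r \<Omega> (\<lambda>p. u p - v p) p))\<^sup>2) = (LINT p|M. (cmod (wd_r \<Omega> u p - wd_r \<Omega> v p))\<^sup>2)"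
    by (rule integral_cong_AE) (use z(2) in \<open>auto elim!: eventually_mono\<close>)
  show "(LINT p|M. (cmod (wd_x \<Omega> (\<lambda>p. u p - v p) p))\<^sup>2) = (LINT p|M. (cmod (wd_x \<Omega> u p - wd_x \<Omega> v p))\<^sup>2)"
    by (rule integral_cong_AE) (use z(3) in \<open>auto elim!: eventually_mono\<close>)
qed

lemma tendsto_integral_mult_continuous:
  assumes s: "\<And>n. s n \<in> sqint M" and u: "u \<in> sqint M" and f: "continuous_on \<Omega> (f :: _ \<Rightarrow> real)"
    and lim: "(\<lambda>n. LINT p|M. (cmod (s n p - u p))\<^sup>2) \<longlonglongrightarrow> 0"
  shows "(\<lambda>n. LINT p|M. s n p * of_real (f p)) \<longlonglongrightarrow> (LINT p|M. u p * of_real (f p))"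
proof -
  have "(\<lambda>n. l2.nrm (\<lambda>p. s n p - u p)) \<longlonglongrightarrow> 0"
    unfolding l2.nrm_def weighted_inner_diag using tendsto_real_sqrt[OF lim] by simp
  from l2.tendsto_form_left[OF s u _ this, of "\<lambda>p. of_real (f p)"]
  show ?thesis using continuous_sqint[of "\<lambda>p. of_real (f p)"] f
    by (simp add: weighted_inner_def continuous_on_of_real)
qed

lemma weak_derivative_limit:
  assumes "\<And>n. s n \<in> sqint M" "u \<in> sqint M" "\<And>n. g n \<in> sqint M" "h \<in> sqint M"
    and "(\<lambda>n. LINT p|M. (cmod (s n p - u p))\<^sup>2) \<longlonglongrightarrow> 0" "(\<lambda>n. LINT p|M. (cmod (g n p - h p))\<^sup>2) \<longlonglongrightarrow> 0"
    and wd: "\<And>n. weak_derivative \<Omega> b (s n) (g n)"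
  shows "weak_derivative \<Omega> b u h"
  unfolding weak_derivative_def
proof (intro allI impI)
  fix \<phi> \<phi>' assume t: "test_function \<Omega> \<phi> \<phi>'"
  note c = test_function_continuous[OF t]
  have "(\<lambda>n. LINT p|M. s n p * of_real (\<phi>' p b)) \<longlonglongrightarrow> (LINT p|M. u p * of_real (\<phi>' p b))"
    by (rule tendsto_integral_mult_continuous) fact+
  moreover have "(\<lambda>n. - (LINT p|M. g n p * of_real (\<phi> p))) \<longlonglongrightarrow> - (LINT p|M. h p * of_real (\<phi> p))"
    by (intro tendsto_minus tendsto_integral_mult_continuous) fact+
  moreover have "(LINT p|M. s n p * of_real (\<phi>' p b)) = - (LINT p|M. g n p * of_real (\<phi> p))" for n
    by (rule wd[unfolded weak_derivative_def, rule_format, OF t])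
  ultimately show "(LINT p|M. u p * of_real (\<phi>' p b)) = - (LINT p|M. h p * of_real (\<phi> p))"
    by (simp only: LIMSEQ_unique)
qed

text \<open>The sequence and its two derivatives converge separately in L2. Testing carries the weak
  derivative relation to the limit, and \<open>H1I\<close> identifies the limits of the derivatives
  with the chosen ones.\<close>

lemma H1_complete:
  fixes s :: "nat \<Rightarrow> scalar_field"
  assumes s: "\<And>n. s n \<in> H1 \<Omega>"
    and cauchy: "\<And>e. e > 0 \<Longrightarrow> \<exists>N. \<forall>m\<ge>N. \<forall>n\<ge>N. H1_norm \<Omega> (\<lambda>p. s m p - s n p) < e"
  shows "\<exists>u\<in>H1 \<Omega>. (\<lambda>n. H1_norm \<Omega> (\<lambda>p. s n p - u p)) \<longlonglongrightarrow> 0"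
proof -
  have split: "(H1_norm \<Omega> (\<lambda>p. u p - v p))\<^sup>2 = (LINT p|M. (cmod (u p - v p))\<^sup>2)
      + (LINT p|M. (cmod (wd_r \<Omega> u p - wd_r \<Omega> v p))\<^sup>2) + (LINT p|M. (cmod (wd_x \<Omega> u p - wd_x \<Omega> v p))\<^sup>2)"
    if "u \<in> H1 \<Omega>" "v \<in> H1 \<Omega>" for u v
    unfolding H1_norm_sq L2_norm_sq wd_diff[OF that] ..
  note mem = s[THEN H1_sqint] s[THEN wd_r, THEN conjunct1] s[THEN wd_x, THEN conjunct1]
  have c: "\<exists>N. \<forall>m\<ge>N. \<forall>n\<ge>N. (H1_norm \<Omega> (\<lambda>p. s m p - s n p))\<^sup>2 < e" if "e > 0" for e
  proof -
    have "0 < sqrt e" using that by simp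
    from cauchy[OF this]
    obtain N where N: "\<And>m n. \<lbrakk>m \<ge> N; n \<ge> N\<rbrakk> \<Longrightarrow> H1_norm \<Omega> (\<lambda>p. s m p - s n p) < sqrt e" by blast
    have "(H1_norm \<Omega> (\<lambda>p. s m p - s n p))\<^sup>2 < e" if "m \<ge> N" "n \<ge> N" for m n
    proof -
      have "(H1_norm \<Omega> (\<lambda>p. s m p - s n p))\<^sup>2 < (sqrt e)\<^sup>2"
        using N[OF that] by (intro power_strict_mono) (auto simp: H1_norm_def)
      then show ?thesis using \<open>e > 0\<close> by simp
    qed
    then show ?thesis by blast
  qed
  have lim: "\<exists>g\<in>sqint M. (\<lambda>n. LINT p|M. (cmod (T n p - g p))\<^sup>2) \<longlonglongrightarrow> 0"
    if T: "\<And>n. T n \<in> sqint M"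
      and le: "\<And>m n. (LINT p|M. (cmod (T m p - T n p))\<^sup>2) \<le> (H1_norm \<Omega> (\<lambda>p. s m p - s n p))\<^sup>2" for T
  proof (rule sqint_complete[OF T])
    fix e :: real assume "0 < e"
    from c[OF this] show "\<exists>N. \<forall>m\<ge>N. \<forall>n\<ge>N. (LINT p|M. (cmod (T m p - T n p))\<^sup>2) < e"
      using le by (meson order_le_less_trans)
  qed
  obtain u where u: "u \<in> sqint M" "(\<lambda>n. LINT p|M. (cmod (s n p - u p))\<^sup>2) \<longlonglongrightarrow> 0"
    using lim[of s, OF mem(1)] unfolding split[OF s s] by auto
  obtain g where g: "g \<in> sqint M" "(\<lambda>n. LINT p|M. (cmod (wd_r \<Omega> (s n) p - g p))\<^sup>2) \<longlonglongrightarrow> 0"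
    using lim[of "\<lambda>n. wd_r \<Omega> (s n)", OF mem(2)] unfolding split[OF s s] by auto
  obtain h where h: "h \<in> sqint M" "(\<lambda>n. LINT p|M. (cmod (wd_x \<Omega> (s n) p - h p))\<^sup>2) \<longlonglongrightarrow> 0"
    using lim[of "\<lambda>n. wd_x \<Omega> (s n)", OF mem(3)] unfolding split[OF s s] by auto
  have "weak_derivative \<Omega> (1, 0) u g" "weak_derivative \<Omega> (0, 1) u h"
    using weak_derivative_limit[OF mem(1) u(1) mem(2) g(1) u(2) g(2)]
      weak_derivative_limit[OF mem(1) u(1) mem(3) h(1) u(2) h(2)] wd_r[OF s] wd_x[OF s] by auto
  note uH = H1I[OF u(1) g(1) h(1) this]
  have eq: "(H1_norm \<Omega> (\<lambda>p. s n p - u p))\<^sup>2 = (LINT p|M. (cmod (s n p - u p))\<^sup>2)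
      + (LINT p|M. (cmod (wd_r \<Omega> (s n) p - g p))\<^sup>2) + (LINT p|M. (cmod (wd_x \<Omega> (s n) p - h p))\<^sup>2)" for n
  proof -
    note [measurable] = mem[THEN sqint_measurable] g(1)[THEN sqint_measurable] h(1)[THEN sqint_measurable]
      wd_measurable(1)[OF uH(1)] wd_measurable(2)[OF uH(1)]
    have "(LINT p|M. (cmod (wd_r \<Omega> (s n) p - wd_r \<Omega> u p))\<^sup>2) = (LINT p|M. (cmod (wd_r \<Omega> (s n) p - g p))\<^sup>2)"
      by (rule integral_cong_AE) (use uH(2) in \<open>auto elim!: eventually_mono\<close>)
    moreover have "(LINT p|M. (cmod (wd_x \<Omega> (s n) p - wd_x \<Omega> u p))\<^sup>2) = (LINT p|M. (cmod (wd_x \<Omega> (s n) p - h p))\<^sup>2)"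
      by (rule integral_cong_AE) (use uH(3) in \<open>auto elim!: eventually_mono\<close>)
    ultimately show ?thesis unfolding split[OF s uH(1)] by simp
  qed
  have "(\<lambda>n. (H1_norm \<Omega> (\<lambda>p. s n p - u p))\<^sup>2) \<longlonglongrightarrow> 0 + 0 + 0"
    unfolding eq by (intro tendsto_add u(2) g(2) h(2))
  then have "(\<lambda>n. sqrt ((H1_norm \<Omega> (\<lambda>p. s n p - u p))\<^sup>2)) \<longlonglongrightarrow> sqrt 0"
    by (intro tendsto_real_sqrt) simp
  moreover have "sqrt ((H1_norm \<Omega> (\<lambda>p. s n p - u p))\<^sup>2) = H1_norm \<Omega> (\<lambda>p. s n p - u p)" for n
    by (simp add: H1_norm_def)
  ultimately show ?thesis using uH(1) by auto
qed

text \<open>Compactness turns the pointwise positivity of a regular slab into uniform ellipticity of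
  the form and two-sided bounds for the inner product.\<close>

lemma positive_weight:
  assumes c: "continuous_on \<Omega> w" and pos: "\<And>p. p \<in> \<Omega> \<Longrightarrow> 0 < (w p :: real)"
  shows "weight w" "\<exists>\<kappa>>0. \<exists>K>0. \<forall>p\<in>\<Omega>. \<kappa> \<le> w p \<and> w p \<le> K"
proof -
  have ne: "\<Omega> \<noteq> {}" using r01 x01 by (auto simp: \<Omega>_eq)
  obtain p where p: "p \<in> \<Omega>" "\<And>q. q \<in> \<Omega> \<Longrightarrow> w p \<le> w q"
    using continuous_attains_inf[OF compact_\<Omega> ne c] by blast
  obtain q where q: "q \<in> \<Omega>" "\<And>p. p \<in> \<Omega> \<Longrightarrow> w p \<le> w q"
    using continuous_attains_sup[OF compact_\<Omega> ne c] by blast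
  show "\<exists>\<kappa>>0. \<exists>K>0. \<forall>p\<in>\<Omega>. \<kappa> \<le> w p \<and> w p \<le> K" using p q pos by blast
  then show "weight w" unfolding weight_def using continuous_measurable[OF c] by fastforce
qed

lemma weighted_integral_bounds:
  assumes w: "weight w" and b: "\<And>p. p \<in> \<Omega> \<Longrightarrow> \<kappa> \<le> w p \<and> w p \<le> K" and f: "f \<in> sqint M"
  shows "\<kappa> * (LINT p|M. (cmod (f p))\<^sup>2) \<le> (LINT p|M. w p * (cmod (f p))\<^sup>2)"
    and "(LINT p|M. w p * (cmod (f p))\<^sup>2) \<le> K * (LINT p|M. (cmod (f p))\<^sup>2)"
proof -
  obtain K' where K': "\<And>p. p \<in> \<Omega> \<Longrightarrow> 0 \<le> w p \<and> w p \<le> K'" using w by (auto simp: weight_def)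
  have "integrable M (\<lambda>p. of_real (w p) * f p * cnj (f p))"
    using K' by (intro sqint_mult_integrable[OF f f weight_measurable[OF w], of K']) auto
  moreover have "of_real (w p) * f p * cnj (f p) = of_real (w p * (cmod (f p))\<^sup>2)" for p
    by (simp add: mult.assoc flip: complex_norm_square)
  ultimately have i: "integrable M (\<lambda>p. w p * (cmod (f p))\<^sup>2)"
    by (simp only: complex_of_real_integrable_eq)
  have "(LINT p|M. \<kappa> * (cmod (f p))\<^sup>2) \<le> (LINT p|M. w p * (cmod (f p))\<^sup>2)"
    using b by (intro integral_mono i integrable_mult_right sqint_integrable f mult_right_mono) auto
  then show "\<kappa> * (LINT p|M. (cmod (f p))\<^sup>2) \<le> (LINT p|M. w p * (cmod (f p))\<^sup>2)" by simp
  have "(LINT p|M. w p * (cmod (f p))\<^sup>2) \<le> (LINT p|M. K * (cmod (f p))\<^sup>2)"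
    using b by (intro integral_mono i integrable_mult_right sqint_integrable f mult_right_mono) auto
  then show "(LINT p|M. w p * (cmod (f p))\<^sup>2) \<le> K * (LINT p|M. (cmod (f p))\<^sup>2)" by simp
qed

end

section \<open>The operator \<open>L0\<close>\<close>

lemma semi_inner_cong:
  assumes "semi_inner H B" and eq: "\<And>u v. \<lbrakk>u \<in> H; v \<in> H\<rbrakk> \<Longrightarrow> B' u v = B u v"
  shows "semi_inner H B'"
proof -
  interpret semi_inner H B by fact
  show ?thesis
  proof
    show "B' (\<lambda>p. c * u p + d * v p) w = c * B' u w + d * B' v w" if "u \<in> H" "v \<in> H" "w \<in> H" for u v w c d
      unfolding eq[OF comb_mem[OF that(1,2)] that(3)] eq[OF that(1,3)] eq[OF that(2,3)] by (rule comb_left[OF that])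
    show "B' v u = cnj (B' u v)" if "u \<in> H" "v \<in> H" for u v
      unfolding eq[OF that] eq[OF that(2,1)] by (rule hermitian[OF that])
    show "0 \<le> Re (B' u u)" if "u \<in> H" for u
      unfolding eq[OF that that] by (rule nonneg[OF that])
  qed (rule zero_mem comb_mem; assumption?)+
qed

section \<open>The form domain and the comparison of norms\<close>

locale carter_slab = slab +
  fixes P :: carter and V :: "scalar_field set"
  assumes positive: "\<And>p. p \<in> \<Omega> \<Longrightarrow> rho2 P p > 0 \<and> Delta_r P (fst p) > 0 \<and> Delta_x P (snd p) > 0 \<and> A_weight P p > 0"
    and form_domain: "reflecting_form_domain \<Omega> V"
begin

lemma V_H1: "u \<in> V \<Longrightarrow> u \<in> H1 \<Omega>"
  and V_zero: "(\<lambda>_. 0) \<in> V"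
  and V_comb: "\<lbrakk>u \<in> V; v \<in> V\<rbrakk> \<Longrightarrow> (\<lambda>p. c * u p + d * v p) \<in> V"
  and V_dense: "\<lbrakk>f \<in> sqint M; 0 < e\<rbrakk> \<Longrightarrow> \<exists>v\<in>V. L2_norm \<Omega> (\<lambda>p. f p - v p) < e"
  and V_one: "(\<lambda>_. 1) \<in> V"
  using form_domain unfolding reflecting_form_domain_def complex_subspace_def L2_dense_def L2_eq by blast+

lemma V_closed: "\<lbrakk>\<And>n. s n \<in> V; u \<in> H1 \<Omega>; (\<lambda>n::nat. H1_norm \<Omega> (\<lambda>p. s n p - u p)) \<longlonglongrightarrow> 0\<rbrakk> \<Longrightarrow> u \<in> V"
  using form_domain unfolding reflecting_form_domain_def H1_closed_def by blast

lemma V_const: "(\<lambda>_. c) \<in> V"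
  using V_comb[OF V_one V_one, of c 0] by simp

lemma V_sqint: "u \<in> V \<Longrightarrow> u \<in> sqint M"
  using V_H1 H1_sqint by blast

lemma ae_measurable:
  assumes "u \<in> sqint M" "AE p in M. u p = v p"
  shows "v \<in> borel_measurable M"
  by (rule borel_measurable_lebesgue_on_AE[OF _ sqint_measurable[OF assms(1)] assms(2)])
    (simp add: \<Omega>_lmeasurable fmeasurableD)

text \<open>The constant sequence u is at H1 distance 0 from v, so closedness of V already contains
  this invariance.\<close>

lemma V_cong:
  assumes u: "u \<in> V" and eq: "AE p in M. u p = v p"
  shows "v \<in> V"
proof -
  note v = H1_cong[OF V_H1[OF u] ae_measurable[OF V_sqint[OF u] eq] eq]
  have "H1_norm \<Omega> (\<lambda>p. u p - v p) = 0"
  proof -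
    note vu = wd_diff[OF V_H1[OF u] v(1)]
    have "(LINT p|M. (cmod (wd_r \<Omega> u p - wd_r \<Omega> v p))\<^sup>2) = 0"
      by (rule integral_eq_zero_AE, use v(2) in eventually_elim) simp
    moreover have "(LINT p|M. (cmod (wd_x \<Omega> u p - wd_x \<Omega> v p))\<^sup>2) = 0"
      by (rule integral_eq_zero_AE, use v(3) in eventually_elim) simp
    moreover have "(LINT p|M. (cmod (u p - v p))\<^sup>2) = 0"
      by (rule integral_eq_zero_AE, use eq in eventually_elim) simp
    ultimately have "(H1_norm \<Omega> (\<lambda>p. u p - v p))\<^sup>2 = 0" unfolding H1_norm_sq L2_norm_sq vu by simp
    then show ?thesis by simp
  qed
  then show ?thesis using u v(1) by (simp add: V_closed[of "\<lambda>_. u"])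
qed

abbreviation w_r where "w_r \<equiv> \<lambda>p :: real \<times> real. Delta_r P (fst p)"
abbreviation w_x where "w_x \<equiv> \<lambda>p :: real \<times> real. Delta_x P (snd p)"

lemma continuous_weights:
  "continuous_on \<Omega> w_r" "continuous_on \<Omega> w_x" "continuous_on \<Omega> (A_weight P)"
proof -
  show r: "continuous_on \<Omega> w_r" unfolding Delta_r_def by (intro continuous_intros)
  show x: "continuous_on \<Omega> w_x" unfolding Delta_x_def by (intro continuous_intros)
  have nz: "Delta_r P (fst p) \<noteq> 0" "Delta_x P (snd p) \<noteq> 0" "rho2 P p \<noteq> 0" if "p \<in> \<Omega>" for p
    using positive[OF that] by auto
  \<comment> \<open>The weight is defined through a matrix inverse; its closed form makes continuity
    a matter of nonvanishing denominators.\<close>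
  have "continuous_on \<Omega> (\<lambda>p. ((fst p)\<^sup>2 + (car_a P)\<^sup>2)\<^sup>2 / Delta_r P (fst p) - (car_a P)\<^sup>2 * (1 - (snd p)\<^sup>2)\<^sup>2 / Delta_x P (snd p))"
    using nz by (intro continuous_intros r x) auto
  moreover have "A_weight P p = ((fst p)\<^sup>2 + (car_a P)\<^sup>2)\<^sup>2 / Delta_r P (fst p) - (car_a P)\<^sup>2 * (1 - (snd p)\<^sup>2)\<^sup>2 / Delta_x P (snd p)"
    if "p \<in> \<Omega>" for p
    using A_weight_closed_form[of P "fst p" "snd p"] nz[OF that] by simp
  ultimately show "continuous_on \<Omega> (A_weight P)" by (simp cong: continuous_on_cong)
qed

lemma weights: "weight w_r" "weight w_x" "weight (A_weight P)"
  using positive by (intro positive_weight continuous_weights; blast)+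

lemma weight_bounds:
  obtains \<kappa> K where "0 < \<kappa>" "0 < K"
    "\<And>p. p \<in> \<Omega> \<Longrightarrow> \<kappa> \<le> w_r p \<and> w_r p \<le> K" "\<And>p. p \<in> \<Omega> \<Longrightarrow> \<kappa> \<le> w_x p \<and> w_x p \<le> K"
    "\<And>p. p \<in> \<Omega> \<Longrightarrow> \<kappa> \<le> A_weight P p \<and> A_weight P p \<le> K"
proof -
  obtain k1 K1 where 1: "0 < k1" "0 < K1" "\<forall>p\<in>\<Omega>. k1 \<le> w_r p \<and> w_r p \<le> K1"
    using positive_weight(2)[OF continuous_weights(1)] positive by blast
  obtain k2 K2 where 2: "0 < k2" "0 < K2" "\<forall>p\<in>\<Omega>. k2 \<le> w_x p \<and> w_x p \<le> K2"
    using positive_weight(2)[OF continuous_weights(2)] positive by blast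
  obtain k3 K3 where 3: "0 < k3" "0 < K3" "\<forall>p\<in>\<Omega>. k3 \<le> A_weight P p \<and> A_weight P p \<le> K3"
    using positive_weight(2)[OF continuous_weights(3)] positive by blast
  show ?thesis
    by (rule that[of "min k1 (min k2 k3)" "max K1 (max K2 K3)"])
      (use 1 2 3 in \<open>auto simp: min_le_iff_disj le_max_iff_disj\<close>)
qed

lemma inner_A_eq: "inner_A P \<Omega> = weighted_inner M (A_weight P)"
  by (simp add: inner_A_def weighted_inner_def fun_eq_iff)

text \<open>\<open>q0\<close> is one integral of a sum and \<open>grad_form\<close> a sum of
  integrals, so each summand must be integrable; the bounded weights see to that.\<close>

lemma q0_eq:
  assumes "u \<in> H1 \<Omega>" "v \<in> H1 \<Omega>"
  shows "q0 P \<Omega> u v = grad_form (\<lambda>_. 0) w_r w_x u v"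
proof -
  obtain \<kappa> K where b: "0 < \<kappa>" "0 < K" "\<And>p. p \<in> \<Omega> \<Longrightarrow> \<kappa> \<le> w_r p \<and> w_r p \<le> K"
    "\<And>p. p \<in> \<Omega> \<Longrightarrow> \<kappa> \<le> w_x p \<and> w_x p \<le> K" by (rule weight_bounds) blast
  have "integrable M (\<lambda>p. of_real (w_r p) * wd_r \<Omega> u p * cnj (wd_r \<Omega> v p))"
    using b by (intro sqint_mult_integrable[of _ _ _ _ K] wd_sqint(1) assms weight_measurable weights) fastforce
  moreover have "integrable M (\<lambda>p. of_real (w_x p) * wd_x \<Omega> u p * cnj (wd_x \<Omega> v p))"
    using b by (intro sqint_mult_integrable[of _ _ _ _ K] wd_sqint(2) assms weight_measurable weights) fastforce
  ultimately show ?thesis by (simp add: q0_def grad_form_def weighted_inner_def)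
qed

lemma q0_cong_left:
  assumes u: "u \<in> H1 \<Omega>" and u': "u' \<in> H1 \<Omega>" and v: "v \<in> H1 \<Omega>" and eq: "AE p in M. u p = u' p"
  shows "q0 P \<Omega> u v = q0 P \<Omega> u' v"
proof -
  note c = H1_cong[OF u sqint_measurable[OF H1_sqint[OF u']] eq]
  have "AE p in M. of_real (w_r p) * wd_r \<Omega> u p * cnj (wd_r \<Omega> v p) + of_real (w_x p) * wd_x \<Omega> u p * cnj (wd_x \<Omega> v p)
      = of_real (w_r p) * wd_r \<Omega> u' p * cnj (wd_r \<Omega> v p) + of_real (w_x p) * wd_x \<Omega> u' p * cnj (wd_x \<Omega> v p)"
    using c(2,3) by eventually_elim simp
  moreover note [measurable] = wd_measurable(1)[OF u] wd_measurable(1)[OF v]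
    wd_measurable(2)[OF u] wd_measurable(2)[OF v]
    wd_measurable(1)[OF u'] wd_measurable(2)[OF u']
    weights[THEN weight_measurable]
  ultimately show ?thesis unfolding q0_def by (intro integral_cong_AE) measurable
qed

sublocale A: semi_inner "sqint M" "inner_A P \<Omega>"
  unfolding inner_A_eq by (intro semi_inner_weight weights)

sublocale Q: semi_inner "H1 \<Omega>" "q0 P \<Omega>"
  by (rule semi_inner_cong[OF semi_inner_grad_form q0_eq]) (intro weights weight_const order_refl)+

lemma A_nrm_sq: "f \<in> sqint M \<Longrightarrow> (A.nrm f)\<^sup>2 = (LINT p|M. A_weight P p * (cmod (f p))\<^sup>2)"
  by (simp add: A.nrm_sq) (simp add: inner_A_eq weighted_inner_diag)

lemma Q_nrm_sq: "u \<in> H1 \<Omega> \<Longrightarrow> (Q.nrm u)\<^sup>2 = (LINT p|M. w_r p * (cmod (wd_r \<Omega> u p))\<^sup>2) + (LINT p|M. w_x p * (cmod (wd_x \<Omega> u p))\<^sup>2)"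
  by (simp add: Q.nrm_sq q0_eq Re_grad_form_diag)

text \<open>One pair of constants for two equivalences: the A-norm with the L2 norm, and the
  seminorm of \<open>q0\<close> with the norm of the gradient.\<close>

definition comparison :: "real \<Rightarrow> real \<Rightarrow> bool" where
  "comparison \<kappa> K \<longleftrightarrow> 0 < \<kappa> \<and> 0 < K \<and>
    (\<forall>f\<in>sqint M. \<kappa> * (L2_norm \<Omega> f)\<^sup>2 \<le> (A.nrm f)\<^sup>2 \<and> (A.nrm f)\<^sup>2 \<le> K * (L2_norm \<Omega> f)\<^sup>2) \<and>
    (\<forall>u\<in>H1 \<Omega>. \<kappa> * ((L2_norm \<Omega> (wd_r \<Omega> u))\<^sup>2 + (L2_norm \<Omega> (wd_x \<Omega> u))\<^sup>2) \<le> (Q.nrm u)\<^sup>2 \<and>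
      (Q.nrm u)\<^sup>2 \<le> K * ((L2_norm \<Omega> (wd_r \<Omega> u))\<^sup>2 + (L2_norm \<Omega> (wd_x \<Omega> u))\<^sup>2))"

lemma comparisonD:
  assumes "comparison \<kappa> K"
  shows "0 < \<kappa>" "0 < K"
    "f \<in> sqint M \<Longrightarrow> \<kappa> * (L2_norm \<Omega> f)\<^sup>2 \<le> (A.nrm f)\<^sup>2 \<and> (A.nrm f)\<^sup>2 \<le> K * (L2_norm \<Omega> f)\<^sup>2"
    "u \<in> H1 \<Omega> \<Longrightarrow> \<kappa> * ((L2_norm \<Omega> (wd_r \<Omega> u))\<^sup>2 + (L2_norm \<Omega> (wd_x \<Omega> u))\<^sup>2) \<le> (Q.nrm u)\<^sup>2 \<and>
      (Q.nrm u)\<^sup>2 \<le> K * ((L2_norm \<Omega> (wd_r \<Omega> u))\<^sup>2 + (L2_norm \<Omega> (wd_x \<Omega> u))\<^sup>2)"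
  using assms unfolding comparison_def by blast+

lemma comparison_exists: "\<exists>\<kappa> K. comparison \<kappa> K"
proof -
  obtain \<kappa> K where b: "0 < \<kappa>" "0 < K" "\<And>p. p \<in> \<Omega> \<Longrightarrow> \<kappa> \<le> w_r p \<and> w_r p \<le> K"
    "\<And>p. p \<in> \<Omega> \<Longrightarrow> \<kappa> \<le> w_x p \<and> w_x p \<le> K" "\<And>p. p \<in> \<Omega> \<Longrightarrow> \<kappa> \<le> A_weight P p \<and> A_weight P p \<le> K"
    by (rule weight_bounds) blast
  have "comparison \<kappa> K"
    unfolding comparison_def
  proof (intro conjI[OF b(1)] conjI[OF b(2)] conjI[OF ballI ballI])
    show "\<kappa> * (L2_norm \<Omega> f)\<^sup>2 \<le> (A.nrm f)\<^sup>2 \<and> (A.nrm f)\<^sup>2 \<le> K * (L2_norm \<Omega> f)\<^sup>2" if "f \<in> sqint M" for f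
      unfolding A_nrm_sq[OF that] L2_norm_sq using weighted_integral_bounds[OF weights(3) b(5) that] by simp
    show "\<kappa> * ((L2_norm \<Omega> (wd_r \<Omega> u))\<^sup>2 + (L2_norm \<Omega> (wd_x \<Omega> u))\<^sup>2) \<le> (Q.nrm u)\<^sup>2
      \<and> (Q.nrm u)\<^sup>2 \<le> K * ((L2_norm \<Omega> (wd_r \<Omega> u))\<^sup>2 + (L2_norm \<Omega> (wd_x \<Omega> u))\<^sup>2)" if "u \<in> H1 \<Omega>" for u
      unfolding Q_nrm_sq[OF that] L2_norm_sq
      using weighted_integral_bounds[OF weights(1) b(3) wd_sqint(1)[OF that]]
        weighted_integral_bounds[OF weights(2) b(4) wd_sqint(2)[OF that]]
      by (simp add: distrib_left)
  qed
  then show ?thesis by blast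
qed

lemma A_nrm_zero:
  assumes "f \<in> sqint M" "A.nrm f = 0"
  shows "AE p in M. f p = 0"
proof -
  obtain \<kappa> K where cmp: "comparison \<kappa> K" using comparison_exists by blast
  note \<kappa>_pos = comparisonD(1)[OF cmp] and K = comparisonD(2)[OF cmp] and \<kappa> = comparisonD(3)[OF cmp]
  from \<kappa>[OF assms(1)] have "\<kappa> * (L2_norm \<Omega> f)\<^sup>2 \<le> 0" using assms(2) by simp
  then have "(L2_norm \<Omega> f)\<^sup>2 \<le> 0" using \<kappa>_pos by (simp add: mult_le_0_iff)
  then show ?thesis using L2_norm_zero_iff[OF assms(1)] by simp
qed

text \<open>For v in V close to f, orthogonality replaces |f|^2 by the pairing of f with f - v,
  which is small.\<close>

lemma A_orthogonal_V:
  assumes f: "f \<in> sqint M" and orth: "\<And>v. v \<in> V \<Longrightarrow> inner_A P \<Omega> f v = 0"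
  shows "AE p in M. f p = 0"
proof -
  obtain \<kappa> K where cmp: "comparison \<kappa> K" using comparison_exists by blast
  note \<kappa>_pos = comparisonD(1)[OF cmp] and K = comparisonD(2)[OF cmp] and \<kappa> = comparisonD(3)[OF cmp]
  have "A.nrm f \<le> e" if e: "0 < e" for e
  proof -
    \<comment> \<open>The A-norm is at most \<open>sqrt K\<close> times the L2 norm, hence this
      tolerance.\<close>
    have "0 < e / sqrt K" using e K by simp
    from V_dense[OF f this] obtain v where v: "v \<in> V" and d: "L2_norm \<Omega> (\<lambda>p. f p - v p) < e / sqrt K" by blast
    have vs: "v \<in> sqint M" and fv: "(\<lambda>p. f p - v p) \<in> sqint M"
      using V_sqint[OF v] sqint_diff[OF f] by auto
    have "(A.nrm (\<lambda>p. f p - v p))\<^sup>2 \<le> K * (e / sqrt K)\<^sup>2"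
    proof -
      have "(L2_norm \<Omega> (\<lambda>p. f p - v p))\<^sup>2 \<le> (e / sqrt K)\<^sup>2"
        using d l2.nrm_nonneg[OF fv] by (intro power_mono) (auto simp: L2_norm_eq)
      then have "K * (L2_norm \<Omega> (\<lambda>p. f p - v p))\<^sup>2 \<le> K * (e / sqrt K)\<^sup>2" using K by (intro mult_left_mono) auto
      then show ?thesis using \<kappa>[OF fv] by linarith
    qed
    also have "\<dots> = e\<^sup>2" using K by (simp add: power_divide)
    finally have "(A.nrm (\<lambda>p. f p - v p))\<^sup>2 \<le> e\<^sup>2" .
    then have d': "A.nrm (\<lambda>p. f p - v p) \<le> e" by (rule power2_le_imp_le) (use e in simp)
    have "(A.nrm f)\<^sup>2 = Re (inner_A P \<Omega> f (\<lambda>p. f p - v p))"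
      using A.nrm_sq[OF f] A.diff_right[OF f vs f] orth[OF v] by simp
    also have "\<dots> \<le> A.nrm f * A.nrm (\<lambda>p. f p - v p)"
      using A.Cauchy_Schwarz[OF f fv] complex_Re_le_cmod order_trans by blast
    also have "\<dots> \<le> A.nrm f * e" using d' A.nrm_nonneg[OF f] by (intro mult_left_mono)
    finally have "A.nrm f * A.nrm f \<le> A.nrm f * e" by (simp add: power2_eq_square)
    then show ?thesis using A.nrm_nonneg[OF f] e by (cases "A.nrm f = 0") (auto simp: mult_le_cancel_left)
  qed
  then have "A.nrm f \<le> 0" using field_le_epsilon[of "A.nrm f" 0] by simp
  then show ?thesis using A_nrm_zero[OF f] A.nrm_nonneg[OF f] by simp
qed

text \<open>The shift by lam makes the form coercive: its norm is equivalent to the H1 norm, for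
  which V is complete as a closed subspace. The right-hand side is antilinear in v, as the Riesz
  theorem demands.\<close>

lemma resolvent:
  assumes lam: "0 < lam" and F: "F \<in> sqint M"
  shows "\<exists>u\<in>V. \<forall>v\<in>V. q0 P \<Omega> u v + of_real lam * inner_A P \<Omega> u v = inner_A P \<Omega> F v"
proof -
  define B where "B = grad_form (\<lambda>p. lam * A_weight P p) w_r w_x"
  have B: "B u v = q0 P \<Omega> u v + of_real lam * inner_A P \<Omega> u v" if "u \<in> H1 \<Omega>" "v \<in> H1 \<Omega>" for u v
    unfolding B_def q0_eq[OF that] inner_A_eq
    by (simp add: grad_form_def weighted_inner_def mult.assoc algebra_simps)
  have "semi_inner (H1 \<Omega>) B"
    unfolding B_def using lam by (intro semi_inner_grad_form weight_scale weights) auto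
  then interpret B: semi_inner V B
    by (rule semi_inner_subspace[OF _ subsetI[OF V_H1] V_zero V_comb])
  obtain \<kappa> K where cmp: "comparison \<kappa> K" using comparison_exists by blast
  note k = comparisonD[OF cmp]
  have Bsq: "(B.nrm u)\<^sup>2 = (Q.nrm u)\<^sup>2 + lam * (A.nrm u)\<^sup>2" if "u \<in> V" for u
    using that V_H1[OF that] V_sqint[OF that] by (simp add: B.nrm_sq Q.nrm_sq A.nrm_sq B)
  \<comment> \<open>The gradient part carries the factor 1 and the zeroth-order part the factor lam,
    so the smaller and the larger of the two decide the equivalence with the H1 norm.\<close>
  define c C where "c = \<kappa> * min 1 lam" and "C = K * max 1 lam"
  have c: "0 < c" "0 < C" using k(1,2) lam by (auto simp: c_def C_def)
  have lower: "c * (H1_norm \<Omega> u)\<^sup>2 \<le> (B.nrm u)\<^sup>2" and upper: "(B.nrm u)\<^sup>2 \<le> C * (H1_norm \<Omega> u)\<^sup>2" if u: "u \<in> V" for u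
  proof -
    let ?g = "(L2_norm \<Omega> (wd_r \<Omega> u))\<^sup>2 + (L2_norm \<Omega> (wd_x \<Omega> u))\<^sup>2" and ?n = "(L2_norm \<Omega> u)\<^sup>2"
    have "c * ?g \<le> \<kappa> * ?g" unfolding c_def using k(1) by (intro mult_right_mono) auto
    moreover have "c * ?n \<le> lam * (\<kappa> * ?n)"
      unfolding c_def using k(1) by (simp add: mult.assoc mult.left_commute[of lam]) (intro mult_left_mono mult_right_mono; simp)
    moreover have "lam * (\<kappa> * ?n) \<le> lam * (A.nrm u)\<^sup>2" using lam k(3)[OF V_sqint[OF u]] by (intro mult_left_mono) auto
    ultimately show "c * (H1_norm \<Omega> u)\<^sup>2 \<le> (B.nrm u)\<^sup>2"
      unfolding Bsq[OF u] H1_norm_sq using k(4)[OF V_H1[OF u]] by (simp add: distrib_left)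
    have "K * ?g \<le> C * ?g" unfolding C_def using k(2) by (intro mult_right_mono) auto
    moreover have "lam * (K * ?n) \<le> C * ?n"
      unfolding C_def using k(2) by (simp add: mult.assoc mult.left_commute[of lam]) (intro mult_left_mono mult_right_mono; simp)
    moreover have "lam * (A.nrm u)\<^sup>2 \<le> lam * (K * ?n)" using lam k(3)[OF V_sqint[OF u]] by (intro mult_left_mono) auto
    ultimately show "(B.nrm u)\<^sup>2 \<le> C * (H1_norm \<Omega> u)\<^sup>2"
      unfolding Bsq[OF u] H1_norm_sq using k(4)[OF V_H1[OF u]] by (simp add: distrib_left)
  qed
  have lower': "H1_norm \<Omega> u \<le> B.nrm u / sqrt c" and upper': "B.nrm u \<le> sqrt C * H1_norm \<Omega> u" if u: "u \<in> V" for u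
  proof -
    have H0: "0 \<le> H1_norm \<Omega> u" by (simp add: H1_norm_def)
    have "sqrt (c * (H1_norm \<Omega> u)\<^sup>2) \<le> sqrt ((B.nrm u)\<^sup>2)" using lower[OF u] by (rule real_sqrt_le_mono)
    then have "sqrt c * H1_norm \<Omega> u \<le> B.nrm u" using H0 B.nrm_nonneg[OF u] by (simp add: real_sqrt_mult)
    then show "H1_norm \<Omega> u \<le> B.nrm u / sqrt c" using c by (simp add: field_simps)
    have "sqrt ((B.nrm u)\<^sup>2) \<le> sqrt (C * (H1_norm \<Omega> u)\<^sup>2)" using upper[OF u] by (rule real_sqrt_le_mono)
    then show "B.nrm u \<le> sqrt C * H1_norm \<Omega> u" using H0 B.nrm_nonneg[OF u] by (simp add: real_sqrt_mult)
  qed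
  have "\<exists>u\<in>V. \<forall>v\<in>V. B u v = inner_A P \<Omega> F v"
  \<comment> \<open>The bound for the functional comes from lam (A.nrm u)^2 being at most (B.nrm
    u)^2.\<close>
  proof (rule B.Riesz_representation[where K = "A.nrm F / sqrt lam"])
    fix s :: "nat \<Rightarrow> scalar_field"
    assume s: "\<And>n. s n \<in> V" and cauchy: "\<And>e. 0 < e \<Longrightarrow> \<exists>N. \<forall>m\<ge>N. \<forall>n\<ge>N. B.nrm (\<lambda>p. s m p - s n p) < e"
    have "\<exists>N. \<forall>m\<ge>N. \<forall>n\<ge>N. H1_norm \<Omega> (\<lambda>p. s m p - s n p) < e" if "0 < e" for e
    proof -
      have "0 < e * sqrt c" using that c by simp
      from cauchy[OF this] obtain N where N: "\<And>m n. \<lbrakk>m \<ge> N; n \<ge> N\<rbrakk> \<Longrightarrow> B.nrm (\<lambda>p. s m p - s n p) < e * sqrt c" by blast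
      have "H1_norm \<Omega> (\<lambda>p. s m p - s n p) < e" if "m \<ge> N" "n \<ge> N" for m n
      proof -
        have "B.nrm (\<lambda>p. s m p - s n p) / sqrt c < e" using N[OF that] c by (simp add: field_simps)
        then show ?thesis using lower'[OF B.diff_mem[OF s s], of m n] by linarith
      qed
      then show ?thesis by blast
    qed
    from H1_complete[OF V_H1[OF s] this] obtain u where u: "u \<in> H1 \<Omega>" "(\<lambda>n. H1_norm \<Omega> (\<lambda>p. s n p - u p)) \<longlonglongrightarrow> 0" by blast
    have uV: "u \<in> V" by (rule V_closed[OF s u])
    have "(\<lambda>n. B.nrm (\<lambda>p. s n p - u p)) \<longlonglongrightarrow> 0"
    proof (rule Lim_null_comparison)
      show "\<forall>\<^sub>F n in sequentially. norm (B.nrm (\<lambda>p. s n p - u p)) \<le> sqrt C * H1_norm \<Omega> (\<lambda>p. s n p - u p)"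
        using upper'[OF B.diff_mem[OF s uV]] B.nrm_nonneg[OF B.diff_mem[OF s uV]] by simp
      show "(\<lambda>n. sqrt C * H1_norm \<Omega> (\<lambda>p. s n p - u p)) \<longlonglongrightarrow> 0"
        using tendsto_mult_left[OF u(2), of "sqrt C"] by simp
    qed
    then show "\<exists>u\<in>V. (\<lambda>n. B.nrm (\<lambda>p. s n p - u p)) \<longlonglongrightarrow> 0" using uV by blast
  next
    fix u v c d assume "u \<in> V" "v \<in> V"
    then show "inner_A P \<Omega> F (\<lambda>p. c * u p + d * v p) = cnj c * inner_A P \<Omega> F u + cnj d * inner_A P \<Omega> F v"
      by (rule A.comb_right[OF V_sqint V_sqint F])
  next
    fix u assume u: "u \<in> V"
    have "(A.nrm u)\<^sup>2 \<le> (B.nrm u / sqrt lam)\<^sup>2"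
      using lam Bsq[OF u] by (simp add: power_divide field_simps)
    then have "A.nrm u \<le> B.nrm u / sqrt lam"
      by (rule power2_le_imp_le) (use B.nrm_nonneg[OF u] lam in simp)
    then have "A.nrm F * A.nrm u \<le> A.nrm F * (B.nrm u / sqrt lam)" by (intro mult_left_mono A.nrm_nonneg F)
    then show "cmod (inner_A P \<Omega> F u) \<le> A.nrm F / sqrt lam * B.nrm u"
      using A.Cauchy_Schwarz[OF F V_sqint[OF u]] by simp
  qed
  then show ?thesis using B V_H1 by auto
qed

section \<open>The graph of L0: self-adjointness, sign and kernel\<close>

lemma L0_iff: "(u, w) \<in> L0 P \<Omega> V \<longleftrightarrow> u \<in> V \<and> w \<in> sqint M \<and> (\<forall>v\<in>V. q0 P \<Omega> u v = inner_A P \<Omega> w v)"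
  by (auto simp: L0_def L2_eq)

lemma L0_resolvent:
  assumes "0 < lam" "F \<in> sqint M"
  shows "\<exists>u. (u, (\<lambda>p. F p - of_real lam * u p)) \<in> L0 P \<Omega> V"
proof -
  obtain u where u: "u \<in> V" and eq: "\<And>v. v \<in> V \<Longrightarrow> q0 P \<Omega> u v + of_real lam * inner_A P \<Omega> u v = inner_A P \<Omega> F v"
    using resolvent[OF assms] by blast
  have lu: "(\<lambda>p. of_real lam * u p) \<in> sqint M" by (rule A.scale_mem[OF V_sqint[OF u]])
  have "q0 P \<Omega> u v = inner_A P \<Omega> (\<lambda>p. F p - of_real lam * u p) v" if "v \<in> V" for v
  proof -
    have "q0 P \<Omega> u v = inner_A P \<Omega> F v - of_real lam * inner_A P \<Omega> u v"
      using eq[OF that] by (simp add: algebra_simps)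
    then show ?thesis
      by (simp only: A.diff_left[OF assms(2) lu V_sqint[OF that]] A.scale_left[OF V_sqint[OF u] V_sqint[OF that]])
  qed
  then have "(u, (\<lambda>p. F p - of_real lam * u p)) \<in> L0 P \<Omega> V"
    using u A.diff_mem[OF assms(2) lu] by (auto simp: L0_iff)
  then show ?thesis by blast
qed

lemma L0_symmetric:
  assumes "(u, w) \<in> L0 P \<Omega> V" "(u', w') \<in> L0 P \<Omega> V"
  shows "inner_A P \<Omega> w u' = inner_A P \<Omega> u w'"
proof -
  have "inner_A P \<Omega> w u' = q0 P \<Omega> u u'" "q0 P \<Omega> u' u = inner_A P \<Omega> w' u" using assms by (auto simp: L0_iff)
  then show ?thesis
    using Q.hermitian[of u' u] A.hermitian[of w' u] assms V_H1 V_sqint by (simp add: L0_iff)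
qed

lemma linear_L0: "linear_operator_on_L2 \<Omega> (L0 P \<Omega> V)"
  unfolding linear_operator_on_L2_def
proof (intro conjI)
  show "L0 P \<Omega> V \<subseteq> L2 \<Omega> \<times> L2 \<Omega>" using V_sqint by (auto simp: L0_iff L2_eq)
  have "q0 P \<Omega> (\<lambda>_. 0) v = 0" if "v \<in> V" for v
    using Q.scale_left[OF H1_zero V_H1[OF that], of 0] by simp
  moreover have "inner_A P \<Omega> (\<lambda>_. 0) v = 0" for v by (simp add: inner_A_def)
  ultimately show "((\<lambda>_. 0), (\<lambda>_. 0)) \<in> L0 P \<Omega> V" using V_zero sqint_zero by (simp add: L0_iff)
  show "\<forall>(u, w)\<in>L0 P \<Omega> V. \<forall>(u', w')\<in>L0 P \<Omega> V. \<forall>c d. ((\<lambda>p. c * u p + d * u' p), (\<lambda>p. c * w p + d * w' p)) \<in> L0 P \<Omega> V"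
  proof (safe)
    fix u w u' w' c d assume "(u, w) \<in> L0 P \<Omega> V" "(u', w') \<in> L0 P \<Omega> V"
    then have 1: "u \<in> V" "w \<in> sqint M" "\<And>v. v \<in> V \<Longrightarrow> q0 P \<Omega> u v = inner_A P \<Omega> w v"
      and 2: "u' \<in> V" "w' \<in> sqint M" "\<And>v. v \<in> V \<Longrightarrow> q0 P \<Omega> u' v = inner_A P \<Omega> w' v"
      by (auto simp: L0_iff)
    have "q0 P \<Omega> (\<lambda>p. c * u p + d * u' p) v = inner_A P \<Omega> (\<lambda>p. c * w p + d * w' p) v" if "v \<in> V" for v
      by (simp only: Q.comb_left[OF V_H1[OF 1(1)] V_H1[OF 2(1)] V_H1[OF that]]
          A.comb_left[OF 1(2) 2(2) V_sqint[OF that]] 1(3)[OF that] 2(3)[OF that])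
    then show "((\<lambda>p. c * u p + d * u' p), (\<lambda>p. c * w p + d * w' p)) \<in> L0 P \<Omega> V"
      using V_comb[OF 1(1) 2(1)] sqint_comb[OF 1(2) 2(2)] by (simp add: L0_iff)
  qed
  show "\<forall>(u, w)\<in>L0 P \<Omega> V. \<forall>(u', w')\<in>L0 P \<Omega> V. ae_eq \<Omega> u u' \<longrightarrow> ae_eq \<Omega> w w'"
  proof (safe)
    fix u w u' w' assume 1: "(u, w) \<in> L0 P \<Omega> V" and 2: "(u', w') \<in> L0 P \<Omega> V" and eq: "ae_eq \<Omega> u u'"
    have uV: "u \<in> V" "u' \<in> V" and ws: "w \<in> sqint M" "w' \<in> sqint M" using 1 2 by (auto simp: L0_iff)
    \<comment> \<open>Both images represent the same functional on V, and only a null function is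
      A-orthogonal to a dense subspace.\<close>
    have "AE p in M. w p - w' p = 0"
    proof (rule A_orthogonal_V[OF sqint_diff[OF ws]])
      fix v assume v: "v \<in> V"
      have "q0 P \<Omega> u v = q0 P \<Omega> u' v"
        by (rule q0_cong_left[OF _ _ _ eq[unfolded ae_eq_def]]) (use uV v V_H1 in auto)
      then show "inner_A P \<Omega> (\<lambda>p. w p - w' p) v = 0"
        using 1 2 v A.diff_left[OF ws V_sqint[OF v]] by (simp add: L0_iff)
    qed
    then show "ae_eq \<Omega> w w'" unfolding ae_eq_def by eventually_elim simp
  qed
qed

text \<open>The resolvent \<open>u = (1 + L0 / lam)^-1 v\<close> satisfies \<open>lam * |u - v|^2 \<le> q0 v v / 4\<close>, so
  \<open>u\<close> approximates \<open>v\<close> as \<open>lam\<close> tends to infinity.\<close>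

lemma L0_domain_dense: "L2_dense \<Omega> (Domain (L0 P \<Omega> V))"
  unfolding L2_dense_def L2_eq
proof (intro ballI allI impI)
  fix f and e :: real assume f: "f \<in> sqint M" and e: "0 < e"
  from V_dense[OF f, of "e / 2"] e obtain v where v: "v \<in> V" and fv: "L2_norm \<Omega> (\<lambda>p. f p - v p) < e / 2" by auto
  have vs: "v \<in> sqint M" and vH: "v \<in> H1 \<Omega>" using V_sqint[OF v] V_H1[OF v] by auto
  obtain \<kappa> K where cmp: "comparison \<kappa> K" using comparison_exists by blast
  note \<kappa> = comparisonD[OF cmp]
  \<comment> \<open>Chosen so that lam \<kappa> |u - v|^2 being at most
    \<open>(Q.nrm v)\<^sup>2 / 4\<close> forces |u - v| < e / 2. The summand 1 keeps lam positive
    and the inequality strict.\<close>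
  define lam where "lam = ((Q.nrm v)\<^sup>2 + 1) / (\<kappa> * e\<^sup>2)"
  have lam: "0 < lam" using \<kappa> e by (simp add: lam_def add_nonneg_pos)
  have lv: "(\<lambda>p. of_real lam * v p) \<in> sqint M" by (rule A.scale_mem[OF vs])
  obtain u where u: "(u, (\<lambda>p. of_real lam * v p - of_real lam * u p)) \<in> L0 P \<Omega> V"
    using L0_resolvent[OF lam lv] by blast
  then have uV: "u \<in> V" by (simp add: L0_iff)
  have us: "u \<in> sqint M" and uH: "u \<in> H1 \<Omega>" using V_sqint[OF uV] V_H1[OF uV] by auto
  let ?d = "\<lambda>p. u p - v p"
  have dV: "?d \<in> V" using V_comb[OF uV v, of 1 "-1"] by simp
  have ds: "?d \<in> sqint M" and dH: "?d \<in> H1 \<Omega>" using V_sqint[OF dV] V_H1[OF dV] by auto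
  have "q0 P \<Omega> u ?d = inner_A P \<Omega> (\<lambda>p. of_real lam * v p - of_real lam * u p) ?d"
    using u dV by (simp add: L0_iff)
  also have "\<dots> = - of_real lam * inner_A P \<Omega> ?d ?d"
    using A.scale_left[OF ds ds, of "- of_real lam"] by (simp add: algebra_simps)
  finally have 1: "Re (q0 P \<Omega> u ?d) = - (lam * (A.nrm ?d)\<^sup>2)" using A.nrm_sq[OF ds] by simp
  have "q0 P \<Omega> u ?d = q0 P \<Omega> ?d ?d + q0 P \<Omega> v ?d"
    using Q.diff_left[OF uH vH dH] by (simp add: algebra_simps)
  then have 2: "Re (q0 P \<Omega> u ?d) = (Q.nrm ?d)\<^sup>2 + Re (q0 P \<Omega> v ?d)" using Q.nrm_sq[OF dH] by simp
  have "- Re (q0 P \<Omega> v ?d) \<le> Q.nrm v * Q.nrm ?d"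
    using Q.Cauchy_Schwarz[OF vH dH] abs_Re_le_cmod[of "q0 P \<Omega> v ?d"] by linarith
  \<comment> \<open>Young's inequality: Q.nrm v times Q.nrm d minus (Q.nrm d)^2 is at most (Q.nrm
    v)^2 / 4.\<close>
  moreover have "0 \<le> (Q.nrm v / 2 - Q.nrm ?d)\<^sup>2" by simp
  ultimately have "lam * (A.nrm ?d)\<^sup>2 \<le> (Q.nrm v)\<^sup>2 / 4"
    using 1 2 by (simp add: power2_diff power_divide)
  moreover have "lam * (\<kappa> * (L2_norm \<Omega> ?d)\<^sup>2) \<le> lam * (A.nrm ?d)\<^sup>2"
    using \<kappa>(3)[OF ds] lam by (intro mult_left_mono) auto
  ultimately have "lam * (\<kappa> * (L2_norm \<Omega> ?d)\<^sup>2) \<le> (Q.nrm v)\<^sup>2 / 4" by linarith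
  moreover have "lam * (\<kappa> * x) = ((Q.nrm v)\<^sup>2 + 1) / e\<^sup>2 * x" for x
    using \<kappa>(1) by (simp add: lam_def)
  ultimately have "((Q.nrm v)\<^sup>2 + 1) / e\<^sup>2 * (L2_norm \<Omega> ?d)\<^sup>2 \<le> (Q.nrm v)\<^sup>2 / 4" by simp
  then have "((Q.nrm v)\<^sup>2 + 1) * (L2_norm \<Omega> ?d)\<^sup>2 \<le> (Q.nrm v)\<^sup>2 / 4 * e\<^sup>2"
    using e by (simp add: pos_divide_le_eq)
  also have "\<dots> < ((Q.nrm v)\<^sup>2 + 1) * (e / 2)\<^sup>2" using e by (simp add: power_divide algebra_simps)
  finally have "((Q.nrm v)\<^sup>2 + 1) * (L2_norm \<Omega> ?d)\<^sup>2 < ((Q.nrm v)\<^sup>2 + 1) * (e / 2)\<^sup>2" .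
  then have "(L2_norm \<Omega> ?d)\<^sup>2 < (e / 2)\<^sup>2" by (rule mult_left_less_imp_less) simp
  then have "L2_norm \<Omega> ?d < e / 2" by (rule power2_less_imp_less) (use e in simp)
  moreover have "L2_norm \<Omega> (\<lambda>p. f p - u p) \<le> L2_norm \<Omega> (\<lambda>p. f p - v p) + L2_norm \<Omega> (\<lambda>p. v p - u p)"
    unfolding L2_norm_eq by (rule l2.nrm_triangle_sub[OF f vs us])
  moreover have "L2_norm \<Omega> (\<lambda>p. v p - u p) = L2_norm \<Omega> ?d"
    unfolding L2_norm_eq by (rule l2.nrm_minus_commute[OF vs us])
  ultimately have "L2_norm \<Omega> (\<lambda>p. f p - u p) < e" using fv by linarith
  then show "\<exists>v\<in>Domain (L0 P \<Omega> V). L2_norm \<Omega> (\<lambda>p. f p - v p) < e" using u by blast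
qed

lemma L0_cong:
  assumes "(u, w) \<in> L0 P \<Omega> V" "AE p in M. u p = u' p" "AE p in M. w p = w' p"
  shows "(u', w') \<in> L0 P \<Omega> V"
proof -
  have u: "u \<in> V" and w: "w \<in> sqint M" and eq: "\<And>v. v \<in> V \<Longrightarrow> q0 P \<Omega> u v = inner_A P \<Omega> w v"
    using assms(1) by (auto simp: L0_iff)
  have u': "u' \<in> V" by (rule V_cong[OF u assms(2)])
  have w': "w' \<in> sqint M" by (rule sqint_ae_cong[OF w ae_measurable[OF w assms(3)] assms(3)])
  have "q0 P \<Omega> u' v = inner_A P \<Omega> w' v" if v: "v \<in> V" for v
  proof -
    have "inner_A P \<Omega> w v = inner_A P \<Omega> w' v"
      unfolding inner_A_eq using assms(3)
      by (intro weighted_inner_cong w w' V_sqint v weight_measurable weights) auto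
    then show ?thesis using q0_cong_left[OF V_H1[OF u] V_H1[OF u'] V_H1[OF v] assms(2)] eq[OF v] by simp
  qed
  then show ?thesis using u' w' by (simp add: L0_iff)
qed

text \<open>A symmetric operator \<open>T\<close> for which \<open>T + 1\<close> is onto is self-adjoint.\<close>

theorem selfadjoint_L0: "selfadjoint_A P \<Omega> (L0 P \<Omega> V)"
proof -
  have "L0 P \<Omega> V \<subseteq> adjoint_A P \<Omega> (L0 P \<Omega> V)"
  proof
    fix x assume "x \<in> L0 P \<Omega> V"
    moreover obtain f g where x: "x = (f, g)" by fastforce
    ultimately have fg: "(f, g) \<in> L0 P \<Omega> V" by simp
    then have "f \<in> sqint M" "g \<in> sqint M" using V_sqint by (auto simp: L0_iff)
    then show "x \<in> adjoint_A P \<Omega> (L0 P \<Omega> V)"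
      using L0_symmetric[OF _ fg] by (auto simp: x adjoint_A_def L2_eq)
  qed
  moreover have "(f, g) \<in> L0 P \<Omega> V" if "(f, g) \<in> adjoint_A P \<Omega> (L0 P \<Omega> V)" for f g
  proof -
    have f: "f \<in> sqint M" and g: "g \<in> sqint M"
      and adj: "\<And>u w. (u, w) \<in> L0 P \<Omega> V \<Longrightarrow> inner_A P \<Omega> w f = inner_A P \<Omega> u g"
      using that by (auto simp: adjoint_A_def L2_eq)
    have gf: "(\<lambda>p. g p + f p) \<in> sqint M" by (rule A.add_mem[OF g f])
    \<comment> \<open>k solves (L0 + 1) k = g + f. The aim is k = f almost everywhere, which puts f
      into the domain.\<close>
    obtain k where k: "(k, (\<lambda>p. g p + f p - of_real 1 * k p)) \<in> L0 P \<Omega> V"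
      using L0_resolvent[OF zero_less_one gf] by blast
    then have ks: "k \<in> sqint M" using V_sqint by (auto simp: L0_iff)
    have fk: "(\<lambda>p. f p - k p) \<in> sqint M" by (rule sqint_diff[OF f ks])
    \<comment> \<open>Solving (L0 + 1) u = f - k turns |f - k|^2 into the pairing of (L0 + 1) u with
      f - k. The adjoint relation treats f, symmetry treats k, and everything cancels by the
      equation for k.\<close>
    obtain u where u: "(u, (\<lambda>p. f p - k p - of_real 1 * u p)) \<in> L0 P \<Omega> V"
      using L0_resolvent[OF zero_less_one fk] by blast
    then have us: "u \<in> sqint M" using V_sqint by (auto simp: L0_iff)
    let ?w = "\<lambda>p. f p - k p - u p"
    have ws: "?w \<in> sqint M" by (rule sqint_diff[OF fk us])
    have 1: "inner_A P \<Omega> ?w f = inner_A P \<Omega> u g" using adj[OF u] by simp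
    have 2: "inner_A P \<Omega> ?w k = inner_A P \<Omega> u (\<lambda>p. g p + f p - k p)"
      using L0_symmetric[OF u k] by simp
    have "inner_A P \<Omega> (\<lambda>p. f p - k p) (\<lambda>p. f p - k p) = inner_A P \<Omega> (\<lambda>p. ?w p + u p) (\<lambda>p. f p - k p)" by simp
    also have "\<dots> = inner_A P \<Omega> ?w (\<lambda>p. f p - k p) + inner_A P \<Omega> u (\<lambda>p. f p - k p)"
      by (rule A.add_left[OF ws us fk])
    also have "\<dots> = 0"
      unfolding A.diff_right[OF f ks ws] A.diff_right[OF f ks us] 1 2 A.diff_right[OF gf ks us] A.add_right[OF g f us]
      by simp
    finally have "A.nrm (\<lambda>p. f p - k p) = 0" by (simp add: A.nrm_def)
    from A_nrm_zero[OF fk this] have kf: "AE p in M. k p = f p" by eventually_elim simp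
    then have gk: "AE p in M. g p + f p - of_real 1 * k p = g p" by eventually_elim simp
    show ?thesis by (rule L0_cong[OF k kf gk])
  qed
  ultimately show ?thesis
    unfolding selfadjoint_A_def using linear_L0 L0_domain_dense by auto
qed

theorem nonnegative_L0: "nonnegative_A P \<Omega> (L0 P \<Omega> V)"
  unfolding nonnegative_A_def
proof (safe)
  fix u w assume "(u, w) \<in> L0 P \<Omega> V"
  then have "u \<in> V" "q0 P \<Omega> u u = inner_A P \<Omega> w u" by (auto simp: L0_iff)
  then show "inner_A P \<Omega> w u \<in> \<real>" "0 \<le> Re (inner_A P \<Omega> w u)"
    using Q.diag_real[OF V_H1] Q.nonneg[OF V_H1] by metis+
qed

text \<open>A vanishing gradient makes the right-hand side of the Poincare inequality zero; this is
  where connectedness of the domain is felt.\<close>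

lemma Q_nrm_zero:
  assumes u: "u \<in> H1 \<Omega>" and z: "Q.nrm u = 0"
  shows "\<exists>c. AE p in M. u p = c"
proof -
  obtain \<kappa> K where cmp: "comparison \<kappa> K" using comparison_exists by blast
  note \<kappa> = comparisonD[OF cmp]
  have "\<kappa> * ((L2_norm \<Omega> (wd_r \<Omega> u))\<^sup>2 + (L2_norm \<Omega> (wd_x \<Omega> u))\<^sup>2) \<le> 0" using \<kappa>(4)[OF u] z by simp
  then have g: "(L2_norm \<Omega> (wd_r \<Omega> u))\<^sup>2 + (L2_norm \<Omega> (wd_x \<Omega> u))\<^sup>2 \<le> 0" using \<kappa>(1) by (simp add: mult_le_0_iff)
  obtain C where C: "0 \<le> C" "\<And>u. u \<in> H1 \<Omega> \<Longrightarrow> \<exists>c. (LINT p|M. (cmod (u p - c))\<^sup>2)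
    \<le> C * ((LINT p|M. (cmod (wd_r \<Omega> u p))\<^sup>2) + (LINT p|M. (cmod (wd_x \<Omega> u p))\<^sup>2))"
    using Poincare_inequality by blast
  from C(2)[OF u] obtain c where
    "(L2_norm \<Omega> (\<lambda>p. u p - c))\<^sup>2 \<le> C * ((L2_norm \<Omega> (wd_r \<Omega> u))\<^sup>2 + (L2_norm \<Omega> (wd_x \<Omega> u))\<^sup>2)"
    unfolding L2_norm_sq by blast
  also have "\<dots> \<le> 0" using C(1) g by (simp add: mult_nonneg_nonpos)
  finally have "L2_norm \<Omega> (\<lambda>p. u p - c) = 0" by simp
  then have "AE p in M. u p - c = 0" using L2_norm_zero_iff[OF sqint_diff[OF H1_sqint[OF u] const_sqint]] by simp
  then have "AE p in M. u p = c" by eventually_elim simp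
  then show ?thesis by blast
qed

text \<open>A constant has seminorm 0 because its chosen derivatives vanish almost everywhere, and
  Cauchy-Schwarz for \<open>q0\<close> then kills its pairing with any v.\<close>

lemma q0_const: "v \<in> H1 \<Omega> \<Longrightarrow> q0 P \<Omega> (\<lambda>_. c) v = 0"
proof -
  assume v: "v \<in> H1 \<Omega>"
  have "(Q.nrm (\<lambda>_. c))\<^sup>2 = 0"
  proof -
    have "(LINT p|M. w_r p * (cmod (wd_r \<Omega> (\<lambda>_. c) p))\<^sup>2) = 0"
      by (rule integral_eq_zero_AE, use H1_const(2)[of c] in eventually_elim) simp
    moreover have "(LINT p|M. w_x p * (cmod (wd_x \<Omega> (\<lambda>_. c) p))\<^sup>2) = 0"
      by (rule integral_eq_zero_AE, use H1_const(3)[of c] in eventually_elim) simp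
    ultimately show ?thesis unfolding Q_nrm_sq[OF H1_const(1)] by simp
  qed
  then have "cmod (q0 P \<Omega> (\<lambda>_. c) v) \<le> 0" using Q.Cauchy_Schwarz[OF H1_const(1) v, of c] by simp
  then show ?thesis by simp
qed

theorem kernel_L0: "operator_kernel (L0 P \<Omega> V) = {u. \<exists>c. ae_eq \<Omega> u (\<lambda>_. c)}"
proof (intro equalityI subsetI; clarify)
  fix u assume "u \<in> operator_kernel (L0 P \<Omega> V)"
  then have u: "u \<in> V" "q0 P \<Omega> u u = 0" by (auto simp: operator_kernel_def L0_iff inner_A_def)
  then have "Q.nrm u = 0" by (simp add: Q.nrm_def)
  then show "\<exists>c. ae_eq \<Omega> u (\<lambda>_. c)" using Q_nrm_zero[OF V_H1[OF u(1)]] unfolding ae_eq_def by blast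
next
  fix u c assume "ae_eq \<Omega> u (\<lambda>_. c)"
  then have "AE p in M. c = u p" unfolding ae_eq_def by eventually_elim simp
  moreover have "((\<lambda>_. c), (\<lambda>_. 0)) \<in> L0 P \<Omega> V"
    using V_const sqint_zero q0_const V_H1 by (auto simp: L0_iff inner_A_def)
  ultimately show "u \<in> operator_kernel (L0 P \<Omega> V)"
    unfolding operator_kernel_def using L0_cong[of "\<lambda>_. c" "\<lambda>_. 0" u "\<lambda>_. 0"] by simp
qed

text \<open>The rectangle has positive area. With \<open>kernel_L0\<close> this makes the kernel
  one-dimensional modulo null sets rather than trivial.\<close>

lemma one_not_ae_zero: "\<not> ae_eq \<Omega> (\<lambda>_. 1) (\<lambda>_. 0)"
proof
  assume "ae_eq \<Omega> (\<lambda>_. 1) (\<lambda>_. 0)"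
  then have "AE p in M. False" unfolding ae_eq_def by simp
  then have "(LINT p|M. 1 :: real) = 0" by (intro integral_eq_zero_AE) (auto elim: eventually_mono)
  moreover have "(LINT p|M. 1 :: real) = measure lebesgue \<Omega>"
    by (simp add: measure_restrict_space)
  ultimately show False using measure_\<Omega> r01 x01 by simp
qed

end

section \<open>Conservation of energy\<close>

text \<open>The energy class is phrased by difference quotients and the weak equation by
  derivatives; pairings have to pass between the two.\<close>

lemma has_vector_derivative_quotient_iff:
  fixes f :: "real \<Rightarrow> complex"
  shows "(f has_vector_derivative d) (at t) \<longleftrightarrow> ((\<lambda>s. (f s - f t) / of_real (s - t)) \<longlongrightarrow> d) (at t)"
proof -
  have "norm (f s - f t - (s - t) *\<^sub>R d) / norm (s - t) = norm ((f s - f t) / of_real (s - t) - d)" if "s \<noteq> t" for s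
  proof -
    have "(f s - f t) / of_real (s - t) - d = (f s - f t - (s - t) *\<^sub>R d) / of_real (s - t)"
      using that by (simp add: diff_divide_distrib scaleR_conv_of_real)
    then show ?thesis by (simp only: norm_divide norm_of_real real_norm_def)
  qed
  then have "((\<lambda>s. norm (f s - f t - (s - t) *\<^sub>R d) / norm (s - t)) \<longlongrightarrow> 0) (at t)
      \<longleftrightarrow> ((\<lambda>s. norm ((f s - f t) / of_real (s - t) - d)) \<longlongrightarrow> 0) (at t)"
    by (intro filterlim_cong refl) (auto simp: eventually_at_filter)
  also have "\<dots> \<longleftrightarrow> ((\<lambda>s. (f s - f t) / of_real (s - t)) \<longlongrightarrow> d) (at t)"
    by (simp only: tendsto_norm_zero_iff Lim_null[symmetric])
  finally show ?thesis
    unfolding has_vector_derivative_def has_derivative_iff_norm by (simp add: bounded_linear_scaleR_left)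
qed

lemma constant_if_zero_vector_derivative:
  fixes f :: "real \<Rightarrow> complex"
  assumes "\<And>t. (f has_vector_derivative 0) (at t)"
  shows "f t = f s"
  using has_vector_derivative_zero_constant[of UNIV f] assms by (metis UNIV_I convex_UNIV)

lemma has_vector_derivative_cnj:
  "(f has_vector_derivative d) F \<Longrightarrow> ((\<lambda>t. cnj (f t)) has_vector_derivative cnj d) F"
  by (rule bounded_linear.has_vector_derivative[OF bounded_linear_cnj])

section \<open>Weak solutions, Wronskian and energy\<close>

context carter_slab
begin

abbreviation "ipA \<equiv> inner_A P \<Omega>"
abbreviation "frm \<equiv> q0 P \<Omega>"

definition "solution u ut \<longleftrightarrow> axisymmetric_solution P \<Omega> V u ut"

lemma solutionD:
  assumes "solution u ut"
  shows "u t \<in> V" "ut t \<in> sqint M"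
    "((\<lambda>s. H1_norm \<Omega> (\<lambda>p. u s p - u t p)) \<longlongrightarrow> 0) (at t)"
    "((\<lambda>s. L2_norm \<Omega> (\<lambda>p. ut s p - ut t p)) \<longlongrightarrow> 0) (at t)"
    "((\<lambda>s. L2_norm \<Omega> (\<lambda>p. (u s p - u t p) / of_real (s - t) - ut t p)) \<longlongrightarrow> 0) (at t)"
    "v \<in> V \<Longrightarrow> ((\<lambda>s. ipA (ut s) v) has_vector_derivative (- frm (u t) v)) (at t)"
  using assms unfolding solution_def axisymmetric_solution_def energy_class_def L2_eq by blast+

lemma solutionI:
  assumes "\<And>t. u t \<in> V" "\<And>t. ut t \<in> sqint M"
    "\<And>t. ((\<lambda>s. H1_norm \<Omega> (\<lambda>p. u s p - u t p)) \<longlongrightarrow> 0) (at t)"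
    "\<And>t. ((\<lambda>s. L2_norm \<Omega> (\<lambda>p. ut s p - ut t p)) \<longlongrightarrow> 0) (at t)"
    "\<And>t. ((\<lambda>s. L2_norm \<Omega> (\<lambda>p. (u s p - u t p) / of_real (s - t) - ut t p)) \<longlongrightarrow> 0) (at t)"
    "\<And>t v. v \<in> V \<Longrightarrow> ((\<lambda>s. ipA (ut s) v) has_vector_derivative (- frm (u t) v)) (at t)"
  shows "solution u ut"
  using assms V_H1 unfolding solution_def axisymmetric_solution_def energy_class_def L2_eq by simp

lemma solution_energy_class: "solution u ut \<Longrightarrow> energy_class \<Omega> u ut"
  unfolding solution_def axisymmetric_solution_def by blast

lemma A_nrm_tendsto_zero:
  assumes f: "\<And>s. f s \<in> sqint M" and lim: "((\<lambda>s. L2_norm \<Omega> (f s)) \<longlongrightarrow> 0) F"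
  shows "((\<lambda>s. A.nrm (f s)) \<longlongrightarrow> 0) F"
proof -
  obtain \<kappa> K where cmp: "comparison \<kappa> K" using comparison_exists by blast
  note \<kappa>_pos = comparisonD(1)[OF cmp] and K = comparisonD(2)[OF cmp] and \<kappa> = comparisonD(3)[OF cmp]
  have "A.nrm (f s) \<le> sqrt K * L2_norm \<Omega> (f s)" for s
  proof -
    have "sqrt ((A.nrm (f s))\<^sup>2) \<le> sqrt (K * (L2_norm \<Omega> (f s))\<^sup>2)" using \<kappa>[OF f] by (intro real_sqrt_le_mono) simp
    then show ?thesis using A.nrm_nonneg[OF f[of s]] by (simp add: real_sqrt_mult L2_norm_def)
  qed
  then have "\<forall>\<^sub>F s in F. norm (A.nrm (f s)) \<le> sqrt K * L2_norm \<Omega> (f s)" using A.nrm_nonneg[OF f] by simp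
  moreover have "((\<lambda>s. sqrt K * L2_norm \<Omega> (f s)) \<longlongrightarrow> 0) F" using tendsto_mult_left[OF lim, of "sqrt K"] by simp
  ultimately show ?thesis by (rule Lim_null_comparison)
qed

lemma quotient_mem:
  assumes "f \<in> sqint M" "g \<in> sqint M" "h \<in> sqint M"
  shows "(\<lambda>p. (f p - g p) / c) \<in> sqint M" "(\<lambda>p. (f p - g p) / c - h p) \<in> sqint M"
proof -
  show 1: "(\<lambda>p. (f p - g p) / c) \<in> sqint M"
    using A.scale_mem[OF sqint_diff[OF assms(1,2)], of "1 / c"] by simp
  show "(\<lambda>p. (f p - g p) / c - h p) \<in> sqint M" by (rule sqint_diff[OF 1 assms(3)])
qed

lemma pairing_derivative:
  assumes u: "solution u ut" and v: "solution v vt"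
  shows "((\<lambda>t. ipA (u t) (vt t)) has_vector_derivative (ipA (ut t) (vt t) - frm (u t) (v t))) (at t)"
proof -
  have us: "u s \<in> sqint M" and vs: "vt s \<in> sqint M" "ut s \<in> sqint M" for s
    using solutionD(1,2)[OF u] solutionD(2)[OF v] V_sqint by auto
  let ?D = "\<lambda>s p. (u s p - u t p) / of_real (s - t)"
  have D: "?D s \<in> sqint M" and Dd: "(\<lambda>p. ?D s p - ut t p) \<in> sqint M" and vd: "(\<lambda>p. vt s p - vt t p) \<in> sqint M" for s
    using quotient_mem[OF us us vs(2)] sqint_diff[OF vs(1) vs(1)] by auto
  have n1: "((\<lambda>s. A.nrm (\<lambda>p. ?D s p - ut t p)) \<longlongrightarrow> 0) (at t)"
    by (rule A_nrm_tendsto_zero[OF Dd solutionD(5)[OF u]])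
  have n2: "((\<lambda>s. A.nrm (\<lambda>p. vt s p - vt t p)) \<longlongrightarrow> 0) (at t)"
    by (rule A_nrm_tendsto_zero[OF vd solutionD(4)[OF v]])
  have "((\<lambda>s. ipA (?D s) (vt s) - ipA (ut t) (vt t)) \<longlongrightarrow> 0) (at t)"
  proof (rule Lim_null_comparison)
    have "norm (ipA (?D s) (vt s) - ipA (ut t) (vt t))
        \<le> A.nrm (\<lambda>p. ?D s p - ut t p) * (A.nrm (vt t) + A.nrm (\<lambda>p. vt s p - vt t p)) + A.nrm (ut t) * A.nrm (\<lambda>p. vt s p - vt t p)" for s
    proof -
      have split: "ipA (?D s) (vt s) - ipA (ut t) (vt t) = ipA (\<lambda>p. ?D s p - ut t p) (vt s) + ipA (ut t) (\<lambda>p. vt s p - vt t p)"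
        unfolding A.diff_left[OF D vs(2) vs(1)] A.diff_right[OF vs(1) vs(1) vs(2)] by simp
      have "A.nrm (vt s) \<le> A.nrm (vt t) + A.nrm (\<lambda>p. vt s p - vt t p)"
        using A.nrm_add_le[OF vs(1)[of t] vd[of s]] by simp
      then have "A.nrm (\<lambda>p. ?D s p - ut t p) * A.nrm (vt s)
          \<le> A.nrm (\<lambda>p. ?D s p - ut t p) * (A.nrm (vt t) + A.nrm (\<lambda>p. vt s p - vt t p))"
        by (intro mult_left_mono A.nrm_nonneg Dd)
      then show ?thesis
        unfolding split
        using A.Cauchy_Schwarz[OF Dd[of s] vs(1)[of s]] A.Cauchy_Schwarz[OF vs(2)[of t] vd[of s]]
          norm_triangle_ineq[of "ipA (\<lambda>p. ?D s p - ut t p) (vt s)" "ipA (ut t) (\<lambda>p. vt s p - vt t p)"]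
        by linarith
    qed
    then show "\<forall>\<^sub>F s in at t. norm (ipA (?D s) (vt s) - ipA (ut t) (vt t))
        \<le> A.nrm (\<lambda>p. ?D s p - ut t p) * (A.nrm (vt t) + A.nrm (\<lambda>p. vt s p - vt t p)) + A.nrm (ut t) * A.nrm (\<lambda>p. vt s p - vt t p)"
      by simp
    show "((\<lambda>s. A.nrm (\<lambda>p. ?D s p - ut t p) * (A.nrm (vt t) + A.nrm (\<lambda>p. vt s p - vt t p)) + A.nrm (ut t) * A.nrm (\<lambda>p. vt s p - vt t p)) \<longlongrightarrow> 0) (at t)"
      using tendsto_add[OF tendsto_mult[OF n1 tendsto_add[OF tendsto_const[of "A.nrm (vt t)"] n2]] tendsto_mult[OF tendsto_const[of "A.nrm (ut t)"] n2]] by simp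
  qed
  then have t1: "((\<lambda>s. ipA (?D s) (vt s)) \<longlongrightarrow> ipA (ut t) (vt t)) (at t)" by (simp only: Lim_null[symmetric])
  have "((\<lambda>s. cnj (ipA (vt s) (u t))) has_vector_derivative cnj (- frm (v t) (u t))) (at t)"
    by (rule has_vector_derivative_cnj[OF solutionD(6)[OF v solutionD(1)[OF u]]])
  moreover have "cnj (ipA (vt s) (u t)) = ipA (u t) (vt s)" for s by (rule A.hermitian[OF vs(1) us, symmetric])
  moreover have "cnj (- frm (v t) (u t)) = - frm (u t) (v t)"
    using Q.hermitian[OF V_H1[OF solutionD(1)[OF v]] V_H1[OF solutionD(1)[OF u]]] by simp
  ultimately have "((\<lambda>s. ipA (u t) (vt s)) has_vector_derivative - frm (u t) (v t)) (at t)" by (simp only:)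
  then have t2: "((\<lambda>s. (ipA (u t) (vt s) - ipA (u t) (vt t)) / of_real (s - t)) \<longlongrightarrow> - frm (u t) (v t)) (at t)"
    by (simp only: has_vector_derivative_quotient_iff)
  have eq: "ipA (?D s) (vt s) + (ipA (u t) (vt s) - ipA (u t) (vt t)) / of_real (s - t)
      = (ipA (u s) (vt s) - ipA (u t) (vt t)) / of_real (s - t)" for s
  proof -
    have "ipA (?D s) (vt s) = (1 / of_real (s - t)) * ipA (\<lambda>p. u s p - u t p) (vt s)"
      using A.scale_left[OF sqint_diff[OF us us] vs(1), of "1 / of_real (s - t)" s t s] by simp
    then show ?thesis unfolding A.diff_left[OF us us vs(1)] by (simp add: add_divide_distrib[symmetric])
  qed
  from tendsto_add[OF t1 t2] show ?thesis
    unfolding eq has_vector_derivative_quotient_iff by simp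
qed

lemma pairing_derivative':
  assumes u: "solution u ut" and v: "solution v vt"
  shows "((\<lambda>t. ipA (ut t) (v t)) has_vector_derivative (ipA (ut t) (vt t) - frm (u t) (v t))) (at t)"
proof -
  have us: "v s \<in> sqint M" "vt s \<in> sqint M" "ut s \<in> sqint M" for s
    using solutionD(1,2)[OF v] solutionD(2)[OF u] V_sqint by auto
  have "((\<lambda>t. cnj (ipA (v t) (ut t))) has_vector_derivative cnj (ipA (vt t) (ut t) - frm (v t) (u t))) (at t)"
    by (rule has_vector_derivative_cnj[OF pairing_derivative[OF v u]])
  moreover have "cnj (ipA (v t) (ut t)) = ipA (ut t) (v t)" for t by (rule A.hermitian[OF us(1) us(3), symmetric])
  moreover have "cnj (ipA (vt t) (ut t) - frm (v t) (u t)) = ipA (ut t) (vt t) - frm (u t) (v t)"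
    using A.hermitian[OF us(2,3)] Q.hermitian[OF V_H1[OF solutionD(1)[OF v]] V_H1[OF solutionD(1)[OF u]]] by simp
  ultimately show ?thesis by (simp only:)
qed

lemma wronskian_constant:
  assumes u: "solution u ut" and v: "solution v vt"
  shows "ipA (u t) (vt t) - ipA (ut t) (v t) = ipA (u s) (vt s) - ipA (ut s) (v s)"
  by (rule constant_if_zero_vector_derivative)
    (use has_vector_derivative_diff[OF pairing_derivative[OF u v] pairing_derivative'[OF u v]] in simp)

lemma has_vector_derivative_shift:
  "(f has_vector_derivative d) (at (t + h)) \<Longrightarrow> ((\<lambda>s. f (s + h)) has_vector_derivative d) (at (t :: real))"
proof -
  assume f: "(f has_vector_derivative d) (at (t + h))"
  have "((\<lambda>s. s + h) has_vector_derivative 1) (at t)"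
    by (rule has_vector_derivative_eq_rhs[OF has_vector_derivative_add_const[THEN iffD2]])
      (auto intro: has_vector_derivative_id)
  from vector_diff_chain_at[OF this f] show ?thesis by (simp add: o_def)
qed

lemma solution_shift:
  assumes u: "solution u ut"
  shows "solution (\<lambda>t. u (t + h)) (\<lambda>t. ut (t + h))"
proof (rule solutionI)
  fix t
  show "u (t + h) \<in> V" "ut (t + h) \<in> sqint M" by (rule solutionD[OF u])+
  show "((\<lambda>s. H1_norm \<Omega> (\<lambda>p. u (s + h) p - u (t + h) p)) \<longlongrightarrow> 0) (at t)"
    using LIM_offset[OF solutionD(3)[OF u, of "t + h"], of h] by simp
  show "((\<lambda>s. L2_norm \<Omega> (\<lambda>p. ut (s + h) p - ut (t + h) p)) \<longlongrightarrow> 0) (at t)"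
    using LIM_offset[OF solutionD(4)[OF u, of "t + h"], of h] by simp
  show "((\<lambda>s. L2_norm \<Omega> (\<lambda>p. (u (s + h) p - u (t + h) p) / of_real (s - t) - ut (t + h) p)) \<longlongrightarrow> 0) (at t)"
    using LIM_offset[OF solutionD(5)[OF u, of "t + h"], of h] by simp
  show "((\<lambda>s. ipA (ut (s + h)) v) has_vector_derivative - frm (u (t + h)) v) (at t)" if "v \<in> V" for v
    by (rule has_vector_derivative_shift[OF solutionD(6)[OF u that]])
qed

text \<open>Difference quotients of u converge in norm, so any square-integrable w may be used here,
  in contrast to pairings of ut, which need w in V. The energy identity applies this with a velocity
  as w.\<close>

lemma strong_derivative:
  assumes u: "solution u ut" and w: "w \<in> sqint M"
  shows "((\<lambda>s. ipA (u s) w) has_vector_derivative ipA (ut t) w) (at t)"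
proof -
  have us: "u s \<in> sqint M" "ut s \<in> sqint M" for s using solutionD(1,2)[OF u] V_sqint by auto
  let ?D = "\<lambda>s p. (u s p - u t p) / of_real (s - t)"
  note D = quotient_mem[OF us(1) us(1) us(2)]
  have n: "((\<lambda>s. A.nrm (\<lambda>p. ?D s p - ut t p)) \<longlongrightarrow> 0) (at t)"
    by (rule A_nrm_tendsto_zero[OF D(2) solutionD(5)[OF u]])
  have "((\<lambda>s. ipA (?D s) w) \<longlongrightarrow> ipA (ut t) w) (at t)"
    by (rule A.tendsto_form_left[OF _ us(2) w n]) (rule D(1))
  moreover have "ipA (?D s) w = (ipA (u s) w - ipA (u t) w) / of_real (s - t)" for s
    using A.scale_left[OF sqint_diff[OF us(1) us(1)] w, of "1 / of_real (s - t)" s t] A.diff_left[OF us(1) us(1) w, of s t] by simp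
  ultimately show ?thesis by (simp only: has_vector_derivative_quotient_iff)
qed

text \<open>A weak solution has too little regularity to be used as its own test function. Instead, the
  Wronskian of \<open>u\<close> and its time shifts is constant, so \<open>\<langle>u(t),u_t(s)\<rangle> - \<langle>u_t(t),u(s)\<rangle>\<close> depends on
  \<open>s - t\<close> only, and its \<open>t\<close>-derivative at \<open>t = s\<close> is twice the energy.\<close>

theorem energy_conservation:
  assumes u: "solution u ut"
  shows "(A.nrm (ut s))\<^sup>2 + (Q.nrm (u s))\<^sup>2 = (A.nrm (ut 0))\<^sup>2 + (Q.nrm (u 0))\<^sup>2"
proof -
  have us: "u s \<in> sqint M" "ut s \<in> sqint M" "u s \<in> V" "u s \<in> H1 \<Omega>" for s
    using solutionD(1,2)[OF u] V_sqint V_H1 by auto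
  define R where "R t s = ipA (u t) (ut s) - ipA (ut t) (u s)" for t s
  \<comment> \<open>The second solution is u delayed by t; its Wronskian with u is compared at the
    times t + s and t.\<close>
  have shift: "R (t + s) s = R t 0" for t s
    using wronskian_constant[OF u solution_shift[OF u, of "- t"], of "t + s" t] by (simp add: R_def)
  \<comment> \<open>With s frozen only the first factors move: the first term is differentiated
    strongly, the second by the weak equation tested with \<open>u s\<close>.\<close>
  have "((\<lambda>t. R t s) has_vector_derivative of_real ((A.nrm (ut s))\<^sup>2 + (Q.nrm (u s))\<^sup>2)) (at s)" for s
  proof -
    have "((\<lambda>t. R t s) has_vector_derivative ipA (ut s) (ut s) - - frm (u s) (u s)) (at s)"
      unfolding R_def
      by (intro has_vector_derivative_diff strong_derivative[OF u us(2)] solutionD(6)[OF u us(3)])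
    then show ?thesis by (simp add: A.diag_eq[OF us(2)] Q.diag_eq[OF us(4)])
  qed
  note d = this
  have "((\<lambda>t. R (t + s) s) has_vector_derivative of_real ((A.nrm (ut s))\<^sup>2 + (Q.nrm (u s))\<^sup>2)) (at 0)"
    by (rule has_vector_derivative_shift) (use d[of s] in simp)
  then have "((\<lambda>t. R t 0) has_vector_derivative of_real ((A.nrm (ut s))\<^sup>2 + (Q.nrm (u s))\<^sup>2)) (at 0)"
    unfolding shift .
  from vector_derivative_unique_at[OF this d[of 0]] show ?thesis by (simp only: of_real_eq_iff)
qed

section \<open>Differences, affine solutions and changes on null sets\<close>

lemma L2_norm_nonneg: "0 \<le> L2_norm \<Omega> u"
  by (simp add: L2_norm_def)

lemma H1_norm_nonneg: "0 \<le> H1_norm \<Omega> u"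
  by (simp add: H1_norm_def)

lemma solution_diff:
  assumes u: "solution u ut" and v: "solution v vt"
  shows "solution (\<lambda>t p. u t p - v t p) (\<lambda>t p. ut t p - vt t p)"
proof (rule solutionI)
  have us: "u s \<in> sqint M" "ut s \<in> sqint M" "u s \<in> V" "u s \<in> H1 \<Omega>"
    and vs: "v s \<in> sqint M" "vt s \<in> sqint M" "v s \<in> V" "v s \<in> H1 \<Omega>" for s
    using solutionD(1,2)[OF u] solutionD(1,2)[OF v] V_sqint V_H1 by auto
  fix t
  show "(\<lambda>p. u t p - v t p) \<in> V" using V_comb[OF us(3) vs(3), of 1 t "-1" t] by simp
  show "(\<lambda>p. ut t p - vt t p) \<in> sqint M" by (rule sqint_diff[OF us(2) vs(2)])
  show "((\<lambda>s. H1_norm \<Omega> (\<lambda>p. (u s p - v s p) - (u t p - v t p))) \<longlongrightarrow> 0) (at t)"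
  proof (rule Lim_null_comparison)
    have "H1_norm \<Omega> (\<lambda>p. (u s p - v s p) - (u t p - v t p)) \<le> H1_norm \<Omega> (\<lambda>p. u s p - u t p) + H1_norm \<Omega> (\<lambda>p. v s p - v t p)" for s
    proof -
      have eq: "(\<lambda>p. (u s p - v s p) - (u t p - v t p)) = (\<lambda>p. (u s p - u t p) - (v s p - v t p))"
        by (simp add: fun_eq_iff)
      show ?thesis unfolding eq H1_norm_eq by (rule h1.nrm_diff_le[OF h1.diff_mem[OF us(4) us(4)] h1.diff_mem[OF vs(4) vs(4)]])
    qed
    then show "\<forall>\<^sub>F s in at t. norm (H1_norm \<Omega> (\<lambda>p. (u s p - v s p) - (u t p - v t p)))
        \<le> H1_norm \<Omega> (\<lambda>p. u s p - u t p) + H1_norm \<Omega> (\<lambda>p. v s p - v t p)"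
      by (simp add: H1_norm_nonneg)
    show "((\<lambda>s. H1_norm \<Omega> (\<lambda>p. u s p - u t p) + H1_norm \<Omega> (\<lambda>p. v s p - v t p)) \<longlongrightarrow> 0) (at t)"
      using tendsto_add[OF solutionD(3)[OF u] solutionD(3)[OF v]] by simp
  qed
  show "((\<lambda>s. L2_norm \<Omega> (\<lambda>p. (ut s p - vt s p) - (ut t p - vt t p))) \<longlongrightarrow> 0) (at t)"
  proof (rule Lim_null_comparison)
    have "L2_norm \<Omega> (\<lambda>p. (ut s p - vt s p) - (ut t p - vt t p)) \<le> L2_norm \<Omega> (\<lambda>p. ut s p - ut t p) + L2_norm \<Omega> (\<lambda>p. vt s p - vt t p)" for s
    proof -
      have eq: "(\<lambda>p. (ut s p - vt s p) - (ut t p - vt t p)) = (\<lambda>p. (ut s p - ut t p) - (vt s p - vt t p))"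
        by (simp add: fun_eq_iff)
      show ?thesis unfolding eq L2_norm_eq by (rule l2.nrm_diff_le[OF sqint_diff[OF us(2) us(2)] sqint_diff[OF vs(2) vs(2)]])
    qed
    then show "\<forall>\<^sub>F s in at t. norm (L2_norm \<Omega> (\<lambda>p. (ut s p - vt s p) - (ut t p - vt t p)))
        \<le> L2_norm \<Omega> (\<lambda>p. ut s p - ut t p) + L2_norm \<Omega> (\<lambda>p. vt s p - vt t p)"
      by (simp add: L2_norm_nonneg)
    show "((\<lambda>s. L2_norm \<Omega> (\<lambda>p. ut s p - ut t p) + L2_norm \<Omega> (\<lambda>p. vt s p - vt t p)) \<longlongrightarrow> 0) (at t)"
      using tendsto_add[OF solutionD(4)[OF u] solutionD(4)[OF v]] by simp
  qed
  show "((\<lambda>s. L2_norm \<Omega> (\<lambda>p. ((u s p - v s p) - (u t p - v t p)) / of_real (s - t) - (ut t p - vt t p))) \<longlongrightarrow> 0) (at t)"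
  proof (rule Lim_null_comparison)
    let ?U = "\<lambda>s p. (u s p - u t p) / of_real (s - t) - ut t p" and ?W = "\<lambda>s p. (v s p - v t p) / of_real (s - t) - vt t p"
    have "L2_norm \<Omega> (\<lambda>p. ((u s p - v s p) - (u t p - v t p)) / of_real (s - t) - (ut t p - vt t p)) \<le> L2_norm \<Omega> (?U s) + L2_norm \<Omega> (?W s)" for s
    proof -
      have eq: "(\<lambda>p. ((u s p - v s p) - (u t p - v t p)) / of_real (s - t) - (ut t p - vt t p)) = (\<lambda>p. ?U s p - ?W s p)"
        by (simp add: fun_eq_iff diff_divide_distrib)
      show ?thesis unfolding eq L2_norm_eq by (rule l2.nrm_diff_le[OF quotient_mem(2)[OF us(1) us(1) us(2)] quotient_mem(2)[OF vs(1) vs(1) vs(2)]])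
    qed
    then show "\<forall>\<^sub>F s in at t. norm (L2_norm \<Omega> (\<lambda>p. ((u s p - v s p) - (u t p - v t p)) / of_real (s - t) - (ut t p - vt t p)))
        \<le> L2_norm \<Omega> (?U s) + L2_norm \<Omega> (?W s)"
      by (simp add: L2_norm_nonneg)
    show "((\<lambda>s. L2_norm \<Omega> (?U s) + L2_norm \<Omega> (?W s)) \<longlongrightarrow> 0) (at t)"
      using tendsto_add[OF solutionD(5)[OF u] solutionD(5)[OF v]] by simp
  qed
  show "((\<lambda>s. ipA (\<lambda>p. ut s p - vt s p) w) has_vector_derivative - frm (\<lambda>p. u t p - v t p) w) (at t)" if w: "w \<in> V" for w
  proof -
    have "((\<lambda>s. ipA (ut s) w - ipA (vt s) w) has_vector_derivative - frm (u t) w - - frm (v t) w) (at t)"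
      by (intro has_vector_derivative_diff solutionD(6)[OF u w] solutionD(6)[OF v w])
    then show ?thesis
      by (simp add: A.diff_left[OF us(2) vs(2) V_sqint[OF w]] Q.diff_left[OF us(4) vs(4) V_H1[OF w]])
  qed
qed

lemma affine_solution: "solution (\<lambda>t p. c0 + c1 * of_real t) (\<lambda>t p. c1)"
proof (rule solutionI)
  fix t
  show "(\<lambda>p. c0 + c1 * of_real t) \<in> V" "(\<lambda>p. c1) \<in> sqint M" by (rule V_const const_sqint)+
  have "H1_norm \<Omega> (\<lambda>p. (c0 + c1 * of_real s) - (c0 + c1 * of_real t)) = cmod (c1 * of_real (s - t)) * H1_norm \<Omega> (\<lambda>p. 1)" for s
    using h1.nrm_scale[OF H1_const(1)[of 1], of "c1 * of_real (s - t)"] by (simp add: H1_norm_eq algebra_simps)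
  moreover have "((\<lambda>s. cmod (c1 * of_real (s - t)) * H1_norm \<Omega> (\<lambda>p. 1)) \<longlongrightarrow> cmod (c1 * of_real (t - t)) * H1_norm \<Omega> (\<lambda>p. 1)) (at t)"
    by (intro tendsto_intros)
  ultimately show "((\<lambda>s. H1_norm \<Omega> (\<lambda>p. (c0 + c1 * of_real s) - (c0 + c1 * of_real t))) \<longlongrightarrow> 0) (at t)" by simp
  show "((\<lambda>s. L2_norm \<Omega> (\<lambda>p. c1 - c1)) \<longlongrightarrow> 0) (at t)" by (simp add: L2_norm_def)
  \<comment> \<open>At s = t the quotient is 0 by the convention x / 0 = 0, which would leave -c1;
    the punctured filter excludes this point.\<close>
  have "\<forall>\<^sub>F s in at t. L2_norm \<Omega> (\<lambda>p. ((c0 + c1 * of_real s) - (c0 + c1 * of_real t)) / of_real (s - t) - c1) = 0"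
    unfolding eventually_at_filter
  proof (intro always_eventually allI impI)
    fix s assume "s \<noteq> t"
    then have "((c0 + c1 * of_real s) - (c0 + c1 * of_real t)) / of_real (s - t) - c1 = 0"
      by (simp add: right_diff_distrib[symmetric] of_real_diff[symmetric] del: of_real_diff)
    then show "L2_norm \<Omega> (\<lambda>p. ((c0 + c1 * of_real s) - (c0 + c1 * of_real t)) / of_real (s - t) - c1) = 0"
      by (simp only: L2_norm_def) simp
  qed
  then show "((\<lambda>s. L2_norm \<Omega> (\<lambda>p. ((c0 + c1 * of_real s) - (c0 + c1 * of_real t)) / of_real (s - t) - c1)) \<longlongrightarrow> 0) (at t)"
    by (rule tendsto_eventually)
  show "((\<lambda>s. ipA (\<lambda>p. c1) v) has_vector_derivative - frm (\<lambda>p. c0 + c1 * of_real t) v) (at t)" if "v \<in> V" for v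
    by (simp add: q0_const[OF V_H1[OF that]])
qed

lemma H1_norm_cong:
  assumes u: "u \<in> H1 \<Omega>" and v: "v \<in> H1 \<Omega>" and eq: "AE p in M. u p = v p"
  shows "H1_norm \<Omega> u = H1_norm \<Omega> v"
proof -
  note c = H1_cong[OF u sqint_measurable[OF H1_sqint[OF v]] eq]
  note [measurable] = sqint_measurable[OF H1_sqint[OF u]] sqint_measurable[OF H1_sqint[OF v]]
    wd_measurable(1)[OF u] wd_measurable(1)[OF v]
    wd_measurable(2)[OF u] wd_measurable(2)[OF v]
  have "(LINT p|M. (cmod (u p))\<^sup>2) = (LINT p|M. (cmod (v p))\<^sup>2)"
    by (rule integral_cong_AE) (use eq in \<open>auto elim!: eventually_mono\<close>)
  moreover have "(LINT p|M. (cmod (wd_r \<Omega> u p))\<^sup>2) = (LINT p|M. (cmod (wd_r \<Omega> v p))\<^sup>2)"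
    by (rule integral_cong_AE) (use c(2) in \<open>auto elim!: eventually_mono\<close>)
  moreover have "(LINT p|M. (cmod (wd_x \<Omega> u p))\<^sup>2) = (LINT p|M. (cmod (wd_x \<Omega> v p))\<^sup>2)"
    by (rule integral_cong_AE) (use c(3) in \<open>auto elim!: eventually_mono\<close>)
  ultimately show ?thesis by (simp add: H1_norm_def L2_norm_sq)
qed

lemma L2_norm_cong:
  assumes "u \<in> sqint M" "v \<in> sqint M" "AE p in M. u p = v p"
  shows "L2_norm \<Omega> u = L2_norm \<Omega> v"
proof -
  note [measurable] = assms(1,2)[THEN sqint_measurable]
  have "(LINT p|M. (cmod (u p))\<^sup>2) = (LINT p|M. (cmod (v p))\<^sup>2)"
    by (rule integral_cong_AE) (use assms(3) in \<open>auto elim!: eventually_mono\<close>)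
  then show ?thesis by (simp add: L2_norm_def)
qed

text \<open>Zero modes prescribe u t only up to a null set, which may vary with t, so the solution
  property has to survive such changes.\<close>

lemma solution_cong:
  assumes u: "solution u ut" and eq: "\<And>t. AE p in M. u t p = u' t p"
  shows "solution u' ut"
proof (rule solutionI)
  have V': "u' t \<in> V" for t by (rule V_cong[OF solutionD(1)[OF u] eq])
  have us: "u s \<in> sqint M" "ut s \<in> sqint M" "u s \<in> V" "u s \<in> H1 \<Omega>" and vs: "u' s \<in> sqint M" "u' s \<in> V" "u' s \<in> H1 \<Omega>" for s
    using solutionD(1,2)[OF u] V' V_sqint V_H1 by auto
  fix t
  show "u' t \<in> V" "ut t \<in> sqint M" by (rule V' us)+
  have "H1_norm \<Omega> (\<lambda>p. u s p - u t p) = H1_norm \<Omega> (\<lambda>p. u' s p - u' t p)" for s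
  proof (rule H1_norm_cong[OF h1.diff_mem[OF us(4) us(4)] h1.diff_mem[OF vs(3) vs(3)]])
    show "AE p in M. u s p - u t p = u' s p - u' t p" using eq[of s] eq[of t] by eventually_elim simp
  qed
  then show "((\<lambda>s. H1_norm \<Omega> (\<lambda>p. u' s p - u' t p)) \<longlongrightarrow> 0) (at t)" using solutionD(3)[OF u, of t] by simp
  show "((\<lambda>s. L2_norm \<Omega> (\<lambda>p. ut s p - ut t p)) \<longlongrightarrow> 0) (at t)" by (rule solutionD(4)[OF u])
  have "L2_norm \<Omega> (\<lambda>p. (u s p - u t p) / of_real (s - t) - ut t p) = L2_norm \<Omega> (\<lambda>p. (u' s p - u' t p) / of_real (s - t) - ut t p)" for s
  proof (rule L2_norm_cong[OF quotient_mem(2)[OF us(1) us(1) us(2)] quotient_mem(2)[OF vs(1) vs(1) us(2)]])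
    show "AE p in M. (u s p - u t p) / of_real (s - t) - ut t p = (u' s p - u' t p) / of_real (s - t) - ut t p"
      using eq[of s] eq[of t] by eventually_elim simp
  qed
  then show "((\<lambda>s. L2_norm \<Omega> (\<lambda>p. (u' s p - u' t p) / of_real (s - t) - ut t p)) \<longlongrightarrow> 0) (at t)"
    using solutionD(5)[OF u, of t] by simp
  show "((\<lambda>s. ipA (ut s) v) has_vector_derivative - frm (u' t) v) (at t)" if "v \<in> V" for v
    using solutionD(6)[OF u that, of t] q0_cong_left[OF us(4) vs(3) V_H1[OF that] eq] by simp
qed

end

section \<open>Decomposition of solutions\<close>

context carter_slab
begin

section \<open>Means and stability of the mean-free part\<close>

definition mass :: real where
  "mass = (LINT p|M. A_weight P p)"

abbreviation mean :: "scalar_field \<Rightarrow> complex" where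
  "mean f \<equiv> ipA f (\<lambda>_. 1)"

lemma mass_pos: "0 < mass"
proof -
  have "(A.nrm (\<lambda>_. 1))\<^sup>2 = mass" by (simp add: A_nrm_sq[OF const_sqint] mass_def)
  moreover have "A.nrm (\<lambda>_. 1) \<noteq> 0"
    using A_nrm_zero[OF const_sqint[of 1]] one_not_ae_zero unfolding ae_eq_def by blast
  ultimately show ?thesis by (metis zero_less_power2)
qed

lemma average_A_eq: "average_A P \<Omega> f = mean f / of_real mass"
  by (simp add: average_A_def inner_A_def mass_def)

lemma mean_const: "mean (\<lambda>_. c) = c * of_real mass"
  by (simp add: inner_A_def mass_def mult.commute)

lemma mean_cong:
  assumes "f \<in> sqint M" "g \<in> sqint M" "AE p in M. f p = g p"
  shows "mean f = mean g"
  unfolding inner_A_eq using assms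
  by (intro weighted_inner_cong weight_measurable weights const_sqint) auto

text \<open>The constant 1 is an admissible test function and \<open>q0\<close> annihilates it:
  conservation of momentum of the zero mode.\<close>

lemma mean_velocity:
  assumes u: "solution u ut"
  shows "mean (ut t) = mean (ut 0)"
proof (rule constant_if_zero_vector_derivative)
  fix t
  have "frm (u t) (\<lambda>_. 1) = 0"
    using Q.hermitian[OF H1_const(1)[of 1] V_H1[OF solutionD(1)[OF u]]] q0_const[OF V_H1[OF solutionD(1)[OF u]], of 1] by simp
  then show "((\<lambda>t. mean (ut t)) has_vector_derivative 0) (at t)"
    using solutionD(6)[OF u V_one, of t] by simp
qed

lemma mean_affine:
  assumes u: "solution u ut"
  shows "mean (u t) = mean (u 0) + mean (ut 0) * of_real t"
proof -
  have lin: "((\<lambda>s. mean (ut 0) * of_real s) has_vector_derivative mean (ut 0)) (at s)" for s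
    by (auto intro!: derivative_eq_intros)
  have "((\<lambda>s. mean (u s) - mean (ut 0) * of_real s) has_vector_derivative 0) (at s)" for s
    using has_vector_derivative_diff[OF strong_derivative[OF u const_sqint[of 1], of s] lin[of s]] mean_velocity[OF u, of s] by simp
  from constant_if_zero_vector_derivative[OF this, of t 0] show ?thesis by (simp add: algebra_simps)
qed

text \<open>A mean-free u is A-orthogonal to constants, so by Pythagoras subtracting any c only
  increases its A-norm. The unspecified constant of the Poincare inequality can therefore be
  dropped.\<close>

lemma mean_free_Poincare:
  "\<exists>C\<ge>0. \<forall>u\<in>H1 \<Omega>. mean u = 0 \<longrightarrow> H1_norm \<Omega> u \<le> C * Q.nrm u"
proof -
  obtain \<kappa> K where cmp: "comparison \<kappa> K" using comparison_exists by blast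
  note \<kappa> = comparisonD[OF cmp]
  obtain C where C: "0 \<le> C" "\<And>u. u \<in> H1 \<Omega> \<Longrightarrow> \<exists>c. (LINT p|M. (cmod (u p - c))\<^sup>2)
    \<le> C * ((LINT p|M. (cmod (wd_r \<Omega> u p))\<^sup>2) + (LINT p|M. (cmod (wd_x \<Omega> u p))\<^sup>2))"
    using Poincare_inequality by blast
  \<comment> \<open>K C / \<kappa> bounds the L2 part by the gradient, 1 accounts for the gradient
    itself, and the last division by \<kappa> passes from the gradient to \<open>q0\<close>.\<close>
  define D where "D = (K * C / \<kappa> + 1) / \<kappa>"
  have D: "0 \<le> D" using \<kappa>(1,2) C(1) by (simp add: D_def)
  have "H1_norm \<Omega> u \<le> sqrt D * Q.nrm u" if u: "u \<in> H1 \<Omega>" and mean: "mean u = 0" for u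
  proof -
    let ?g = "(L2_norm \<Omega> (wd_r \<Omega> u))\<^sup>2 + (L2_norm \<Omega> (wd_x \<Omega> u))\<^sup>2"
    note us = H1_sqint[OF u]
    from C(2)[OF u] obtain c where c: "(L2_norm \<Omega> (\<lambda>p. u p - c))\<^sup>2 \<le> C * ?g"
      unfolding L2_norm_sq by blast
    have "(A.nrm (\<lambda>p. u p + (- c) * 1))\<^sup>2 = (A.nrm u)\<^sup>2 + (cmod c)\<^sup>2 * (A.nrm (\<lambda>_. 1))\<^sup>2"
      using A.Re_diag_comb[OF us const_sqint[of 1], of "- c"] mean
        A.nrm_sq[OF A.diff_mem[OF us const_sqint[of c]]] A.nrm_sq[OF us] A.nrm_sq[OF const_sqint[of 1]] by simp
    then have "(A.nrm u)\<^sup>2 \<le> (A.nrm (\<lambda>p. u p - c))\<^sup>2" by simp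
    also have "\<dots> \<le> K * (L2_norm \<Omega> (\<lambda>p. u p - c))\<^sup>2" using \<kappa>(3)[OF sqint_diff[OF us const_sqint]] by simp
    also have "\<dots> \<le> K * (C * ?g)" using c \<kappa>(2) by (intro mult_left_mono) auto
    finally have "\<kappa> * (L2_norm \<Omega> u)\<^sup>2 \<le> K * (C * ?g)" using \<kappa>(3)[OF us] by linarith
    then have "(L2_norm \<Omega> u)\<^sup>2 \<le> K * C / \<kappa> * ?g" using \<kappa>(1) by (simp add: field_simps)
    then have "(H1_norm \<Omega> u)\<^sup>2 \<le> (K * C / \<kappa> + 1) * ?g" unfolding H1_norm_sq by (simp add: distrib_right)
    also have "\<dots> \<le> (K * C / \<kappa> + 1) * ((Q.nrm u)\<^sup>2 / \<kappa>)"
      using \<kappa>(1,2) C(1) \<kappa>(4)[OF u] by (intro mult_left_mono) (auto simp: field_simps)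
    also have "\<dots> = D * (Q.nrm u)\<^sup>2" by (simp add: D_def)
    finally have "sqrt ((H1_norm \<Omega> u)\<^sup>2) \<le> sqrt (D * (Q.nrm u)\<^sup>2)" by (rule real_sqrt_le_mono)
    then show ?thesis using H1_norm_nonneg Q.nrm_nonneg[OF u] by (simp add: real_sqrt_mult)
  qed
  then show ?thesis using D by (intro exI[of _ "sqrt D"]) auto
qed

text \<open>The conserved energy is compared with the norms twice: C and 1 / sqrt \<kappa> lead from
  the energy to the norms at time t, and sqrt K bounds the energy by the norms at time 0.\<close>

lemma mean_free_stability:
  "\<exists>C. \<forall>v vt. solution v vt \<longrightarrow> (\<forall>t. mean (v t) = 0) \<longrightarrow>
    (\<forall>t. H1_norm \<Omega> (v t) + L2_norm \<Omega> (vt t) \<le> C * (H1_norm \<Omega> (v 0) + L2_norm \<Omega> (vt 0)))"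
proof -
  obtain \<kappa> K where cmp: "comparison \<kappa> K" using comparison_exists by blast
  note \<kappa> = comparisonD[OF cmp]
  obtain C where C: "0 \<le> C" "\<And>u. u \<in> H1 \<Omega> \<Longrightarrow> mean u = 0 \<Longrightarrow> H1_norm \<Omega> u \<le> C * Q.nrm u"
    using mean_free_Poincare by blast
  have "H1_norm \<Omega> (v t) + L2_norm \<Omega> (vt t) \<le> (C + 1 / sqrt \<kappa>) * sqrt K * (H1_norm \<Omega> (v 0) + L2_norm \<Omega> (vt 0))"
    if sol: "solution v vt" and mean: "\<And>t. mean (v t) = 0" for v vt t
  proof -
    have vs: "v s \<in> H1 \<Omega>" "vt s \<in> sqint M" for s using solutionD(1,2)[OF sol] V_H1 by auto
    define E where "E = sqrt ((A.nrm (vt 0))\<^sup>2 + (Q.nrm (v 0))\<^sup>2)"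
    have E2: "E\<^sup>2 = (A.nrm (vt 0))\<^sup>2 + (Q.nrm (v 0))\<^sup>2" and E0: "0 \<le> E" by (simp_all add: E_def)
    have cons: "(A.nrm (vt t))\<^sup>2 + (Q.nrm (v t))\<^sup>2 = E\<^sup>2" unfolding E2 by (rule energy_conservation[OF sol])
    have "(Q.nrm (v t))\<^sup>2 \<le> E\<^sup>2" "(A.nrm (vt t))\<^sup>2 \<le> E\<^sup>2"
      using cons zero_le_power2[of "A.nrm (vt t)"] zero_le_power2[of "Q.nrm (v t)"] by linarith+
    then have QE: "Q.nrm (v t) \<le> E" and AE: "A.nrm (vt t) \<le> E" using E0 power2_le_imp_le by blast+
    have "H1_norm \<Omega> (v t) \<le> C * E" using C(2)[OF vs(1) mean, of t] mult_left_mono[OF QE C(1)] by linarith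
    moreover have "L2_norm \<Omega> (vt t) \<le> 1 / sqrt \<kappa> * E"
    proof -
      have "sqrt (\<kappa> * (L2_norm \<Omega> (vt t))\<^sup>2) \<le> sqrt ((A.nrm (vt t))\<^sup>2)" using \<kappa>(3)[OF vs(2)] by (intro real_sqrt_le_mono) simp
      then have "sqrt \<kappa> * L2_norm \<Omega> (vt t) \<le> E"
        using AE A.nrm_nonneg[OF vs(2)] L2_norm_nonneg by (simp add: real_sqrt_mult)
      then show ?thesis using \<kappa>(1) by (simp add: field_simps)
    qed
    ultimately have 1: "H1_norm \<Omega> (v t) + L2_norm \<Omega> (vt t) \<le> (C + 1 / sqrt \<kappa>) * E" by (simp add: distrib_right)
    let ?h = "H1_norm \<Omega> (v 0)" and ?l = "L2_norm \<Omega> (vt 0)"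
    have "(A.nrm (vt 0))\<^sup>2 \<le> K * ?l\<^sup>2" using \<kappa>(3)[OF vs(2)] by simp
    moreover have "(Q.nrm (v 0))\<^sup>2 \<le> K * ?h\<^sup>2"
    proof -
      have "K * ((L2_norm \<Omega> (wd_r \<Omega> (v 0)))\<^sup>2 + (L2_norm \<Omega> (wd_x \<Omega> (v 0)))\<^sup>2) \<le> K * ?h\<^sup>2"
        unfolding H1_norm_sq using \<kappa>(2) by (intro mult_left_mono) auto
      then show ?thesis using \<kappa>(4)[OF vs(1), of 0] by linarith
    qed
    ultimately have "E\<^sup>2 \<le> K * (?h\<^sup>2 + ?l\<^sup>2)" unfolding E2 by (simp add: distrib_left)
    also have "\<dots> \<le> K * (?h + ?l)\<^sup>2"
      using \<kappa>(2) H1_norm_nonneg L2_norm_nonneg by (intro mult_left_mono) (simp_all add: power2_sum)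
    finally have "sqrt (E\<^sup>2) \<le> sqrt (K * (?h + ?l)\<^sup>2)" by (rule real_sqrt_le_mono)
    then have "E \<le> sqrt K * (?h + ?l)" using E0 H1_norm_nonneg L2_norm_nonneg by (simp add: real_sqrt_mult)
    then have "(C + 1 / sqrt \<kappa>) * E \<le> (C + 1 / sqrt \<kappa>) * (sqrt K * (?h + ?l))"
      using C(1) \<kappa>(1) by (intro mult_left_mono) auto
    with 1 show ?thesis by (simp only: mult.assoc)
  qed
  then show ?thesis by blast
qed

section \<open>Existence and uniqueness of the splitting\<close>

lemma splitting_exists:
  assumes u: "solution u ut"
  obtains c0 c1 v vt where "solution v vt" "mean_free_splitting P \<Omega> u c0 c1 v vt" "\<And>t. mean (v t) = 0"
    "\<And>t. average_A P \<Omega> (u t) = c0 + c1 * of_real t"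
    "\<And>t p. u t p = c0 + c1 * of_real t + v t p"
proof -
  define c0 c1 where "c0 = average_A P \<Omega> (u 0)" and "c1 = average_A P \<Omega> (ut 0)"
  define v vt where "v t p = u t p - (c0 + c1 * of_real t)" and "vt t p = ut t p - c1" for t :: real and p
  have us: "u t \<in> sqint M" "ut t \<in> sqint M" for t using solutionD(1,2)[OF u] V_sqint by auto
  have sol: "solution v vt" unfolding v_def vt_def by (rule solution_diff[OF u affine_solution])
  have m: "mass \<noteq> 0" using mass_pos by simp
  have avg: "mean (u t) = (c0 + c1 * of_real t) * of_real mass" for t
    unfolding mean_affine[OF u, of t] c0_def c1_def average_A_eq using m by (simp add: field_simps)
  have mv: "mean (v t) = 0" for t
    unfolding v_def A.diff_left[OF us(1) const_sqint const_sqint] mean_const avg by simp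
  have mvt: "mean (vt t) = 0" for t
    unfolding vt_def A.diff_left[OF us(2) const_sqint const_sqint] mean_const mean_velocity[OF u, of t]
    using m by (simp add: c1_def average_A_eq)
  have eq: "u t p = c0 + c1 * of_real t + v t p" for t p by (simp add: v_def)
  show ?thesis
  proof (rule that[OF sol _ mv _ eq])
    show "mean_free_splitting P \<Omega> u c0 c1 v vt"
      unfolding mean_free_splitting_def
      using solution_energy_class[OF sol] mv mvt by (simp add: ae_eq_def eq average_A_eq)
    show "average_A P \<Omega> (u t) = c0 + c1 * of_real t" for t
      unfolding average_A_eq avg using m by simp
  qed
qed

text \<open>The affine part of any splitting is the A-average of u, a quantity that does not mention
  the splitting; evaluation at t = 0 and t = 1 then fixes both constants.\<close>

lemma splitting_average:
  assumes s: "mean_free_splitting P \<Omega> u c0 c1 v vt" and u: "u t \<in> sqint M"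
  shows "average_A P \<Omega> (u t) = c0 + c1 * of_real t"
proof -
  have v: "v t \<in> sqint M" using s H1_sqint unfolding mean_free_splitting_def energy_class_def by blast
  have m: "mass \<noteq> 0" using mass_pos by simp
  have "mean (v t) = 0" using s m unfolding mean_free_splitting_def average_A_eq by simp
  moreover have "mean (u t) = mean (\<lambda>p. (c0 + c1 * of_real t) + v t p)"
    using s unfolding mean_free_splitting_def ae_eq_def
    by (intro mean_cong u A.add_mem[OF const_sqint v]) blast
  ultimately have "mean (u t) = (c0 + c1 * of_real t) * of_real mass"
    by (simp add: A.add_left[OF const_sqint v const_sqint] mean_const)
  then show ?thesis using m by (simp add: average_A_eq)
qed

lemma splitting_unique:
  assumes u: "\<And>t. u t \<in> sqint M"
    and s: "mean_free_splitting P \<Omega> u c0 c1 v vt" and s': "mean_free_splitting P \<Omega> u c0' c1' v' vt'"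
  shows "c0' = c0" "c1' = c1" "ae_eq \<Omega> (v' t) (v t)" "ae_eq \<Omega> (vt' t) (vt t)"
proof -
  have eq: "c0' + c1' * of_real t = c0 + c1 * of_real t" for t
    using splitting_average[OF s u] splitting_average[OF s' u] by metis
  show c0: "c0' = c0" using eq[of 0] by simp
  show c1: "c1' = c1" using eq[of 1] c0 by simp
  have vv: "AE p in M. v' t p = v t p" for t
  proof -
    have "AE p in M. u t p = c0 + c1 * of_real t + v t p" "AE p in M. u t p = c0 + c1 * of_real t + v' t p"
      using s s' unfolding mean_free_splitting_def ae_eq_def c0 c1 by blast+
    then show ?thesis by eventually_elim simp
  qed
  then show "ae_eq \<Omega> (v' t) (v t)" by (simp add: ae_eq_def)
  have e: "energy_class \<Omega> v vt" and e': "energy_class \<Omega> v' vt'"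
    using s s' unfolding mean_free_splitting_def by blast+
  have mem: "v t \<in> sqint M" "vt t \<in> sqint M" "v' t \<in> sqint M" "vt' t \<in> sqint M" for t
    using e e' H1_sqint unfolding energy_class_def L2_eq by blast+
  let ?D = "\<lambda>s p. (v s p - v t p) / of_real (s - t) - vt t p" and ?D' = "\<lambda>s p. (v' s p - v' t p) / of_real (s - t) - vt' t p"
  \<comment> \<open>The identity for u determines only v. The velocity is recovered as the limit of
    difference quotients, which agree almost everywhere for v and v', so vt' - vt is a difference of
    two vanishing errors.\<close>
  have lim: "((\<lambda>s. L2_norm \<Omega> (?D s) + L2_norm \<Omega> (?D' s)) \<longlongrightarrow> 0) (at t)"
    using e e' unfolding energy_class_def by (intro tendsto_add_zero) blast+
  have "L2_norm \<Omega> (\<lambda>p. vt' t p - vt t p) \<le> L2_norm \<Omega> (?D s) + L2_norm \<Omega> (?D' s)" for s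
  proof -
    have "AE p in M. vt' t p - vt t p = ?D s p - ?D' s p" using vv[of s] vv[of t] by eventually_elim simp
    then have "L2_norm \<Omega> (\<lambda>p. vt' t p - vt t p) = L2_norm \<Omega> (\<lambda>p. ?D s p - ?D' s p)"
      by (rule L2_norm_cong[OF sqint_diff[OF mem(4,2)] sqint_diff[OF quotient_mem(2)[OF mem(1,1,2)] quotient_mem(2)[OF mem(3,3,4)]]])
    also have "\<dots> \<le> L2_norm \<Omega> (?D s) + L2_norm \<Omega> (?D' s)"
      unfolding L2_norm_eq by (rule l2.nrm_diff_le[OF quotient_mem(2)[OF mem(1,1,2)] quotient_mem(2)[OF mem(3,3,4)]])
    finally show ?thesis .
  qed
  then have "L2_norm \<Omega> (\<lambda>p. vt' t p - vt t p) \<le> 0"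
    by (intro tendsto_le[OF _ lim tendsto_const]) auto
  then have "L2_norm \<Omega> (\<lambda>p. vt' t p - vt t p) = 0" using L2_norm_nonneg by (meson antisym)
  then have "AE p in M. vt' t p - vt t p = 0" using L2_norm_zero_iff[OF sqint_diff[OF mem(4,2)]] by simp
  then show "ae_eq \<Omega> (vt' t) (vt t)" unfolding ae_eq_def by eventually_elim simp
qed

lemma real_average:
  assumes u: "u \<in> sqint M" and re: "AE p in M. u p \<in> \<real>"
  shows "average_A P \<Omega> u \<in> \<real>"
proof -
  note [measurable] = sqint_measurable[OF u] weight_measurable[OF weights(3)]
  have "mean u = (LINT p|M. of_real (A_weight P p * Re (u p)))"
    unfolding inner_A_def
    by (rule integral_cong_AE) (use re in \<open>auto elim!: eventually_mono simp: complex_is_Real_iff complex_eq_iff\<close>)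
  also have "\<dots> = of_real (LINT p|M. A_weight P p * Re (u p))" by (rule integral_complex_of_real)
  finally show ?thesis unfolding average_A_eq by simp
qed

theorem stable_splitting:
  "\<exists>C. \<forall>u ut. axisymmetric_solution P \<Omega> V u ut \<longrightarrow>
       (\<exists>c0 c1 v vt.
          mean_free_splitting P \<Omega> u c0 c1 v vt \<and>
          ((\<forall>t. AE p in lebesgue_on \<Omega>. u t p \<in> \<real>) \<longrightarrow> c0 \<in> \<real> \<and> c1 \<in> \<real>) \<and>
          bdd_above (range (\<lambda>t. H1_norm \<Omega> (v t) + L2_norm \<Omega> (vt t))) \<and>
          (SUP t. H1_norm \<Omega> (v t) + L2_norm \<Omega> (vt t)) \<le> C * (H1_norm \<Omega> (v 0) + L2_norm \<Omega> (vt 0)) \<and>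
          (\<forall>c0' c1' v' vt'. mean_free_splitting P \<Omega> u c0' c1' v' vt' \<longrightarrow>
             c0' = c0 \<and> c1' = c1 \<and> (\<forall>t. ae_eq \<Omega> (v' t) (v t) \<and> ae_eq \<Omega> (vt' t) (vt t))))"
proof -
  obtain C where C: "\<And>v vt t. solution v vt \<Longrightarrow> (\<forall>t. mean (v t) = 0) \<Longrightarrow>
      H1_norm \<Omega> (v t) + L2_norm \<Omega> (vt t) \<le> C * (H1_norm \<Omega> (v 0) + L2_norm \<Omega> (vt 0))"
    using mean_free_stability by blast
  show ?thesis
  proof (rule exI[of _ C], intro allI impI)
    fix u ut assume "axisymmetric_solution P \<Omega> V u ut"
    then have sol: "solution u ut" by (simp add: solution_def)
    have us: "u t \<in> sqint M" for t using solutionD(1)[OF sol] V_sqint by auto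
    obtain c0 c1 v vt where v: "solution v vt" and s: "mean_free_splitting P \<Omega> u c0 c1 v vt"
      and mean: "\<And>t. mean (v t) = 0" and avg: "\<And>t. average_A P \<Omega> (u t) = c0 + c1 * of_real t"
      by (rule splitting_exists[OF sol]) blast
    have bound: "H1_norm \<Omega> (v t) + L2_norm \<Omega> (vt t) \<le> C * (H1_norm \<Omega> (v 0) + L2_norm \<Omega> (vt 0))" for t
      using C[OF v] mean by blast
    have real: "c0 \<in> \<real> \<and> c1 \<in> \<real>" if re: "\<forall>t. AE p in M. u t p \<in> \<real>"
    proof -
      have "c0 + c1 * of_real t \<in> \<real>" for t unfolding avg[symmetric] using real_average[OF us] re by blast
      \<comment> \<open>An affine function that is real at t = 0 and t = 1 has real
        coefficients.\<close>
      from this[of 0] this[of 1] have "c0 \<in> \<real>" "c0 + c1 \<in> \<real>" by simp_all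
      then have "(c0 + c1) - c0 \<in> \<real>" by (intro Reals_diff)
      then show ?thesis using \<open>c0 \<in> \<real>\<close> by simp
    qed
    have "(SUP t. H1_norm \<Omega> (v t) + L2_norm \<Omega> (vt t)) \<le> C * (H1_norm \<Omega> (v 0) + L2_norm \<Omega> (vt 0))"
      by (rule cSUP_least) (use bound in auto)
    moreover have "bdd_above (range (\<lambda>t. H1_norm \<Omega> (v t) + L2_norm \<Omega> (vt t)))"
      by (rule bdd_aboveI2[OF bound])
    moreover note unique = splitting_unique[OF us s]
    ultimately show "\<exists>c0 c1 v vt.
          mean_free_splitting P \<Omega> u c0 c1 v vt \<and>
          ((\<forall>t. AE p in lebesgue_on \<Omega>. u t p \<in> \<real>) \<longrightarrow> c0 \<in> \<real> \<and> c1 \<in> \<real>) \<and>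
          bdd_above (range (\<lambda>t. H1_norm \<Omega> (v t) + L2_norm \<Omega> (vt t))) \<and>
          (SUP t. H1_norm \<Omega> (v t) + L2_norm \<Omega> (vt t)) \<le> C * (H1_norm \<Omega> (v 0) + L2_norm \<Omega> (vt 0)) \<and>
          (\<forall>c0' c1' v' vt'. mean_free_splitting P \<Omega> u c0' c1' v' vt' \<longrightarrow>
             c0' = c0 \<and> c1' = c1 \<and> (\<forall>t. ae_eq \<Omega> (v' t) (v t) \<and> ae_eq \<Omega> (vt' t) (vt t)))"
      using s real
      by (intro exI[of _ c0] exI[of _ c1] exI[of _ v] exI[of _ vt] conjI allI) (blast intro: unique)+
  qed
qed

section \<open>Generalized zero modes and growing modes\<close>

lemma A_sum_left:
  fixes n :: nat
  assumes f: "\<And>j. j \<le> n \<Longrightarrow> f j \<in> sqint M" and w: "w \<in> sqint M"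
  shows "(\<lambda>p. \<Sum>j\<le>n. c j * f j p) \<in> sqint M \<and> ipA (\<lambda>p. \<Sum>j\<le>n. c j * f j p) w = (\<Sum>j\<le>n. c j * ipA (f j) w)"
  using f
proof (induction n)
  case 0
  then show ?case using A.scale_mem A.scale_left[OF _ w] by simp
next
  case (Suc n)
  then have IH: "(\<lambda>p. \<Sum>j\<le>n. c j * f j p) \<in> sqint M"
      "ipA (\<lambda>p. \<Sum>j\<le>n. c j * f j p) w = (\<Sum>j\<le>n. c j * ipA (f j) w)" and fn: "f (Suc n) \<in> sqint M" by simp_all
  note cf = A.scale_mem[OF fn, of "c (Suc n)"]
  show ?case
    using A.add_mem[OF IH(1) cf] A.add_left[OF IH(1) cf w] A.scale_left[OF fn w, of "c (Suc n)"] IH(2) by simp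
qed

text \<open>A nonzero coefficient of positive degree would make the polynomial exceed B outside some
  disc, by \<open>polyfun_extremal\<close>.\<close>

lemma bounded_polynomial_constant:
  fixes b :: "nat \<Rightarrow> complex"
  assumes "\<And>t :: real. cmod (\<Sum>j\<le>N. of_real t ^ j * b j) \<le> B"
  shows "(\<Sum>j\<le>N. of_real t ^ j * b j) = b 0"
proof -
  have z: "b k = 0" if k: "k \<noteq> 0" "k \<le> N" for k
  proof (rule ccontr)
    assume "b k \<noteq> 0"
    then have "\<exists>k. k \<noteq> 0 \<and> k \<le> N \<and> b k \<noteq> 0" using k by blast
    from polyfun_extremal[OF this, of "B + 1"]
    obtain r where r: "\<And>z. r \<le> cmod z \<Longrightarrow> B + 1 \<le> cmod (\<Sum>i\<le>N. b i * z ^ i)"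
      unfolding eventually_at_infinity by blast
    \<comment> \<open>The point |r| is real with modulus at least r, so growth at complex infinity
      is seen on the real axis.\<close>
    have "B + 1 \<le> cmod (\<Sum>i\<le>N. b i * of_real \<bar>r\<bar> ^ i)" by (rule r) simp
    then show False using assms[of "\<bar>r\<bar>"] by (simp add: mult.commute)
  qed
  have "(\<Sum>j\<le>N. of_real t ^ j * b j) = (\<Sum>j\<in>{0}. of_real t ^ j * b j)"
    by (rule sum.mono_neutral_right) (use z in auto)
  then show ?thesis by simp
qed

lemma constant_L0: "((\<lambda>_. c), (\<lambda>_. 0)) \<in> L0 P \<Omega> V"
proof -
  have "(\<lambda>_. c) \<in> operator_kernel (L0 P \<Omega> V)" unfolding kernel_L0 by (auto simp: ae_eq_def)
  then show ?thesis by (simp add: operator_kernel_def)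
qed

text \<open>Constant pairings make the velocity weakly zero at all times. The weak equation then
  makes \<open>q0\<close> vanish on v, and the mean-free Poincare inequality leaves only
  zero.\<close>

lemma stationary_mean_free_zero:
  assumes v: "solution v vt" and mean: "mean (v t) = 0"
    and const: "\<And>w s. w \<in> sqint M \<Longrightarrow> ipA (v s) w = ipA (v 0) w"
  shows "AE p in M. v t p = 0"
proof -
  have vV: "v s \<in> V" for s by (rule solutionD(1)[OF v])
  have vt0: "ipA (vt s) w = 0" if w: "w \<in> sqint M" for s w
  proof -
    have e: "(\<lambda>s. ipA (v s) w) = (\<lambda>s. ipA (v 0) w)" by (rule ext) (rule const[OF w])
    have "((\<lambda>s. ipA (v 0) w) has_vector_derivative ipA (vt s) w) (at s)"
      using strong_derivative[OF v w, of s] unfolding e .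
    then show ?thesis using vector_derivative_unique_at has_vector_derivative_const by blast
  qed
  have "((\<lambda>s. 0) has_vector_derivative - frm (v t) (v t)) (at t)"
    using solutionD(6)[OF v vV, of t t] unfolding vt0[OF V_sqint[OF vV]] .
  then have "- frm (v t) (v t) = 0" using vector_derivative_unique_at has_vector_derivative_const by blast
  then have Q0: "Q.nrm (v t) = 0" by (simp add: Q.nrm_def)
  obtain C where "\<And>u. u \<in> H1 \<Omega> \<Longrightarrow> mean u = 0 \<Longrightarrow> H1_norm \<Omega> u \<le> C * Q.nrm u"
    using mean_free_Poincare by blast
  from this[OF V_H1[OF vV] mean] have "H1_norm \<Omega> (v t) \<le> 0" using Q0 by simp
  then have "L2_norm \<Omega> (v t) = 0"
    using L2_norm_le_H1_norm[of "v t"] L2_norm_nonneg[of "v t"] by linarith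
  then show ?thesis using L2_norm_zero_iff[OF V_sqint[OF vV]] by simp
qed

lemma mean_free_bounded:
  assumes v: "solution v vt" and mean: "\<And>t. mean (v t) = 0"
  shows "\<exists>B. \<forall>t. L2_norm \<Omega> (v t) \<le> B \<and> A.nrm (v t) \<le> B"
proof -
  obtain C where C: "\<And>v vt t. solution v vt \<Longrightarrow> (\<forall>t. mean (v t) = 0) \<Longrightarrow>
      H1_norm \<Omega> (v t) + L2_norm \<Omega> (vt t) \<le> C * (H1_norm \<Omega> (v 0) + L2_norm \<Omega> (vt 0))"
    using mean_free_stability by blast
  define B where "B = C * (H1_norm \<Omega> (v 0) + L2_norm \<Omega> (vt 0))"
  have B: "L2_norm \<Omega> (v t) \<le> B" for t
  proof -
    have "H1_norm \<Omega> (v t) + L2_norm \<Omega> (vt t) \<le> B" unfolding B_def by (rule C[OF v]) (simp add: mean)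
    then show ?thesis using L2_norm_le_H1_norm[of "v t"] L2_norm_nonneg[of "vt t"] by linarith
  qed
  obtain \<kappa> K where cmp: "comparison \<kappa> K" using comparison_exists by blast
  note \<kappa>_pos = comparisonD(1)[OF cmp] and K = comparisonD(2)[OF cmp] and \<kappa> = comparisonD(3)[OF cmp]
  have "A.nrm (v t) \<le> sqrt K * B" for t
  proof -
    have vs: "v t \<in> sqint M" using solutionD(1)[OF v] V_sqint by blast
    have "sqrt ((A.nrm (v t))\<^sup>2) \<le> sqrt (K * (L2_norm \<Omega> (v t))\<^sup>2)" using \<kappa>[OF vs] by (intro real_sqrt_le_mono) simp
    then have "A.nrm (v t) \<le> sqrt K * L2_norm \<Omega> (v t)"
      using A.nrm_nonneg[OF vs] L2_norm_nonneg by (simp add: real_sqrt_mult)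
    also have "\<dots> \<le> sqrt K * B" using B K by (intro mult_left_mono) auto
    finally show ?thesis .
  qed
  then show ?thesis using B by (intro exI[of _ "max B (sqrt K * B)"]) (simp add: le_max_iff_disj)
qed

text \<open>For the substantial inclusion the mean-free part is paired with a fixed w. The pairing
  is a bounded scalar polynomial in t, so no coefficient argument in the function space is
  needed.\<close>

theorem generalized_zero_modes:
  "{u. generalized_zero_mode P \<Omega> V u} = {u. \<exists>c0 c1. \<forall>t. ae_eq \<Omega> (u t) (\<lambda>_. c0 + c1 * of_real t)}"
proof (intro equalityI subsetI; clarify)
  fix u assume "generalized_zero_mode P \<Omega> V u"
  then obtain ut N \<psi> where sol: "solution u ut" and \<psi>: "\<And>j. j \<le> N \<Longrightarrow> \<psi> j \<in> Domain (L0 P \<Omega> V)"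
    and ae: "\<And>t. AE p in M. u t p = (\<Sum>j\<le>N. of_real t ^ j * \<psi> j p)"
    unfolding generalized_zero_mode_def solution_def ae_eq_def by blast
  obtain c0 c1 v vt where v: "solution v vt" and mean: "\<And>t. mean (v t) = 0"
    and split: "\<And>t p. u t p = c0 + c1 * of_real t + v t p"
    by (rule splitting_exists[OF sol]) blast
  have vs: "v t \<in> sqint M" for t using solutionD(1)[OF v] V_sqint by blast
  obtain B where B: "\<And>t. A.nrm (v t) \<le> B" using mean_free_bounded[OF v mean] by blast
  \<comment> \<open>Coefficients of the affine part. The sums below run to \<open>Suc N\<close>, so
    that c1 t has a slot even when N = 0; the missing \<psi> is padded with 0.\<close>
  define k where "k j = (if j = 0 then c0 else if j = 1 then c1 else 0)" for j :: nat
  define \<phi> where "\<phi> j p = (if j \<le> N then \<psi> j p else 0) - k j" for j p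
  have \<phi>: "\<phi> j \<in> sqint M" for j
  proof (cases "j \<le> N")
    case True
    then have "\<psi> j \<in> sqint M" using \<psi>[OF True] V_sqint by (auto simp: L0_iff)
    from sqint_diff[OF this const_sqint[of "k j"]] show ?thesis using True by (simp add: \<phi>_def[abs_def])
  next
    case False
    then show ?thesis using const_sqint[of "- k j"] by (simp add: \<phi>_def[abs_def])
  qed
  have v_poly: "AE p in M. v t p = (\<Sum>j\<le>Suc N. of_real t ^ j * \<phi> j p)" for t
    using ae[of t]
  proof eventually_elim
    fix p assume u: "u t p = (\<Sum>j\<le>N. of_real t ^ j * \<psi> j p)"
    have "(\<Sum>j\<le>Suc N. of_real t ^ j * k j) = (\<Sum>j\<in>{0, 1}. of_real t ^ j * k j)"
      by (rule sum.mono_neutral_right) (auto simp: k_def)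
    then have 1: "(\<Sum>j\<le>Suc N. of_real t ^ j * k j) = c0 + c1 * of_real t" by (simp add: k_def mult.commute)
    have 2: "(\<Sum>j\<le>Suc N. of_real t ^ j * (if j \<le> N then \<psi> j p else 0)) = (\<Sum>j\<le>N. of_real t ^ j * \<psi> j p)"
      by simp
    have "(\<Sum>j\<le>Suc N. of_real t ^ j * \<phi> j p)
        = (\<Sum>j\<le>Suc N. of_real t ^ j * (if j \<le> N then \<psi> j p else 0)) - (\<Sum>j\<le>Suc N. of_real t ^ j * k j)"
      unfolding \<phi>_def right_diff_distrib by (rule sum_subtractf)
    then show "v t p = (\<Sum>j\<le>Suc N. of_real t ^ j * \<phi> j p)" unfolding 1 2 u[symmetric] using split[of t p] by simp
  qed
  have const: "ipA (v s) w = ipA (v 0) w" if w: "w \<in> sqint M" for w s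
  proof -
    have poly: "ipA (v t) w = (\<Sum>j\<le>Suc N. of_real t ^ j * ipA (\<phi> j) w)" for t :: real
    proof -
      note sum = A_sum_left[of "Suc N" \<phi> w "\<lambda>j. of_real t ^ j", OF \<phi> w]
      have "ipA (v t) w = ipA (\<lambda>p. \<Sum>j\<le>Suc N. of_real t ^ j * \<phi> j p) w"
        unfolding inner_A_eq using v_poly[of t]
        by (intro weighted_inner_cong vs sum[THEN conjunct1] w weight_measurable weights) simp_all
      then show ?thesis using sum by simp
    qed
    \<comment> \<open>Cauchy-Schwarz carries the uniform bound on v over to the scalar
      polynomial.\<close>
    have "cmod (\<Sum>j\<le>Suc N. of_real t ^ j * ipA (\<phi> j) w) \<le> B * A.nrm w" for t :: real
      unfolding poly[symmetric]
      using A.Cauchy_Schwarz[OF vs w, of t] mult_right_mono[OF B A.nrm_nonneg[OF w], of t] by linarith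
    note c = bounded_polynomial_constant[OF this]
    show ?thesis by (simp only: poly c)
  qed
  have "AE p in M. v t p = 0" for t by (rule stationary_mean_free_zero[OF v mean const])
  then have "ae_eq \<Omega> (u t) (\<lambda>_. c0 + c1 * of_real t)" for t
    unfolding ae_eq_def split by simp
  then show "\<exists>c0 c1. \<forall>t. ae_eq \<Omega> (u t) (\<lambda>_. c0 + c1 * of_real t)" by blast
next
  fix u c0 c1 assume ae: "\<forall>t. ae_eq \<Omega> (u t) (\<lambda>_. c0 + c1 * of_real t)"
  have "AE p in M. c0 + c1 * of_real t = u t p" for t
    using ae[rule_format, of t] unfolding ae_eq_def by eventually_elim simp
  then have sol: "solution u (\<lambda>t p. c1)" by (rule solution_cong[OF affine_solution])
  have poly: "ae_eq \<Omega> (u t) (\<lambda>p. \<Sum>j\<le>1. of_real t ^ j * (if j = 0 then c0 else c1))" for t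
    using ae by (simp add: mult.commute)
  have L: "(\<lambda>p. if j = 0 then c0 else c1) \<in> Domain (L0 P \<Omega> V)" for j :: nat
    using constant_L0[of "if j = 0 then c0 else c1"] by (rule DomainI)
  show "generalized_zero_mode P \<Omega> V u"
    unfolding generalized_zero_mode_def
  proof (intro conjI)
    show "\<exists>ut. axisymmetric_solution P \<Omega> V u ut" using sol unfolding solution_def by blast
    show "\<exists>N \<psi>. (\<forall>j\<le>N. \<psi> j \<in> Domain (L0 P \<Omega> V)) \<and> (\<forall>t. ae_eq \<Omega> (u t) (\<lambda>p. \<Sum>j\<le>N. of_real t ^ j * \<psi> j p))"
      by (rule exI[of _ 1], rule exI[of _ "\<lambda>j p. if j = 0 then c0 else c1"]) (intro conjI allI impI L poly)
  qed
qed

lemma exponential_linear_bound: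
  fixes b N \<alpha> \<beta> :: real
  assumes b: "0 < b" and N: "0 \<le> N" and bound: "\<And>t. 0 \<le> t \<Longrightarrow> exp (b * t) * N \<le> \<alpha> + \<beta> * t"
  shows "N = 0"
proof (rule ccontr)
  assume "N \<noteq> 0"
  with N have N: "0 < N" by simp
  \<comment> \<open>The quadratic Taylor term of the exponential already gives exp (b t) N at least
    c t^2, enough to beat an affine function.\<close>
  define c where "c = N * b\<^sup>2 / 2"
  have c: "0 < c" using N b by (simp add: c_def)
  \<comment> \<open>c t exceeds |\<alpha>| + |\<beta>| by exactly c. The summand 1 ensures t is at
    least 1, which lets \<alpha> be absorbed into |\<alpha>| t.\<close>
  define t where "t = 1 + (\<bar>\<alpha>\<bar> + \<bar>\<beta>\<bar>) / c"
  have t: "1 \<le> t" using c by (simp add: t_def)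
  have "1 + b * t + (b * t)\<^sup>2 / 2 \<le> exp (b * t)" by (rule exp_lower_Taylor_quadratic) (use b t in simp)
  moreover have "0 \<le> b * t" using b t by simp
  ultimately have "(b * t)\<^sup>2 / 2 \<le> exp (b * t)" by linarith
  then have "(b * t)\<^sup>2 / 2 * N \<le> exp (b * t) * N" using N by (intro mult_right_mono) auto
  also have "\<dots> \<le> \<alpha> + \<beta> * t" using bound t by simp
  also have "\<dots> \<le> \<bar>\<alpha>\<bar> * t + \<bar>\<beta>\<bar> * t"
  proof -
    have "\<bar>\<alpha>\<bar> \<le> \<bar>\<alpha>\<bar> * t" using mult_left_mono[OF t, of "\<bar>\<alpha>\<bar>"] by simp
    moreover have "\<beta> * t \<le> \<bar>\<beta>\<bar> * t" using t by (intro mult_right_mono) auto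
    ultimately show ?thesis by linarith
  qed
  finally have "(c * t) * t \<le> (\<bar>\<alpha>\<bar> + \<bar>\<beta>\<bar>) * t" by (simp add: c_def power2_eq_square algebra_simps)
  then have "c * t \<le> \<bar>\<alpha>\<bar> + \<bar>\<beta>\<bar>" using t by simp
  moreover have "c * t = c + (\<bar>\<alpha>\<bar> + \<bar>\<beta>\<bar>)" using c unfolding t_def by (simp add: field_simps)
  ultimately show False using c by simp
qed

text \<open>Both readings of a mode are covered. A separated solution grows like exp (Im \<sigma>
  t), which the sum of an affine and a bounded part cannot match; an eigenfunction is excluded by
  the sign of the form.\<close>

theorem no_growing_modes:
  assumes \<sigma>: "0 < Im \<sigma>" and mode: "separated_mode P \<Omega> V \<sigma> \<psi> \<or> (\<psi>, (\<lambda>p. \<sigma>\<^sup>2 * \<psi> p)) \<in> L0 P \<Omega> V"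
  shows "ae_eq \<Omega> \<psi> (\<lambda>_. 0)"
  using mode
proof
  let ?u = "\<lambda>t p. exp (- \<i> * \<sigma> * of_real t) * \<psi> p"
  assume "separated_mode P \<Omega> V \<sigma> \<psi>"
  then obtain ut where sol: "solution ?u ut" unfolding separated_mode_def solution_def by blast
  have \<psi>: "\<psi> \<in> sqint M" using V_sqint[OF solutionD(1)[OF sol, of 0]] by simp
  obtain c0 c1 v vt where v: "solution v vt" and mean: "\<And>t. mean (v t) = 0"
    and split: "\<And>t p. ?u t p = c0 + c1 * of_real t + v t p"
    by (rule splitting_exists[OF sol]) blast
  have vs: "v t \<in> sqint M" for t using solutionD(1)[OF v] V_sqint by blast
  obtain B where B: "\<And>t. L2_norm \<Omega> (v t) \<le> B" using mean_free_bounded[OF v mean] by blast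
  let ?n = "L2_norm \<Omega> (\<lambda>_. 1)"
  have "exp (Im \<sigma> * t) * L2_norm \<Omega> \<psi> \<le> (cmod c0 * ?n + B) + (cmod c1 * ?n) * t" if t: "0 \<le> t" for t
  proof -
    have "exp (Im \<sigma> * t) * L2_norm \<Omega> \<psi> = L2_norm \<Omega> (?u t)"
      using l2.nrm_scale[OF \<psi>, of "exp (- \<i> * \<sigma> * of_real t)"] by (simp add: L2_norm_eq)
    also have "\<dots> = L2_norm \<Omega> (\<lambda>p. (c0 + c1 * of_real t) + v t p)" by (simp only: split)
    also have "\<dots> \<le> L2_norm \<Omega> (\<lambda>p. c0 + c1 * of_real t) + L2_norm \<Omega> (v t)"
      unfolding L2_norm_eq by (rule l2.nrm_add_le[OF const_sqint vs])
    also have "L2_norm \<Omega> (\<lambda>p. c0 + c1 * of_real t) = cmod (c0 + c1 * of_real t) * ?n"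
      using l2.nrm_scale[OF const_sqint[of 1], of "c0 + c1 * of_real t"] by (simp add: L2_norm_eq)
    also have "\<dots> \<le> (cmod c0 + cmod c1 * t) * ?n"
      using norm_triangle_ineq[of c0 "c1 * of_real t"] t by (intro mult_right_mono L2_norm_nonneg) (simp add: norm_mult)
    finally show ?thesis using B[of t] by (simp add: algebra_simps)
  qed
  from exponential_linear_bound[OF \<sigma> L2_norm_nonneg this] have "L2_norm \<Omega> \<psi> = 0" .
  then show ?thesis using L2_norm_zero_iff[OF \<psi>] by (simp add: ae_eq_def)
next
  assume L: "(\<psi>, (\<lambda>p. \<sigma>\<^sup>2 * \<psi> p)) \<in> L0 P \<Omega> V"
  then have \<psi>V: "\<psi> \<in> V" by (simp add: L0_iff)
  note \<psi> = V_sqint[OF \<psi>V] and \<psi>H = V_H1[OF \<psi>V]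
  have "frm \<psi> \<psi> = \<sigma>\<^sup>2 * ipA \<psi> \<psi>" using L \<psi>V A.scale_left[OF \<psi> \<psi>] by (simp add: L0_iff)
  then have eq: "of_real ((Q.nrm \<psi>)\<^sup>2) = \<sigma>\<^sup>2 * of_real ((A.nrm \<psi>)\<^sup>2)"
    by (simp only: A.diag_eq[OF \<psi>] Q.diag_eq[OF \<psi>H])
  have "A.nrm \<psi> = 0"
  proof (rule ccontr)
    assume "A.nrm \<psi> \<noteq> 0"
    then have pos: "0 < (A.nrm \<psi>)\<^sup>2" by simp
    \<comment> \<open>Both quadratic forms are real, so the square of \<sigma> is real. With Im
      \<sigma> > 0 this puts \<sigma> on the imaginary axis, where its square is negative.\<close>
    have "Im (\<sigma>\<^sup>2 * of_real ((A.nrm \<psi>)\<^sup>2)) = 0" unfolding eq[symmetric] by (rule Im_complex_of_real)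
    then have "Im (\<sigma>\<^sup>2) = 0" using pos by (simp only: times_complex.sel Im_complex_of_real Re_complex_of_real mult_zero_right add_0_left mult_eq_0_iff) simp
    then have re: "Re \<sigma> = 0" using \<sigma> by (simp add: power2_eq_square)
    have "(Q.nrm \<psi>)\<^sup>2 = Re (\<sigma>\<^sup>2 * of_real ((A.nrm \<psi>)\<^sup>2))" unfolding eq[symmetric] by simp
    also have "\<dots> = - ((Im \<sigma>)\<^sup>2 * (A.nrm \<psi>)\<^sup>2)" using re by (simp add: power2_eq_square)
    also have "\<dots> < 0" using \<sigma> pos by simp
    finally show False by simp
  qed
  then show ?thesis using A_nrm_zero[OF \<psi>] by (simp add: ae_eq_def)
qed

end

theorem theorem1p6:
  fixes P :: carter and \<Omega> :: "(real \<times> real) set" and V :: "scalar_field set"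
  assumes "regular_timelike_slab P \<Omega>"
    and "reflecting_form_domain \<Omega> V"
  shows
    "(selfadjoint_A P \<Omega> (L0 P \<Omega> V) \<and> nonnegative_A P \<Omega> (L0 P \<Omega> V) \<and>
     operator_kernel (L0 P \<Omega> V) = {u. \<exists>c. ae_eq \<Omega> u (\<lambda>_. c)} \<and>
     \<not> ae_eq \<Omega> (\<lambda>_. 1) (\<lambda>_. 0)) \<and>
     ({u. generalized_zero_mode P \<Omega> V u} =
     {u. \<exists>c0 c1. \<forall>t. ae_eq \<Omega> (u t) (\<lambda>_. c0 + c1 * of_real t)}) \<and>
     (\<exists>C. \<forall>u ut. axisymmetric_solution P \<Omega> V u ut \<longrightarrow>
       (\<exists>c0 c1 v vt.
          mean_free_splitting P \<Omega> u c0 c1 v vt \<and>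
          ((\<forall>t. AE p in lebesgue_on \<Omega>. u t p \<in> \<real>) \<longrightarrow> c0 \<in> \<real> \<and> c1 \<in> \<real>) \<and>
          bdd_above (range (\<lambda>t. H1_norm \<Omega> (v t) + L2_norm \<Omega> (vt t))) \<and>
          (SUP t. H1_norm \<Omega> (v t) + L2_norm \<Omega> (vt t)) \<le> C * (H1_norm \<Omega> (v 0) + L2_norm \<Omega> (vt 0)) \<and>
          (\<forall>c0' c1' v' vt'. mean_free_splitting P \<Omega> u c0' c1' v' vt' \<longrightarrow>
             c0' = c0 \<and> c1' = c1 \<and> (\<forall>t. ae_eq \<Omega> (v' t) (v t) \<and> ae_eq \<Omega> (vt' t) (vt t))))) \<and>
     (\<forall>\<sigma> \<psi>. Im \<sigma> > 0 \<and> (separated_mode P \<Omega> V \<sigma> \<psi> \<or> (\<psi>, (\<lambda>p. \<sigma>\<^sup>2 * \<psi> p)) \<in> L0 P \<Omega> V) \<longrightarrow>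
       ae_eq \<Omega> \<psi> (\<lambda>_. 0))"
proof -
  obtain r0 r1 x0 x1 where slab: "r0 < r1" "x0 < x1" "\<Omega> = {r0..r1} \<times> {x0..x1}"
    using assms(1) unfolding regular_timelike_slab_def by blast
  have positive: "rho2 P p > 0 \<and> Delta_r P (fst p) > 0 \<and> Delta_x P (snd p) > 0 \<and> A_weight P p > 0"
    if "p \<in> \<Omega>" for p
    using assms(1) that unfolding regular_timelike_slab_def by blast
  interpret carter_slab r0 r1 x0 x1 \<Omega> P V
    by unfold_locales (fact slab positive assms(2))+
  show ?thesis
    by (intro conjI selfadjoint_L0 nonnegative_L0 kernel_L0 one_not_ae_zero generalized_zero_modes
        stable_splitting allI impI) (elim conjE, rule no_growing_modes)
qed

end
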